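(* Let $\mathcal{A}$ be a $3$-ary algebra of type $\bullet_{3,3}$ over $\mathbb{K}$ and $V$ a $\mathbb{K}$-vector space. Then any linear map $f:V\to\mathcal{A}$ factorizes through a unique morphism of $3$-ary algebras $F:L(V,\bullet_{3,3})\to\mathcal{A}$; that is, there is a unique morphism of $3$-ary algebras $F:L(V,\bullet_{3,3})\to\mathcal{A}$ whose restriction to $L^1(V)=V$ is $f$.
   Context: $\mathbb{K}$ is a field of characteristic $0$. A $3$-ary algebra of type $\bullet_{3,3}$ (ternary partially associative algebra) is a $\mathbb{K}$-vector space $\mathcal A$ with a trilinear product $\mu$ satisfying $$\mu(\mu(a,b,c),d,e)+\mu(a,\mu(b,c,d),e)+\mu(a,b,\mu(c,d,e))=0 .$$ A morphism $(\mathcal A_1,\mu_1)\to(\mathcal A_2,\mu_2)$ is a linear map $g$ with $\mu_2(g(X),g(Y),g(Z))=g(\mu_1(X,Y,Z))$. The algebra $L(V,\bullet_{3,3})=\bigoplus_{p\ge 0}L^{2p+1}(V)$ is defined as follows. $L^1(V)=V$, $L^3(V)=V^{\otimes 3}$, and for $p\ge 2$ $$L^{2p+1}(V)=\Big(\bigoplus_{(a,b,c)\in D(2p+1,3)}L^a(V)\otimes L^b(V)\otimes L^c(V)\Big)\Big/R_{2p+1},$$ where $D(k,3)$ is the set of triples of odd positive integers $(a,b,c)$ with $a+b+c=k$. The product of homogeneous elements $a_1,a_2,a_3$ is the class of $a_1\otimes a_2\otimes a_3$; with it $L(V,\bullet_{3,3})$ is a $3$-ary algebra of type $\bullet_{3,3}$.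 Coding: a complete ternary bracketing of the word $v_1v_2\cdots v_{2p+1}$ (every bracket containing exactly three factors, the outermost bracket omitted, hence $p-1$ brackets) is coded by the positions of its left brackets: $g_{j_1,\dots,j_{p-1}}$ with $j_1\le j_2\le\dots\le j_{p-1}$ and $1\le j_l\le 2l+1$, where each $j_l$ means that a left bracket opens immediately before the letter number $j_l$. For example $1\cdot2\cdot(3\cdot4\cdot(5\cdot6\cdot7))$ is $g_{3,5}$. For $v_1,\dots,v_{2p+1}\in V$ the corresponding bracketed tensor is an element of $\bigoplus L^a(V)\otimes L^b(V)\otimes L^c(V)$. Relations: $R_5$ is spanned by the vectors coded by $g_1+g_2+g_3$, i.e. by all $(v_1\otimes v_2\otimes v_3)\otimes v_4\otimes v_5+v_1\otimes(v_2\otimes v_3\otimes v_4)\otimes v_5+v_1\otimes v_2\otimes(v_3\otimes v_4\otimes v_5)$. For $p\ge 3$, $R_{2p+1}$ is spanned by the vectors (for all choices of $v_1,\dots,v_{2p+1}\in V$) given by the coded relations obtained from the coded generating relations of $R_{2p-1}$ by the following two rules, applied to every term $g_{j_1,\dots,j_{p-2}}$ of the relation simultaneously: (a) for $i=1,2,3$, replace each $j_l$ by $j_l+(i-1)$ and add the index $i$ in front; (b) for $i=1,2,\dots,2p-1$, replace each $j_l$ with $j_l>i$ by $j_l+2$, keep each $j_l\le i$, add the index $i$, and rearrange the indices in nondecreasing order. *)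

theory Defs
  imports "HOL-Algebra.AbelCoset" "Jordan_Normal_Form.Missing_VectorSpace"
begin

section \<open>Ternary algebras and their morphisms\<close>

locale ternary_algebra = vectorspace K A for K (structure) and A (structure) +
  fixes \<mu> :: "'c \<Rightarrow> 'c \<Rightarrow> 'c \<Rightarrow> 'c"
  assumes linear_1: "\<lbrakk>y \<in> carrier A; z \<in> carrier A\<rbrakk> \<Longrightarrow> (\<lambda>x. \<mu> x y z) \<in> module_hom K A A"
    and linear_2: "\<lbrakk>x \<in> carrier A; z \<in> carrier A\<rbrakk> \<Longrightarrow> (\<lambda>y. \<mu> x y z) \<in> module_hom K A A"
    and linear_3: "\<lbrakk>x \<in> carrier A; y \<in> carrier A\<rbrakk> \<Longrightarrow> (\<lambda>z. \<mu> x y z) \<in> module_hom K A A"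

locale partially_associative_algebra = ternary_algebra +
  assumes partial_assoc:
    "\<lbrakk>a \<in> carrier A; b \<in> carrier A; c \<in> carrier A; d \<in> carrier A; e \<in> carrier A\<rbrakk> \<Longrightarrow>
      \<mu> (\<mu> a b c) d e \<oplus>\<^bsub>A\<^esub> \<mu> a (\<mu> b c d) e \<oplus>\<^bsub>A\<^esub> \<mu> a b (\<mu> c d e) = \<zero>\<^bsub>A\<^esub>"

locale ternary_algebra_hom =
  source: ternary_algebra K A \<mu> + target: ternary_algebra K B \<nu> + linear_map K A B g
  for K and A and \<mu> and B and \<nu> and g +
  assumes hom_product:
    "\<lbrakk>x \<in> carrier A; y \<in> carrier A; z \<in> carrier A\<rbrakk> \<Longrightarrow> \<nu> (g x) (g y) (g z) = g (\<mu> x y z)"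


section \<open>Direct sums, quotients and threefold tensor products\<close>

text \<open>The fields \<open>mult\<close> and \<open>one\<close> of the module record play no role for modules and are left
  undefined.\<close>

definition dsum :: "'i set \<Rightarrow> ('i \<Rightarrow> ('k, 'a) module) \<Rightarrow> ('k, 'i \<Rightarrow> 'a) module" where
  "dsum I M =
    \<lparr>carrier = {f \<in> \<Pi>\<^sub>E i\<in>I. carrier (M i). finite {i \<in> I. f i \<noteq> \<zero>\<^bsub>M i\<^esub>}},
     mult = undefined, one = undefined,
     zero = (\<lambda>i\<in>I. \<zero>\<^bsub>M i\<^esub>),
     add = (\<lambda>f g. \<lambda>i\<in>I. f i \<oplus>\<^bsub>M i\<^esub> g i),
     smult = (\<lambda>c f. \<lambda>i\<in>I. c \<odot>\<^bsub>M i\<^esub> f i)\<rparr>"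

definition dsum_in :: "'i set \<Rightarrow> ('i \<Rightarrow> ('k, 'a) module) \<Rightarrow> 'i \<Rightarrow> 'a \<Rightarrow> ('i \<Rightarrow> 'a)" where
  "dsum_in I M i x = (\<lambda>j\<in>I. if j = i then x else \<zero>\<^bsub>M j\<^esub>)"

definition quot_module :: "('k, 'a) module \<Rightarrow> 'a set \<Rightarrow> ('k, 'a set) module" where
  "quot_module M N =
    \<lparr>carrier = a_rcosets\<^bsub>M\<^esub> N,
     mult = undefined, one = undefined,
     zero = N,
     add = (\<lambda>X Y. X <+>\<^bsub>M\<^esub> Y),
     smult = (\<lambda>c X. \<Union>x\<in>X. N +>\<^bsub>M\<^esub> (c \<odot>\<^bsub>M\<^esub> x))\<rparr>"

text \<open>The copy of a module along a function that is injective on its carrier.\<close>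

definition copy_module :: "('a \<Rightarrow> 'b) \<Rightarrow> ('k, 'a) module \<Rightarrow> ('k, 'b) module" where
  "copy_module h M = (let h' = inv_into (carrier M) h in
    \<lparr>carrier = h ` carrier M,
     mult = undefined, one = undefined,
     zero = h \<zero>\<^bsub>M\<^esub>,
     add = (\<lambda>x y. h (h' x \<oplus>\<^bsub>M\<^esub> h' y)),
     smult = (\<lambda>c x. h (c \<odot>\<^bsub>M\<^esub> h' x))\<rparr>)"

definition ring_module :: "'k ring \<Rightarrow> ('k, 'k) module" where
  "ring_module K =
    \<lparr>carrier = carrier K, mult = mult K, one = one K, zero = zero K, add = add K,
     smult = mult K\<rparr>"

definition free_module :: "'k ring \<Rightarrow> 'a set \<Rightarrow> ('k, 'a \<Rightarrow> 'k) module" where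
  "free_module K S = dsum S (\<lambda>_. ring_module K)"

definition free_gen :: "'k ring \<Rightarrow> 'a set \<Rightarrow> 'a \<Rightarrow> ('a \<Rightarrow> 'k)" where
  "free_gen K S s = dsum_in S (\<lambda>_. ring_module K) s \<one>\<^bsub>K\<^esub>"

definition tensor3_rels :: "'k ring \<Rightarrow> ('k, 'a) module \<Rightarrow> ('k, 'b) module \<Rightarrow> ('k, 'c) module \<Rightarrow>
    ('a \<times> 'b \<times> 'c \<Rightarrow> 'k) set" where
  "tensor3_rels K A B C =
    (let S = carrier A \<times> carrier B \<times> carrier C; F = free_module K S; \<delta> = free_gen K S in
      {\<delta> (x \<oplus>\<^bsub>A\<^esub> x', y, z) \<ominus>\<^bsub>F\<^esub> (\<delta> (x, y, z) \<oplus>\<^bsub>F\<^esub> \<delta> (x', y, z)) | x x' y z.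
        x \<in> carrier A \<and> x' \<in> carrier A \<and> y \<in> carrier B \<and> z \<in> carrier C} \<union>
      {\<delta> (x, y \<oplus>\<^bsub>B\<^esub> y', z) \<ominus>\<^bsub>F\<^esub> (\<delta> (x, y, z) \<oplus>\<^bsub>F\<^esub> \<delta> (x, y', z)) | x y y' z.
        x \<in> carrier A \<and> y \<in> carrier B \<and> y' \<in> carrier B \<and> z \<in> carrier C} \<union>
      {\<delta> (x, y, z \<oplus>\<^bsub>C\<^esub> z') \<ominus>\<^bsub>F\<^esub> (\<delta> (x, y, z) \<oplus>\<^bsub>F\<^esub> \<delta> (x, y, z')) | x y z z'.
        x \<in> carrier A \<and> y \<in> carrier B \<and> z \<in> carrier C \<and> z' \<in> carrier C} \<union>
      {\<delta> (k \<odot>\<^bsub>A\<^esub> x, y, z) \<ominus>\<^bsub>F\<^esub> k \<odot>\<^bsub>F\<^esub> \<delta> (x, y, z) | k x y z.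
        k \<in> carrier K \<and> x \<in> carrier A \<and> y \<in> carrier B \<and> z \<in> carrier C} \<union>
      {\<delta> (x, k \<odot>\<^bsub>B\<^esub> y, z) \<ominus>\<^bsub>F\<^esub> k \<odot>\<^bsub>F\<^esub> \<delta> (x, y, z) | k x y z.
        k \<in> carrier K \<and> x \<in> carrier A \<and> y \<in> carrier B \<and> z \<in> carrier C} \<union>
      {\<delta> (x, y, k \<odot>\<^bsub>C\<^esub> z) \<ominus>\<^bsub>F\<^esub> k \<odot>\<^bsub>F\<^esub> \<delta> (x, y, z) | k x y z.
        k \<in> carrier K \<and> x \<in> carrier A \<and> y \<in> carrier B \<and> z \<in> carrier C})"

definition tensor3_null :: "'k ring \<Rightarrow> ('k, 'a) module \<Rightarrow> ('k, 'b) module \<Rightarrow> ('k, 'c) module \<Rightarrow>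
    ('a \<times> 'b \<times> 'c \<Rightarrow> 'k) set" where
  "tensor3_null K A B C =
    LinearCombinations.module.span K (free_module K (carrier A \<times> carrier B \<times> carrier C))
      (tensor3_rels K A B C)"

definition tensor3 :: "'k ring \<Rightarrow> ('k, 'a) module \<Rightarrow> ('k, 'b) module \<Rightarrow> ('k, 'c) module \<Rightarrow>
    ('k, ('a \<times> 'b \<times> 'c \<Rightarrow> 'k) set) module" where
  "tensor3 K A B C =
    quot_module (free_module K (carrier A \<times> carrier B \<times> carrier C)) (tensor3_null K A B C)"

definition pure3 :: "'k ring \<Rightarrow> ('k, 'a) module \<Rightarrow> ('k, 'b) module \<Rightarrow> ('k, 'c) module \<Rightarrow>
    'a \<Rightarrow> 'b \<Rightarrow> 'c \<Rightarrow> ('a \<times> 'b \<times> 'c \<Rightarrow> 'k) set" where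
  "pure3 K A B C x y z =
    (let S = carrier A \<times> carrier B \<times> carrier C in
      tensor3_null K A B C +>\<^bsub>free_module K S\<^esub> free_gen K S (x, y, z))"


section \<open>Coded ternary bracketings and coded relations\<close>

datatype 'v bracketing = Letter 'v | Bracket "'v bracketing" "'v bracketing" "'v bracketing"

fun letters :: "'v bracketing \<Rightarrow> 'v list" where
  "letters (Letter v) = [v]"
| "letters (Bracket s t u) = letters s @ letters t @ letters u"

abbreviation deg :: "'v bracketing \<Rightarrow> nat" where
  "deg t \<equiv> length (letters t)"

text \<open>The positions of the left brackets, from left to right and including the outermost one, when
  the first letter has number \<open>m\<close>. A left bracket has the number of the letter it precedes.\<close>

fun left_brackets :: "nat \<Rightarrow> 'v bracketing \<Rightarrow> nat list" where
  "left_brackets m (Letter v) = []"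
| "left_brackets m (Bracket s t u) =
    m # left_brackets m s @ left_brackets (m + deg s) t @ left_brackets (m + deg s + deg t) u"

definition code :: "'v bracketing \<Rightarrow> nat list" where
  "code t = tl (left_brackets 1 t)"

lemma code_example: "code (Bracket (Letter 1) (Letter 2) (Bracket (Letter 3) (Letter 4)
    (Bracket (Letter 5) (Letter 6) (Letter (7::nat))))) = [3, 5]"
  by (simp add: code_def)

definition decode :: "nat list \<Rightarrow> 'v list \<Rightarrow> 'v bracketing" where
  "decode js vs = (THE t. letters t = vs \<and> code t = js)"

definition wrap_code :: "nat \<Rightarrow> nat list \<Rightarrow> nat list" where
  "wrap_code i js = i # map (\<lambda>j. j + (i - 1)) js"

definition graft_code :: "nat \<Rightarrow> nat list \<Rightarrow> nat list" where
  "graft_code i js = sort (i # map (\<lambda>j. if j > i then j + 2 else j) js)"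

text \<open>\<open>coded_rel p r\<close>: the list \<open>r\<close> of codes stands for the formal sum of its members, one of the
  generating relations in degree \<open>2 * p + 1\<close>.\<close>

inductive coded_rel :: "nat \<Rightarrow> nat list list \<Rightarrow> bool" where
  base: "coded_rel 2 [[1], [2], [3]]"
| wrap: "coded_rel p r \<Longrightarrow> i \<in> {1..3} \<Longrightarrow> coded_rel (Suc p) (map (wrap_code i) r)"
| graft: "coded_rel p r \<Longrightarrow> i \<in> {1..2 * p + 1} \<Longrightarrow> coded_rel (Suc p) (map (graft_code i) r)"


section \<open>The graded pieces\<close>

text \<open>The degree \<open>2 * p + 1\<close> piece is a space of cosets in a direct sum of tensor products of lower
  pieces. To have all pieces in one type, each coset is renamed to a formal linear combination of
  pure tensors \<open>k (x \<otimes> y \<otimes> z)\<close>, tagged with the degrees of \<open>x\<close>, \<open>y\<close>, \<open>z\<close>, that represents it. Only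
  the injectivity of the renaming matters.\<close>

datatype ('k, 'v) elem =
    Gen 'v
  | Comb "((nat \<times> nat \<times> nat) \<times> 'k \<times> ('k, 'v) elem \<times> ('k, 'v) elem \<times> ('k, 'v) elem) list"

type_synonym ('k, 'v) pieces = "nat \<Rightarrow> ('k, ('k, 'v) elem) module"

text \<open>The product of homogeneous elements, indexed by the triple of their degrees.\<close>

type_synonym ('k, 'v) products =
  "nat \<times> nat \<times> nat \<Rightarrow> ('k, 'v) elem \<Rightarrow> ('k, 'v) elem \<Rightarrow> ('k, 'v) elem \<Rightarrow> ('k, 'v) elem"

type_synonym ('k, 'v) tensors =
  "nat \<times> nat \<times> nat \<Rightarrow> (('k, 'v) elem \<times> ('k, 'v) elem \<times> ('k, 'v) elem \<Rightarrow> 'k) set"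

definition odd_triples :: "nat \<Rightarrow> (nat \<times> nat \<times> nat) set" where
  "odd_triples n = {(a, b, c). odd a \<and> odd b \<and> odd c \<and> a + b + c = n}"

definition tensor_at :: "'k ring \<Rightarrow> ('k, 'v) pieces \<Rightarrow> nat \<times> nat \<times> nat \<Rightarrow>
    ('k, (('k, 'v) elem \<times> ('k, 'v) elem \<times> ('k, 'v) elem \<Rightarrow> 'k) set) module" where
  "tensor_at K L = (\<lambda>(a, b, c). tensor3 K (L a) (L b) (L c))"

definition tensor_sum :: "'k ring \<Rightarrow> ('k, 'v) pieces \<Rightarrow> nat \<Rightarrow> ('k, ('k, 'v) tensors) module" where
  "tensor_sum K L n = dsum (odd_triples n) (tensor_at K L)"

definition pure_tensor :: "'k ring \<Rightarrow> ('k, 'v) pieces \<Rightarrow> nat \<Rightarrow> nat \<times> nat \<times> nat \<Rightarrow>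
    ('k, 'v) elem \<Rightarrow> ('k, 'v) elem \<Rightarrow> ('k, 'v) elem \<Rightarrow> ('k, 'v) tensors" where
  "pure_tensor K L n = (\<lambda>(a, b, c) x y z.
    dsum_in (odd_triples n) (tensor_at K L) (a, b, c) (pure3 K (L a) (L b) (L c) x y z))"

fun bracket_value :: "('k, 'v) products \<Rightarrow> 'v bracketing \<Rightarrow> ('k, 'v) elem" where
  "bracket_value P (Letter v) = Gen v"
| "bracket_value P (Bracket s t u) =
    P (deg s, deg t, deg u) (bracket_value P s) (bracket_value P t) (bracket_value P u)"

text \<open>Only the inner brackets are evaluated. A single letter is not a bracketed tensor.\<close>

fun bracketed_tensor :: "'k ring \<Rightarrow> ('k, 'v) pieces \<Rightarrow> ('k, 'v) products \<Rightarrow> 'v bracketing \<Rightarrow>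
    ('k, 'v) tensors" where
  "bracketed_tensor K L P (Letter v) = undefined"
| "bracketed_tensor K L P (Bracket s t u) =
    pure_tensor K L (deg s + deg t + deg u) (deg s, deg t, deg u)
      (bracket_value P s) (bracket_value P t) (bracket_value P u)"

text \<open>There is no coded relation for \<open>p = 1\<close>, so \<open>relation_space\<close> is zero in degree 3.\<close>

definition relation_space :: "'k ring \<Rightarrow> ('k, 'v) module \<Rightarrow> ('k, 'v) pieces \<Rightarrow> ('k, 'v) products \<Rightarrow>
    nat \<Rightarrow> ('k, 'v) tensors set" where
  "relation_space K V L P p =
    (let T = tensor_sum K L (2 * p + 1) in
      LinearCombinations.module.span K T
        {foldr (\<lambda>js w. bracketed_tensor K L P (decode js vs) \<oplus>\<^bsub>T\<^esub> w) r \<zero>\<^bsub>T\<^esub> | r vs.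
          coded_rel p r \<and> set vs \<subseteq> carrier V \<and> length vs = 2 * p + 1})"

definition eval_comb :: "'k ring \<Rightarrow> ('k, 'v) pieces \<Rightarrow> nat \<Rightarrow>
    ((nat \<times> nat \<times> nat) \<times> 'k \<times> ('k, 'v) elem \<times> ('k, 'v) elem \<times> ('k, 'v) elem) list \<Rightarrow>
    ('k, 'v) tensors" where
  "eval_comb K L n ts =
    (let T = tensor_sum K L n in
      foldr (\<lambda>(d, k, x, y, z) w. k \<odot>\<^bsub>T\<^esub> pure_tensor K L n d x y z \<oplus>\<^bsub>T\<^esub> w) ts \<zero>\<^bsub>T\<^esub>)"

definition name_coset :: "'k ring \<Rightarrow> ('k, 'v) pieces \<Rightarrow> nat \<Rightarrow> ('k, 'v) tensors set \<Rightarrow> ('k, 'v) elem"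
  where "name_coset K L n X = Comb (SOME ts. eval_comb K L n ts \<in> X)"

text \<open>Adjoin the piece of degree \<open>2 * p + 1\<close> and the products with values in it.\<close>

definition next_piece :: "'k ring \<Rightarrow> ('k, 'v) module \<Rightarrow> nat \<Rightarrow> ('k, 'v) pieces \<times> ('k, 'v) products \<Rightarrow>
    ('k, 'v) pieces \<times> ('k, 'v) products" where
  "next_piece K V p = (\<lambda>(L, P).
    let n = 2 * p + 1; T = tensor_sum K L n; R = relation_space K V L P p in
      (L(n := copy_module (name_coset K L n) (quot_module T R)),
       \<lambda>(a, b, c) x y z.
         if a + b + c = n then name_coset K L n (R +>\<^bsub>T\<^esub> pure_tensor K L n (a, b, c) x y z)
         else P (a, b, c) x y z))"

text \<open>\<open>tower K V p\<close> is meaningful in odd degrees up to \<open>2 * p + 1\<close>.\<close>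

primrec tower :: "'k ring \<Rightarrow> ('k, 'v) module \<Rightarrow> nat \<Rightarrow> ('k, 'v) pieces \<times> ('k, 'v) products" where
  "tower K V 0 = (\<lambda>_. copy_module Gen V, \<lambda>_ _ _ _. undefined)"
| "tower K V (Suc p) = next_piece K V (Suc p) (tower K V p)"

definition piece :: "'k ring \<Rightarrow> ('k, 'v) module \<Rightarrow> ('k, 'v) pieces" where
  "piece K V n = fst (tower K V (n div 2)) n"

definition piece_product :: "'k ring \<Rightarrow> ('k, 'v) module \<Rightarrow> ('k, 'v) products" where
  "piece_product K V = (\<lambda>(a, b, c). snd (tower K V ((a + b + c) div 2)) (a, b, c))"


section \<open>The algebra $L(V, \bullet_{3,3})$\<close>

definition free_algebra :: "'k ring \<Rightarrow> ('k, 'v) module \<Rightarrow> ('k, nat \<Rightarrow> ('k, 'v) elem) module" where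
  "free_algebra K V = dsum {n. odd n} (piece K V)"

definition free_product :: "'k ring \<Rightarrow> ('k, 'v) module \<Rightarrow> (nat \<Rightarrow> ('k, 'v) elem) \<Rightarrow>
    (nat \<Rightarrow> ('k, 'v) elem) \<Rightarrow> (nat \<Rightarrow> ('k, 'v) elem) \<Rightarrow> (nat \<Rightarrow> ('k, 'v) elem)" where
  "free_product K V x y z =
    (\<lambda>n\<in>{n. odd n}. finsum (piece K V n)
      (\<lambda>(a, b, c). piece_product K V (a, b, c) (x a) (y b) (z c)) (odd_triples n))"

definition free_inclusion :: "'k ring \<Rightarrow> ('k, 'v) module \<Rightarrow> 'v \<Rightarrow> (nat \<Rightarrow> ('k, 'v) elem)" where
  "free_inclusion K V v = dsum_in {n. odd n} (piece K V) 1 (Gen v)"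

end

theory Submission
  imports Defs
begin

text \<open>Up to the renaming of cosets, the piece of degree \<open>2 * p + 1\<close> is the quotient of a sum of tensor
  products of lower pieces, so a linear map out of it amounts to a family of trilinear maps on lower
  pieces whose joint extension kills the relations. If the morphism is already a map \<open>G\<close> on the lower
  pieces, the family has to be \<open>\<mu> (G x) (G y) (G z)\<close>. Its extension sends a bracketed tensor to the
  value of the bracketing in the target algebra, and there every coded relation evaluates to zero, by
  induction along the two rules: rule (a) inserts a vanishing sum into a product with two letters, and
  rule (b) evaluates a shorter relation at a word in which one letter is itself a product. Uniqueness
  holds because products of elements of lower degree span every piece of degree greater than 1.\<close>

text \<open>Coded relations are first evaluated at words whose letters are elements of the target
  algebra, read by \<open>id\<close>: rule (b) calls for a letter \<open>\<mu> a b c\<close>, which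
  need not lie in the range of \<open>f\<close>. Renaming letters leaves codes unchanged, and this
  carries the result back to words in \<open>V\<close>. Since \<open>decode\<close> is a definite
  description, every code generated by the two rules must be shown to belong to exactly one
  bracketing of a word of the right length. Construction and good behaviour of the pieces are
  intertwined. That the relators lie in the tensor sum of degree \<open>n\<close>, and hence that
  their span is a submodule and the quotient a module, rests on the lower pieces being modules with
  trilinear products landing in them. The predicate \<open>regular_below\<close> carries this
  through an induction on the degree. In the same way the map out of the piece of degree
  \<open>n\<close> can be obtained only after the maps below \<open>n\<close> are fixed, so the
  family of maps is chosen by well-founded recursion.\<close>

section \<open>Linear maps: kernels, images and factorization\<close>

lemma module_homI:
  assumes "\<And>x. x \<in> carrier M \<Longrightarrow> f x \<in> carrier N"
    and "\<And>x y. x \<in> carrier M \<Longrightarrow> y \<in> carrier M \<Longrightarrow> f (x \<oplus>\<^bsub>M\<^esub> y) = f x \<oplus>\<^bsub>N\<^esub> f y"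
    and "\<And>c x. c \<in> carrier K \<Longrightarrow> x \<in> carrier M \<Longrightarrow> f (c \<odot>\<^bsub>M\<^esub> x) = c \<odot>\<^bsub>N\<^esub> f x"
  shows "f \<in> module_hom K M N"
  using assms by (auto simp: module_hom_def)

lemma module_hom_mem: "f \<in> module_hom K M N \<Longrightarrow> x \<in> carrier M \<Longrightarrow> f x \<in> carrier N"
  by (auto simp: module_hom_def)

lemma module_hom_zero:
  assumes "module K M" "module K N" "f \<in> module_hom K M N"
  shows "f \<zero>\<^bsub>M\<^esub> = \<zero>\<^bsub>N\<^esub>"
proof -
  interpret mod_hom K M N f using assms by (simp add: mod_hom_def mod_hom_axioms_def)
  show ?thesis by (rule f0_is_0)
qed

lemma module_hom_comp:
  assumes "f \<in> module_hom K M N" "g \<in> module_hom K N L"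
  shows "(\<lambda>x. g (f x)) \<in> module_hom K M L"
  using assms by (auto simp: module_hom_def Pi_iff)

text \<open>The kernel is a submodule, so it contains the span of any set it contains.\<close>

lemma module_hom_span_zero:
  assumes M: "module K M" and N: "module K N" and f: "f \<in> module_hom K M N"
    and S: "S \<subseteq> carrier M" "\<And>s. s \<in> S \<Longrightarrow> f s = \<zero>\<^bsub>N\<^esub>"
    and x: "x \<in> LinearCombinations.module.span K M S"
  shows "f x = \<zero>\<^bsub>N\<^esub>"
proof -
  interpret mod_hom K M N f using M N f by (simp add: mod_hom_def mod_hom_axioms_def)
  have "M.span S \<subseteq> ker"
    by (rule M.span_is_subset[OF _ ker_is_submodule]) (use S in \<open>auto simp: ker_def\<close>)
  then show ?thesis using x by (auto simp: ker_def)
qed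

text \<open>Each module law in \<open>Q\<close> is the image of the same law in \<open>M\<close>,
  and inverses are images of inverses. This one transfer serves both quotients and renamed copies.
  The zero of \<open>Q\<close> is tied to \<open>f\<close> by assumption because it is a separate
  record field, and no group law of \<open>Q\<close> is available yet to force it.\<close>

lemma module_hom_image:
  assumes M: "module K M" and f: "f \<in> module_hom K M Q"
    and surj: "f ` carrier M = carrier Q" and zero: "f \<zero>\<^bsub>M\<^esub> = \<zero>\<^bsub>Q\<^esub>"
  shows "module K Q"
proof -
  interpret M: module K M by fact
  have fa: "\<And>x y. x \<in> carrier M \<Longrightarrow> y \<in> carrier M \<Longrightarrow> f x \<oplus>\<^bsub>Q\<^esub> f y = f (x \<oplus>\<^bsub>M\<^esub> y)"
    and fs: "\<And>c x. c \<in> carrier K \<Longrightarrow> x \<in> carrier M \<Longrightarrow> c \<odot>\<^bsub>Q\<^esub> f x = f (c \<odot>\<^bsub>M\<^esub> x)"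
    using f by (auto simp: module_hom_def)
  have neg: "\<exists>y\<in>carrier M. f x \<oplus>\<^bsub>Q\<^esub> f y = f \<zero>\<^bsub>M\<^esub>" if "x \<in> carrier M" for x
    using that by (intro bexI[of _ "\<ominus>\<^bsub>M\<^esub> x"]) (auto simp: fa M.r_neg)
  have all: "(\<forall>q\<in>carrier Q. P q) \<longleftrightarrow> (\<forall>x\<in>carrier M. P (f x))" for P
    unfolding surj[symmetric] by blast
  show ?thesis
  proof (rule module_criteria[OF M.is_cring])
    show "\<zero>\<^bsub>Q\<^esub> \<in> carrier Q" unfolding zero[symmetric] surj[symmetric] by simp
    show "\<forall>v\<in>carrier Q. \<exists>w\<in>carrier Q. v \<oplus>\<^bsub>Q\<^esub> w = \<zero>\<^bsub>Q\<^esub>"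
    proof
      fix v assume "v \<in> carrier Q"
      then obtain x where x: "x \<in> carrier M" "v = f x" using surj by auto
      then obtain y where "y \<in> carrier M" "f x \<oplus>\<^bsub>Q\<^esub> f y = \<zero>\<^bsub>Q\<^esub>" using neg zero by auto
      then show "\<exists>w\<in>carrier Q. v \<oplus>\<^bsub>Q\<^esub> w = \<zero>\<^bsub>Q\<^esub>" using x surj by auto
    qed
    show "\<forall>v w. v \<in> carrier Q \<and> w \<in> carrier Q \<longrightarrow> v \<oplus>\<^bsub>Q\<^esub> w \<in> carrier Q"
      unfolding surj[symmetric] by (auto simp: fa)
    show "\<forall>c v. c \<in> carrier K \<and> v \<in> carrier Q \<longrightarrow> c \<odot>\<^bsub>Q\<^esub> v \<in> carrier Q"
      unfolding surj[symmetric] by (auto simp: fs)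
    show "\<forall>v w. v \<in> carrier Q \<and> w \<in> carrier Q \<longrightarrow> v \<oplus>\<^bsub>Q\<^esub> w = w \<oplus>\<^bsub>Q\<^esub> v"
      unfolding surj[symmetric] by (auto simp: fa M.a_comm)
    show "\<forall>v w x. v \<in> carrier Q \<and> w \<in> carrier Q \<and> x \<in> carrier Q \<longrightarrow>
        v \<oplus>\<^bsub>Q\<^esub> w \<oplus>\<^bsub>Q\<^esub> x = v \<oplus>\<^bsub>Q\<^esub> (w \<oplus>\<^bsub>Q\<^esub> x)"
      unfolding surj[symmetric] by (auto simp: fa M.a_assoc)
    show "\<forall>v\<in>carrier Q. v \<oplus>\<^bsub>Q\<^esub> \<zero>\<^bsub>Q\<^esub> = v"
      unfolding all zero[symmetric] by (simp add: fa)
    show "\<forall>a b v. a \<in> carrier K \<and> b \<in> carrier K \<and> v \<in> carrier Q \<longrightarrow>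
        (a \<otimes>\<^bsub>K\<^esub> b) \<odot>\<^bsub>Q\<^esub> v = a \<odot>\<^bsub>Q\<^esub> (b \<odot>\<^bsub>Q\<^esub> v)"
      unfolding surj[symmetric] by (auto simp: fs M.smult_assoc1)
    show "\<forall>v\<in>carrier Q. \<one>\<^bsub>K\<^esub> \<odot>\<^bsub>Q\<^esub> v = v"
      unfolding all by (simp add: fs)
    show "\<forall>a b v. a \<in> carrier K \<and> b \<in> carrier K \<and> v \<in> carrier Q \<longrightarrow>
        (a \<oplus>\<^bsub>K\<^esub> b) \<odot>\<^bsub>Q\<^esub> v = a \<odot>\<^bsub>Q\<^esub> v \<oplus>\<^bsub>Q\<^esub> b \<odot>\<^bsub>Q\<^esub> v"
      unfolding surj[symmetric] by (auto simp: fa fs M.smult_l_distr)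
    show "\<forall>a v w. a \<in> carrier K \<and> v \<in> carrier Q \<and> w \<in> carrier Q \<longrightarrow>
        a \<odot>\<^bsub>Q\<^esub> (v \<oplus>\<^bsub>Q\<^esub> w) = a \<odot>\<^bsub>Q\<^esub> v \<oplus>\<^bsub>Q\<^esub> a \<odot>\<^bsub>Q\<^esub> w"
      unfolding surj[symmetric] by (auto simp: fa fs M.smult_r_distr)
  qed
qed

text \<open>The map \<open>g\<close> evaluates \<open>f\<close> at a chosen preimage. The choice is
  harmless: two preimages of one element differ by an element of the kernel of \<open>p\<close>,
  where \<open>f\<close> vanishes.\<close>

lemma module_hom_factor:
  assumes M: "module K M" and Q: "module K Q" and N: "module K N"
    and p: "p \<in> module_hom K M Q" and surj: "p ` carrier M = carrier Q"
    and f: "f \<in> module_hom K M N"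
    and ker: "\<And>x. x \<in> carrier M \<Longrightarrow> p x = \<zero>\<^bsub>Q\<^esub> \<Longrightarrow> f x = \<zero>\<^bsub>N\<^esub>"
  shows "\<exists>g\<in>module_hom K Q N. \<forall>x\<in>carrier M. g (p x) = f x"
proof -
  interpret p: mod_hom K M Q p using M Q p by (simp add: mod_hom_def mod_hom_axioms_def)
  interpret f: mod_hom K M N f using M N f by (simp add: mod_hom_def mod_hom_axioms_def)
  note N' = module.axioms(2)[OF N]
  define g where "g q = f (inv_into (carrier M) p q)" for q
  have eq: "f x = f y" if xy: "x \<in> carrier M" "y \<in> carrier M" "p x = p y" for x y
  proof -
    have "p (x \<ominus>\<^bsub>M\<^esub> y) = p x \<ominus>\<^bsub>Q\<^esub> p y" using xy by simp
    also have "\<dots> = \<zero>\<^bsub>Q\<^esub>" using xy by (simp add: a_minus_def abelian_group.r_neg[OF module.axioms(2)[OF Q]])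
    finally have "f (x \<ominus>\<^bsub>M\<^esub> y) = \<zero>\<^bsub>N\<^esub>" using ker xy by simp
    then have "f x \<ominus>\<^bsub>N\<^esub> f y = \<zero>\<^bsub>N\<^esub>" using xy by simp
    then show ?thesis
      using abelian_group.minus_equality[OF N', of "f x" "\<ominus>\<^bsub>N\<^esub> f y"] xy
      by (simp add: a_minus_def abelian_group.minus_minus[OF N'] abelian_group.a_inv_closed[OF N'])
  qed
  have gp: "g (p x) = f x" if "x \<in> carrier M" for x
    unfolding g_def
    using that by (intro eq) (auto simp: inv_into_into f_inv_into_f)
  have "g \<in> module_hom K Q N"
  proof (rule module_homI)
    fix x assume "x \<in> carrier Q"
    then show "g x \<in> carrier N" unfolding surj[symmetric] by (auto simp: gp)
  next
    fix x y assume "x \<in> carrier Q" "y \<in> carrier Q"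
    then obtain a b where "x = p a" "y = p b" "a \<in> carrier M" "b \<in> carrier M"
      unfolding surj[symmetric] by blast
    then show "g (x \<oplus>\<^bsub>Q\<^esub> y) = g x \<oplus>\<^bsub>N\<^esub> g y"
      by (simp add: gp flip: p.f_add)
  next
    fix c x assume "c \<in> carrier K" "x \<in> carrier Q"
    then obtain a where "x = p a" "a \<in> carrier M" using surj by auto
    then show "g (c \<odot>\<^bsub>Q\<^esub> x) = c \<odot>\<^bsub>N\<^esub> g x"
      using \<open>c \<in> carrier K\<close> by (simp add: gp flip: p.f_smult)
  qed
  then show ?thesis using gp by (intro bexI[of _ g]) auto
qed


section \<open>Direct sums\<close>

lemma carrier_dsum:
  "x \<in> carrier (dsum I M) \<longleftrightarrow>
    x \<in> extensional I \<and> (\<forall>i\<in>I. x i \<in> carrier (M i)) \<and> finite {i \<in> I. x i \<noteq> \<zero>\<^bsub>M i\<^esub>}"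
  by (auto simp: dsum_def PiE_iff)

lemma dsum_zero: "\<zero>\<^bsub>dsum I M\<^esub> = (\<lambda>i\<in>I. \<zero>\<^bsub>M i\<^esub>)"
  by (simp add: dsum_def)

lemma dsum_add: "x \<oplus>\<^bsub>dsum I M\<^esub> y = (\<lambda>i\<in>I. x i \<oplus>\<^bsub>M i\<^esub> y i)"
  by (simp add: dsum_def)

lemma dsum_smult: "c \<odot>\<^bsub>dsum I M\<^esub> x = (\<lambda>i\<in>I. c \<odot>\<^bsub>M i\<^esub> x i)"
  by (simp add: dsum_def)

lemma module_dsum:
  assumes K: "cring K" and M: "\<And>i. i \<in> I \<Longrightarrow> module K (M i)"
  shows "module K (dsum I M)"
proof -
  note ag = module.axioms(2)[OF M]
  note am = abelian_group.axioms(1)[OF ag]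
  have minus_zero: "\<ominus>\<^bsub>M i\<^esub> \<zero>\<^bsub>M i\<^esub> = \<zero>\<^bsub>M i\<^esub>" if "i \<in> I" for i
    using abelian_group.minus_equality[OF ag[OF that]] abelian_monoid.zero_closed[OF am[OF that]]
      abelian_monoid.l_zero[OF am[OF that]] by blast
  have fin_add: "finite {i \<in> I. (x \<oplus>\<^bsub>dsum I M\<^esub> y) i \<noteq> \<zero>\<^bsub>M i\<^esub>}"
    if "x \<in> carrier (dsum I M)" "y \<in> carrier (dsum I M)" for x y
    by (rule finite_subset[of _ "{i \<in> I. x i \<noteq> \<zero>\<^bsub>M i\<^esub>} \<union> {i \<in> I. y i \<noteq> \<zero>\<^bsub>M i\<^esub>}"])
      (use that in \<open>auto simp: carrier_dsum dsum_add abelian_monoid.l_zero[OF am] abelian_monoid.zero_closed[OF am]\<close>)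
  have fin_smult: "finite {i \<in> I. (c \<odot>\<^bsub>dsum I M\<^esub> x) i \<noteq> \<zero>\<^bsub>M i\<^esub>}"
    if "x \<in> carrier (dsum I M)" "c \<in> carrier K" for x c
    by (rule finite_subset[of _ "{i \<in> I. x i \<noteq> \<zero>\<^bsub>M i\<^esub>}"])
      (use that in \<open>auto simp: carrier_dsum dsum_smult module.smult_r_null[OF M]\<close>)
  show ?thesis
  proof (rule module_criteria)
    show "\<forall>v\<in>carrier (dsum I M). \<exists>w\<in>carrier (dsum I M). v \<oplus>\<^bsub>dsum I M\<^esub> w = \<zero>\<^bsub>dsum I M\<^esub>"
    proof
      fix v assume v: "v \<in> carrier (dsum I M)"
      have "(\<lambda>i\<in>I. \<ominus>\<^bsub>M i\<^esub> v i) \<in> carrier (dsum I M)"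
      proof -
        have "finite {i \<in> I. (\<lambda>i\<in>I. \<ominus>\<^bsub>M i\<^esub> v i) i \<noteq> \<zero>\<^bsub>M i\<^esub>}"
          by (rule finite_subset[of _ "{i \<in> I. v i \<noteq> \<zero>\<^bsub>M i\<^esub>}"])
            (use v in \<open>auto simp: carrier_dsum minus_zero\<close>)
        then show ?thesis using v by (auto simp: carrier_dsum abelian_group.a_inv_closed[OF ag])
      qed
      moreover have "v \<oplus>\<^bsub>dsum I M\<^esub> (\<lambda>i\<in>I. \<ominus>\<^bsub>M i\<^esub> v i) = \<zero>\<^bsub>dsum I M\<^esub>"
        using v by (auto simp: dsum_add dsum_zero carrier_dsum abelian_group.r_neg[OF ag] intro!: restrict_ext)
      ultimately show "\<exists>w\<in>carrier (dsum I M). v \<oplus>\<^bsub>dsum I M\<^esub> w = \<zero>\<^bsub>dsum I M\<^esub>" by blast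
    qed
    show "\<forall>v w. v \<in> carrier (dsum I M) \<and> w \<in> carrier (dsum I M) \<longrightarrow>
        v \<oplus>\<^bsub>dsum I M\<^esub> w \<in> carrier (dsum I M)"
      using fin_add by (auto simp: carrier_dsum) (auto simp: dsum_add abelian_monoid.a_closed[OF am])
    show "\<forall>c v. c \<in> carrier K \<and> v \<in> carrier (dsum I M) \<longrightarrow> c \<odot>\<^bsub>dsum I M\<^esub> v \<in> carrier (dsum I M)"
      using fin_smult by (auto simp: carrier_dsum) (auto simp: dsum_smult module.smult_closed[OF M])
    show "\<forall>v w. v \<in> carrier (dsum I M) \<and> w \<in> carrier (dsum I M) \<longrightarrow>
        v \<oplus>\<^bsub>dsum I M\<^esub> w = w \<oplus>\<^bsub>dsum I M\<^esub> v"
      by (auto simp: carrier_dsum dsum_add intro!: restrict_ext abelian_monoid.a_comm[OF am])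
    show "\<zero>\<^bsub>dsum I M\<^esub> \<in> carrier (dsum I M)"
      by (auto simp: carrier_dsum dsum_zero abelian_monoid.zero_closed[OF am])
    show "\<forall>v\<in>carrier (dsum I M). v \<oplus>\<^bsub>dsum I M\<^esub> \<zero>\<^bsub>dsum I M\<^esub> = v"
      by (auto simp: carrier_dsum dsum_add dsum_zero abelian_monoid.r_zero[OF am] extensional_def)
    show "\<forall>v\<in>carrier (dsum I M). \<one>\<^bsub>K\<^esub> \<odot>\<^bsub>dsum I M\<^esub> v = v"
      by (auto simp: carrier_dsum dsum_smult module.smult_one[OF M] extensional_def)
    show "\<forall>u v w. u \<in> carrier (dsum I M) \<and> v \<in> carrier (dsum I M) \<and> w \<in> carrier (dsum I M) \<longrightarrow>
        u \<oplus>\<^bsub>dsum I M\<^esub> v \<oplus>\<^bsub>dsum I M\<^esub> w = u \<oplus>\<^bsub>dsum I M\<^esub> (v \<oplus>\<^bsub>dsum I M\<^esub> w)"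
      by (auto simp: carrier_dsum dsum_add intro!: restrict_ext abelian_monoid.a_assoc[OF am])
    show "\<forall>a b v. a \<in> carrier K \<and> b \<in> carrier K \<and> v \<in> carrier (dsum I M) \<longrightarrow>
        (a \<otimes>\<^bsub>K\<^esub> b) \<odot>\<^bsub>dsum I M\<^esub> v = a \<odot>\<^bsub>dsum I M\<^esub> (b \<odot>\<^bsub>dsum I M\<^esub> v)"
      by (auto simp: carrier_dsum dsum_smult intro!: restrict_ext module.smult_assoc1[OF M])
    show "\<forall>a b v. a \<in> carrier K \<and> b \<in> carrier K \<and> v \<in> carrier (dsum I M) \<longrightarrow>
        (a \<oplus>\<^bsub>K\<^esub> b) \<odot>\<^bsub>dsum I M\<^esub> v = a \<odot>\<^bsub>dsum I M\<^esub> v \<oplus>\<^bsub>dsum I M\<^esub> b \<odot>\<^bsub>dsum I M\<^esub> v"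
      by (auto simp: carrier_dsum dsum_add dsum_smult intro!: restrict_ext module.smult_l_distr[OF M])
    show "\<forall>a v w. a \<in> carrier K \<and> v \<in> carrier (dsum I M) \<and> w \<in> carrier (dsum I M) \<longrightarrow>
        a \<odot>\<^bsub>dsum I M\<^esub> (v \<oplus>\<^bsub>dsum I M\<^esub> w) = a \<odot>\<^bsub>dsum I M\<^esub> v \<oplus>\<^bsub>dsum I M\<^esub> a \<odot>\<^bsub>dsum I M\<^esub> w"
      by (auto simp: carrier_dsum dsum_add dsum_smult intro!: restrict_ext module.smult_r_distr[OF M])
  qed (rule K)
qed

lemma dsum_in_closed:
  assumes "\<And>i. i \<in> I \<Longrightarrow> module K (M i)" "i \<in> I" "x \<in> carrier (M i)"
  shows "dsum_in I M i x \<in> carrier (dsum I M)"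
proof -
  have "\<And>j. j \<in> I \<Longrightarrow> \<zero>\<^bsub>M j\<^esub> \<in> carrier (M j)"
    using assms(1) by (meson abelian_groupE(2) module.axioms(2))
  moreover have "finite {j \<in> I. dsum_in I M i x j \<noteq> \<zero>\<^bsub>M j\<^esub>}"
    by (rule finite_subset[of _ "{i}"]) (auto simp: dsum_in_def)
  ultimately show ?thesis using assms(2,3) by (auto simp: carrier_dsum dsum_in_def)
qed

lemma dsum_in_hom:
  assumes M: "\<And>i. i \<in> I \<Longrightarrow> module K (M i)" and i: "i \<in> I"
  shows "dsum_in I M i \<in> module_hom K (M i) (dsum I M)"
proof (rule module_homI)
  note ag = module.axioms(2)[OF M]
  note am = abelian_group.axioms(1)[OF ag]
  fix x y assume "x \<in> carrier (M i)" "y \<in> carrier (M i)"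
  then show "dsum_in I M i (x \<oplus>\<^bsub>M i\<^esub> y) = dsum_in I M i x \<oplus>\<^bsub>dsum I M\<^esub> dsum_in I M i y"
    by (auto simp: dsum_in_def dsum_add abelian_monoid.r_zero[OF am] abelian_monoid.zero_closed[OF am] intro!: restrict_ext)
next
  fix c x assume "c \<in> carrier K" "x \<in> carrier (M i)"
  then show "dsum_in I M i (c \<odot>\<^bsub>M i\<^esub> x) = c \<odot>\<^bsub>dsum I M\<^esub> dsum_in I M i x"
    by (auto simp: dsum_in_def dsum_smult module.smult_r_null[OF M] intro!: restrict_ext)
qed (rule dsum_in_closed[OF M i])

text \<open>Induction on the finite support: erasing one nonzero coordinate \<open>i\<close> gives
  \<open>y\<close> with strictly smaller support, and \<open>x\<close> is \<open>y\<close> plus the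
  element concentrated at \<open>i\<close>. The zero case stands apart because \<open>I\<close> may
  be empty.\<close>

lemma dsum_induct:
  assumes M: "\<And>i. i \<in> I \<Longrightarrow> module K (M i)"
    and x: "x \<in> carrier (dsum I M)"
    and zero: "P \<zero>\<^bsub>dsum I M\<^esub>"
    and single: "\<And>i m. i \<in> I \<Longrightarrow> m \<in> carrier (M i) \<Longrightarrow> P (dsum_in I M i m)"
    and add: "\<And>x y. x \<in> carrier (dsum I M) \<Longrightarrow> y \<in> carrier (dsum I M) \<Longrightarrow> P x \<Longrightarrow> P y \<Longrightarrow>
      P (x \<oplus>\<^bsub>dsum I M\<^esub> y)"
  shows "P x"
proof -
  note ag = module.axioms(2)[OF M]
  note am = abelian_group.axioms(1)[OF ag]
  have "finite {i \<in> I. x i \<noteq> \<zero>\<^bsub>M i\<^esub>}" using x by (simp add: carrier_dsum)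
  then show ?thesis using x
  proof (induction "{i \<in> I. x i \<noteq> \<zero>\<^bsub>M i\<^esub>}" arbitrary: x rule: finite_psubset_induct)
    case psubset
    show ?case
    proof (cases "{i \<in> I. x i \<noteq> \<zero>\<^bsub>M i\<^esub>} = {}")
      case True
      then have "x = \<zero>\<^bsub>dsum I M\<^esub>"
        using psubset.prems by (auto simp: carrier_dsum dsum_zero extensional_def)
      then show ?thesis using zero by simp
    next
      case False
      then obtain i where i: "i \<in> I" "x i \<noteq> \<zero>\<^bsub>M i\<^esub>" by blast
      define y where "y = x(i := \<zero>\<^bsub>M i\<^esub>)"
      have supp: "{j \<in> I. y j \<noteq> \<zero>\<^bsub>M j\<^esub>} \<subset> {j \<in> I. x j \<noteq> \<zero>\<^bsub>M j\<^esub>}"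
        using i by (auto simp: y_def)
      have y: "y \<in> carrier (dsum I M)"
        unfolding carrier_dsum
      proof (intro conjI)
        show "finite {j \<in> I. y j \<noteq> \<zero>\<^bsub>M j\<^esub>}" using supp psubset.hyps finite_subset by blast
      qed (use psubset.prems i in \<open>auto simp: carrier_dsum y_def extensional_def abelian_monoid.zero_closed[OF am]\<close>)
      have "x = dsum_in I M i (x i) \<oplus>\<^bsub>dsum I M\<^esub> y"
        using psubset.prems i
        by (auto simp: carrier_dsum y_def dsum_in_def dsum_add extensional_def abelian_monoid.l_zero[OF am]
            abelian_monoid.r_zero[OF am])
      moreover have "P (dsum_in I M i (x i) \<oplus>\<^bsub>dsum I M\<^esub> y)"
      proof (rule add)
        show "P y" using psubset.hyps(2)[OF supp y] .
        show "P (dsum_in I M i (x i))" using single i psubset.prems by (auto simp: carrier_dsum)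
        show "dsum_in I M i (x i) \<in> carrier (dsum I M)"
          using M i psubset.prems by (intro dsum_in_closed) (auto simp: carrier_dsum)
      qed (rule y)
      ultimately show ?thesis by simp
    qed
  qed
qed

text \<open>The map adds up \<open>f i (x i)\<close> over the support of \<open>x\<close>. Since
  \<open>f i\<close> sends zero to zero, the sum may be taken over any finite index set containing
  the support; this freedom is what linearity needs.\<close>

lemma dsum_universal:
  assumes M: "\<And>i. i \<in> I \<Longrightarrow> module K (M i)" and N: "module K N"
    and f: "\<And>i. i \<in> I \<Longrightarrow> f i \<in> module_hom K (M i) N"
  shows "\<exists>g\<in>module_hom K (dsum I M) N. \<forall>i\<in>I. \<forall>x\<in>carrier (M i). g (dsum_in I M i x) = f i x"
proof -
  interpret N: module K N by fact
  define supp where "supp x = {i \<in> I. x i \<noteq> \<zero>\<^bsub>M i\<^esub>}" for x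
  define g where "g x = (\<Oplus>\<^bsub>N\<^esub>i\<in>supp x. f i (x i))" for x
  have f0: "f i \<zero>\<^bsub>M i\<^esub> = \<zero>\<^bsub>N\<^esub>" if "i \<in> I" for i
    using module_hom_zero M N f that by blast
  have fin: "finite (supp x)" if "x \<in> carrier (dsum I M)" for x
    using that by (simp add: carrier_dsum supp_def)
  have fc: "f i (x i) \<in> carrier N" if "x \<in> carrier (dsum I M)" "i \<in> I" for x i
    using that by (auto simp: carrier_dsum intro: module_hom_mem[OF f])
  have g_eq: "g x = (\<Oplus>\<^bsub>N\<^esub>i\<in>J. f i (x i))"
    if "x \<in> carrier (dsum I M)" "finite J" "supp x \<subseteq> J" "J \<subseteq> I" for x J
    unfolding g_def
    by (rule N.add.finprod_mono_neutral_cong_left) (use that fc f0 in \<open>auto simp: supp_def\<close>)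
  note D = module_dsum[OF N.is_cring M]
  interpret D: module K "dsum I M" by (rule D)
  have "g \<in> module_hom K (dsum I M) N"
  proof (rule module_homI)
    fix x assume x: "x \<in> carrier (dsum I M)"
    then show "g x \<in> carrier N"
      unfolding g_def using fc by (intro N.finsum_closed) (auto simp: supp_def)
  next
    fix x y assume xy: "x \<in> carrier (dsum I M)" "y \<in> carrier (dsum I M)"
    \<comment> \<open>The support of a sum can be smaller than the union of the supports, by
      cancellation, so the three sums are compared over one common index set.\<close>
    let ?J = "supp x \<union> supp y \<union> supp (x \<oplus>\<^bsub>dsum I M\<^esub> y)"
    have J: "finite ?J" "?J \<subseteq> I" using xy fin D.a_closed by (auto simp: supp_def)
    have "g (x \<oplus>\<^bsub>dsum I M\<^esub> y) = (\<Oplus>\<^bsub>N\<^esub>i\<in>?J. f i ((x \<oplus>\<^bsub>dsum I M\<^esub> y) i))"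
      by (rule g_eq) (use xy J in auto)
    also have "\<dots> = (\<Oplus>\<^bsub>N\<^esub>i\<in>?J. f i (x i) \<oplus>\<^bsub>N\<^esub> f i (y i))"
      using xy J fc
      by (intro N.finsum_cong') (auto simp: dsum_add carrier_dsum subset_iff intro!: module_hom_add[OF f])
    also have "\<dots> = (\<Oplus>\<^bsub>N\<^esub>i\<in>?J. f i (x i)) \<oplus>\<^bsub>N\<^esub> (\<Oplus>\<^bsub>N\<^esub>i\<in>?J. f i (y i))"
      using xy J fc by (intro N.finsum_addf) auto
    also have "\<dots> = g x \<oplus>\<^bsub>N\<^esub> g y"
      by (intro arg_cong2[where f = "add N"] g_eq[symmetric]) (use xy J in auto)
    finally show "g (x \<oplus>\<^bsub>dsum I M\<^esub> y) = g x \<oplus>\<^bsub>N\<^esub> g y" .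
  next
    fix c x assume c: "c \<in> carrier K" and x: "x \<in> carrier (dsum I M)"
    let ?J = "supp x \<union> supp (c \<odot>\<^bsub>dsum I M\<^esub> x)"
    have J: "finite ?J" "?J \<subseteq> I" using x c fin D.smult_closed by (auto simp: supp_def)
    have "g (c \<odot>\<^bsub>dsum I M\<^esub> x) = (\<Oplus>\<^bsub>N\<^esub>i\<in>?J. f i ((c \<odot>\<^bsub>dsum I M\<^esub> x) i))"
      by (rule g_eq) (use x c J in auto)
    also have "\<dots> = (\<Oplus>\<^bsub>N\<^esub>i\<in>?J. c \<odot>\<^bsub>N\<^esub> f i (x i))"
      using x c J fc
      by (intro N.finsum_cong') (auto simp: dsum_smult carrier_dsum subset_iff intro!: module_hom_smult[OF f])
    also have "\<dots> = c \<odot>\<^bsub>N\<^esub> (\<Oplus>\<^bsub>N\<^esub>i\<in>?J. f i (x i))"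
      using x c J fc by (intro N.finsum_smult_ldistr[symmetric]) auto
    also have "\<dots> = c \<odot>\<^bsub>N\<^esub> g x" by (intro arg_cong2[where f = "smult N"] refl g_eq[symmetric]) (use x J in auto)
    finally show "g (c \<odot>\<^bsub>dsum I M\<^esub> x) = c \<odot>\<^bsub>N\<^esub> g x" .
  qed
  moreover have "g (dsum_in I M i x) = f i x" if i: "i \<in> I" and x: "x \<in> carrier (M i)" for i x
  proof -
    have "g (dsum_in I M i x) = (\<Oplus>\<^bsub>N\<^esub>j\<in>{i}. f j (dsum_in I M i x j))"
      by (rule g_eq) (use i x dsum_in_closed[OF M] in \<open>auto simp: supp_def dsum_in_def\<close>)
    then show ?thesis using i x module_hom_mem[OF f] by (simp add: dsum_in_def)
  qed
  ultimately show ?thesis by blast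
qed


section \<open>Quotients and copies\<close>

text \<open>Opens the coset calculus of abelian subgroups to submodules. Closure under negation is
  scaling by minus one.\<close>

lemma submodule_abelian_subgroup:
  assumes M: "module K M" and N: "submodule K N M"
  shows "abelian_subgroup N M"
proof -
  interpret M: module K M by fact
  interpret N: submodule K N M by fact
  have neg: "\<ominus>\<^bsub>M\<^esub> x \<in> N" if "x \<in> N" for x
  proof -
    have "\<ominus>\<^bsub>K\<^esub> \<one>\<^bsub>K\<^esub> \<odot>\<^bsub>M\<^esub> x \<in> N" using that N.smult_closed by simp
    moreover have "\<ominus>\<^bsub>K\<^esub> \<one>\<^bsub>K\<^esub> \<odot>\<^bsub>M\<^esub> x = \<ominus>\<^bsub>M\<^esub> x"
      using that N.subset M.smult_l_minus[of "\<one>\<^bsub>K\<^esub>" x] by (auto simp: subset_iff)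
    ultimately show ?thesis by simp
  qed
  show ?thesis
  proof (rule abelian_subgroupI3[OF additive_subgroupI[OF M.add.subgroupI] M.abelian_group_axioms])
    show "N \<noteq> {}" using N.zero_closed by blast
    show "N \<subseteq> carrier M" by (rule N.subset)
    show "\<ominus>\<^bsub>M\<^esub> x \<in> N" if "x \<in> N" for x
      using neg[OF that] .
    show "x \<oplus>\<^bsub>M\<^esub> y \<in> N" if "x \<in> N" "y \<in> N" for x y
      using N.m_closed[OF that] by simp
  qed
qed

lemma coset_eq_iff:
  assumes M: "module K M" and N: "submodule K N M" and xy: "x \<in> carrier M" "y \<in> carrier M"
  shows "N +>\<^bsub>M\<^esub> x = N +>\<^bsub>M\<^esub> y \<longleftrightarrow> x \<in> N +>\<^bsub>M\<^esub> y"
proof -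
  interpret M: module K M by fact
  interpret N: abelian_subgroup N M using submodule_abelian_subgroup[OF M N] .
  show ?thesis
    using N.a_rcos_self[OF xy(1)] M.a_repr_independence[OF _ xy(2) N.a_subgroup, of x]
    by (intro iffI) (simp, rule sym)
qed

lemma quot_hom:
  assumes M: "module K M" and N: "submodule K N M"
  shows "(\<lambda>x. N +>\<^bsub>M\<^esub> x) \<in> module_hom K M (quot_module M N)"
proof -
  interpret M: module K M by fact
  interpret sub: submodule K N M by fact
  interpret N: abelian_subgroup N M using submodule_abelian_subgroup[OF M N] .
  show ?thesis
  proof (rule module_homI)
    fix x assume "x \<in> carrier M"
    then show "N +>\<^bsub>M\<^esub> x \<in> carrier (quot_module M N)"
      by (auto simp: quot_module_def A_RCOSETS_def')
  next
    fix x y assume "x \<in> carrier M" "y \<in> carrier M"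
    then show "N +>\<^bsub>M\<^esub> (x \<oplus>\<^bsub>M\<^esub> y) = (N +>\<^bsub>M\<^esub> x) \<oplus>\<^bsub>quot_module M N\<^esub> (N +>\<^bsub>M\<^esub> y)"
      by (simp add: quot_module_def N.a_rcos_sum)
  next
    fix c x assume c: "c \<in> carrier K" and x: "x \<in> carrier M"
    \<comment> \<open>In \<open>quot_module\<close> the scalar multiple of a coset is a union over
      all representatives. It is a single coset because replacing \<open>x\<close> by
      \<open>n\<close> plus \<open>x\<close> changes the multiple only by \<open>c\<close> times
      \<open>n\<close>, which stays in \<open>N\<close>.\<close>
    have "N +>\<^bsub>M\<^esub> (c \<odot>\<^bsub>M\<^esub> x') = N +>\<^bsub>M\<^esub> (c \<odot>\<^bsub>M\<^esub> x)" if x': "x' \<in> N +>\<^bsub>M\<^esub> x" for x'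
    proof -
      obtain n where n: "n \<in> N" "x' = n \<oplus>\<^bsub>M\<^esub> x" using x' by (auto simp: a_r_coset_def')
      have nM: "n \<in> carrier M" using n N.a_subset by blast
      have "c \<odot>\<^bsub>M\<^esub> x' = c \<odot>\<^bsub>M\<^esub> n \<oplus>\<^bsub>M\<^esub> c \<odot>\<^bsub>M\<^esub> x" using n nM c x by (simp add: M.smult_r_distr)
      moreover have "c \<odot>\<^bsub>M\<^esub> n \<in> N" using sub.smult_closed c n by blast
      ultimately have "c \<odot>\<^bsub>M\<^esub> x' \<in> N +>\<^bsub>M\<^esub> (c \<odot>\<^bsub>M\<^esub> x)" by (auto simp: a_r_coset_def')
      then show ?thesis
        by (rule M.a_repr_independence[OF _ _ N.a_subgroup, symmetric]) (simp add: c x)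
    qed
    then have "(\<Union>x'\<in>N +>\<^bsub>M\<^esub> x. N +>\<^bsub>M\<^esub> (c \<odot>\<^bsub>M\<^esub> x')) = (\<Union>x'\<in>N +>\<^bsub>M\<^esub> x. N +>\<^bsub>M\<^esub> (c \<odot>\<^bsub>M\<^esub> x))"
      by (intro SUP_cong refl)
    then show "N +>\<^bsub>M\<^esub> (c \<odot>\<^bsub>M\<^esub> x) = c \<odot>\<^bsub>quot_module M N\<^esub> (N +>\<^bsub>M\<^esub> x)"
      using N.a_rcos_self[OF x] by (auto simp: quot_module_def)
  qed
qed

lemma quot_surj: "(\<lambda>x. N +>\<^bsub>M\<^esub> x) ` carrier M = carrier (quot_module M N)"
  by (auto simp: quot_module_def A_RCOSETS_def')

lemma quot_zero_iff:
  assumes M: "module K M" and N: "submodule K N M" and x: "x \<in> carrier M"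
  shows "N +>\<^bsub>M\<^esub> x = \<zero>\<^bsub>quot_module M N\<^esub> \<longleftrightarrow> x \<in> N"
proof -
  interpret M: module K M by fact
  interpret N: abelian_subgroup N M using submodule_abelian_subgroup[OF M N] .
  show ?thesis
    unfolding quot_module_def partial_object.simps ring.simps
    by (rule iffI[OF M.a_coset_join1[OF _ x N.a_subgroup] M.a_coset_join2[OF x N.a_subgroup]])
qed

lemma module_quot:
  assumes M: "module K M" and N: "submodule K N M"
  shows "module K (quot_module M N)"
proof (rule module_hom_image[OF M quot_hom[OF M N] quot_surj])
  have "\<zero>\<^bsub>M\<^esub> \<in> carrier M" using M by (meson abelian_groupE(2) module.axioms(2))
  then show "N +>\<^bsub>M\<^esub> \<zero>\<^bsub>M\<^esub> = \<zero>\<^bsub>quot_module M N\<^esub>"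
    using quot_zero_iff[OF M N] submodule.zero_closed[OF N] by simp
qed

lemma copy_hom:
  assumes M: "module K M" and h: "inj_on h (carrier M)"
  shows "h \<in> module_hom K M (copy_module h M)"
  using h by (auto simp: module_hom_def copy_module_def Let_def)

lemma carrier_copy: "carrier (copy_module h M) = h ` carrier M"
  by (simp add: copy_module_def Let_def)

lemma copy_zero: "\<zero>\<^bsub>copy_module h M\<^esub> = h \<zero>\<^bsub>M\<^esub>"
  by (simp add: copy_module_def Let_def)

lemma module_copy:
  assumes M: "module K M" and h: "inj_on h (carrier M)"
  shows "module K (copy_module h M)"
  by (rule module_hom_image[OF M copy_hom[OF M h]]) (simp_all add: carrier_copy copy_zero)

lemma quot_eqI:
  assumes M: "module K M" and N: "submodule K N M" and xy: "x \<in> carrier M" "y \<in> carrier M"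
    and diff: "x \<ominus>\<^bsub>M\<^esub> y \<in> N"
  shows "N +>\<^bsub>M\<^esub> x = N +>\<^bsub>M\<^esub> y"
proof -
  interpret M: module K M by fact
  have "(x \<ominus>\<^bsub>M\<^esub> y) \<oplus>\<^bsub>M\<^esub> y = x"
    using xy by (simp add: a_minus_def M.a_assoc M.l_neg)
  then have "x \<in> N +>\<^bsub>M\<^esub> y" using diff unfolding a_r_coset_def' by (metis UN_I singletonI)
  then show ?thesis using coset_eq_iff[OF M N xy] by simp
qed


section \<open>Threefold tensor products\<close>

lemma carrier_ring_module: "carrier (ring_module K) = carrier K"
  by (simp add: ring_module_def)

lemma module_ring_module: "cring K \<Longrightarrow> module K (ring_module K)"
proof -
  assume K: "cring K"
  interpret K: cring K by fact
  show "module K (ring_module K)"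
  proof (rule module_criteria[OF K])
    show "\<forall>v\<in>carrier (ring_module K). \<exists>w\<in>carrier (ring_module K).
        v \<oplus>\<^bsub>ring_module K\<^esub> w = \<zero>\<^bsub>ring_module K\<^esub>"
    proof
      fix v assume "v \<in> carrier (ring_module K)"
      then show "\<exists>w\<in>carrier (ring_module K). v \<oplus>\<^bsub>ring_module K\<^esub> w = \<zero>\<^bsub>ring_module K\<^esub>"
        by (intro bexI[of _ "\<ominus>\<^bsub>K\<^esub> v"]) (auto simp: ring_module_def K.r_neg)
    qed
  qed (auto simp: ring_module_def K.a_assoc K.m_assoc K.l_distr K.r_distr K.a_ac)
qed

lemma module_free_module: "cring K \<Longrightarrow> module K (free_module K S)"
  unfolding free_module_def by (intro module_dsum module_ring_module)

lemma free_gen_closed: "cring K \<Longrightarrow> s \<in> S \<Longrightarrow> free_gen K S s \<in> carrier (free_module K S)"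
  unfolding free_module_def free_gen_def
  by (intro dsum_in_closed[where K = K] module_ring_module) (auto simp: ring_module_def cring_def ring.ring_simprules)

text \<open>Induction over a direct sum produces elements with one arbitrary coordinate; here they
  become scalar multiples of basis vectors.\<close>

lemma free_smult_gen:
  assumes K: "cring K" and s: "s \<in> S" and k: "k \<in> carrier K"
  shows "dsum_in S (\<lambda>_. ring_module K) s k = k \<odot>\<^bsub>free_module K S\<^esub> free_gen K S s"
proof -
  interpret K: cring K by fact
  have "k = k \<odot>\<^bsub>ring_module K\<^esub> \<one>\<^bsub>K\<^esub>" using k by (simp add: ring_module_def)
  then show ?thesis
    unfolding free_module_def free_gen_def
    using module_hom_smult[OF dsum_in_hom[of S K "\<lambda>_. ring_module K" s, OF module_ring_module[OF K] s] k, of "\<one>\<^bsub>K\<^esub>"]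
    by (simp add: ring_module_def)
qed

lemma free_universal:
  assumes N: "module K N" and h: "\<And>s. s \<in> S \<Longrightarrow> h s \<in> carrier N"
  shows "\<exists>g\<in>module_hom K (free_module K S) N. \<forall>s\<in>S. g (free_gen K S s) = h s"
proof -
  interpret N: module K N by fact
  have "(\<lambda>k. k \<odot>\<^bsub>N\<^esub> h s) \<in> module_hom K (ring_module K) N" if "s \<in> S" for s
    using h[OF that] by (intro module_homI) (auto simp: ring_module_def N.smult_l_distr N.smult_assoc1)
  from dsum_universal[of S K "\<lambda>_. ring_module K" N "\<lambda>s k. k \<odot>\<^bsub>N\<^esub> h s", OF module_ring_module[OF N.is_cring] N this]
  obtain g where "g \<in> module_hom K (free_module K S) N"
    and g: "\<forall>s\<in>S. \<forall>k\<in>carrier K. g (dsum_in S (\<lambda>_. ring_module K) s k) = k \<odot>\<^bsub>N\<^esub> h s"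
    by (auto simp: free_module_def carrier_ring_module)
  moreover have "\<forall>s\<in>S. g (free_gen K S s) = h s"
    using g h by (simp add: free_gen_def)
  ultimately show ?thesis by blast
qed

text \<open>Expressed through \<open>module_hom\<close> in each slot, so that composing with linear
  maps inside or outside reduces to \<open>module_hom_comp\<close>. The same predicate covers pure
  tensors, the graded products, the product of the free algebra and that of the target.\<close>

definition trilinear :: "('k, 'm) ring_scheme \<Rightarrow> ('k, 'a, 'n1) module_scheme \<Rightarrow>
    ('k, 'b, 'n2) module_scheme \<Rightarrow> ('k, 'c, 'n3) module_scheme \<Rightarrow> ('k, 'd, 'n4) module_scheme \<Rightarrow> ('a \<Rightarrow> 'b \<Rightarrow> 'c \<Rightarrow> 'd) \<Rightarrow> bool" where
  "trilinear K A B C D h \<longleftrightarrow>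
    (\<forall>y\<in>carrier B. \<forall>z\<in>carrier C. (\<lambda>x. h x y z) \<in> module_hom K A D) \<and>
    (\<forall>x\<in>carrier A. \<forall>z\<in>carrier C. (\<lambda>y. h x y z) \<in> module_hom K B D) \<and>
    (\<forall>x\<in>carrier A. \<forall>y\<in>carrier B. (\<lambda>z. h x y z) \<in> module_hom K C D)"

lemma trilinearD:
  assumes "trilinear K A B C D h"
  shows "y \<in> carrier B \<Longrightarrow> z \<in> carrier C \<Longrightarrow> (\<lambda>x. h x y z) \<in> module_hom K A D"
    and "x \<in> carrier A \<Longrightarrow> z \<in> carrier C \<Longrightarrow> (\<lambda>y. h x y z) \<in> module_hom K B D"
    and "x \<in> carrier A \<Longrightarrow> y \<in> carrier B \<Longrightarrow> (\<lambda>z. h x y z) \<in> module_hom K C D"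
  using assms by (auto simp: trilinear_def)

lemma trilinear_closed:
  assumes "trilinear K A B C D h" "x \<in> carrier A" "y \<in> carrier B" "z \<in> carrier C"
  shows "h x y z \<in> carrier D"
  using module_hom_mem[OF trilinearD(1)[OF assms(1,3,4)] assms(2)] .

lemma trilinear_zero:
  assumes h: "trilinear K A B C D h"
    and "module K A" "module K B" "module K C" "module K D"
    and "x \<in> carrier A" "y \<in> carrier B" "z \<in> carrier C"
  shows "h \<zero>\<^bsub>A\<^esub> y z = \<zero>\<^bsub>D\<^esub>" "h x \<zero>\<^bsub>B\<^esub> z = \<zero>\<^bsub>D\<^esub>" "h x y \<zero>\<^bsub>C\<^esub> = \<zero>\<^bsub>D\<^esub>"
  using module_hom_zero[OF _ _ trilinearD(1)[OF h]] module_hom_zero[OF _ _ trilinearD(2)[OF h]]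
    module_hom_zero[OF _ _ trilinearD(3)[OF h]] assms by auto

lemma trilinear_add:
  assumes h: "trilinear K A B C D h"
    and "x \<in> carrier A" "y \<in> carrier B" "z \<in> carrier C"
  shows "x' \<in> carrier A \<Longrightarrow> h (x \<oplus>\<^bsub>A\<^esub> x') y z = h x y z \<oplus>\<^bsub>D\<^esub> h x' y z"
    "y' \<in> carrier B \<Longrightarrow> h x (y \<oplus>\<^bsub>B\<^esub> y') z = h x y z \<oplus>\<^bsub>D\<^esub> h x y' z"
    "z' \<in> carrier C \<Longrightarrow> h x y (z \<oplus>\<^bsub>C\<^esub> z') = h x y z \<oplus>\<^bsub>D\<^esub> h x y z'"
  using module_hom_add[OF trilinearD(1)[OF h]] module_hom_add[OF trilinearD(2)[OF h]]
    module_hom_add[OF trilinearD(3)[OF h]] assms by auto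

lemma trilinear_smult:
  assumes h: "trilinear K A B C D h"
    and "k \<in> carrier K" "x \<in> carrier A" "y \<in> carrier B" "z \<in> carrier C"
  shows "h (k \<odot>\<^bsub>A\<^esub> x) y z = k \<odot>\<^bsub>D\<^esub> h x y z" "h x (k \<odot>\<^bsub>B\<^esub> y) z = k \<odot>\<^bsub>D\<^esub> h x y z"
    "h x y (k \<odot>\<^bsub>C\<^esub> z) = k \<odot>\<^bsub>D\<^esub> h x y z"
  using module_hom_smult[OF trilinearD(1)[OF h]] module_hom_smult[OF trilinearD(2)[OF h]]
    module_hom_smult[OF trilinearD(3)[OF h]] assms by auto

lemma trilinear_hom:
  assumes "trilinear K A B C D h" "f \<in> module_hom K D E"
  shows "trilinear K A B C E (\<lambda>x y z. f (h x y z))"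
  using assms by (auto simp: trilinear_def intro: module_hom_comp[OF _ assms(2)])

lemma trilinear_comp:
  assumes h: "trilinear K A' B' C' D h"
    and f: "f \<in> module_hom K A A'" and g: "g \<in> module_hom K B B'" and k: "k \<in> module_hom K C C'"
  shows "trilinear K A B C D (\<lambda>x y z. h (f x) (g y) (k z))"
  unfolding trilinear_def
  using module_hom_comp[OF f trilinearD(1)[OF h]] module_hom_comp[OF g trilinearD(2)[OF h]]
    module_hom_comp[OF k trilinearD(3)[OF h]] module_hom_mem[OF f] module_hom_mem[OF g] module_hom_mem[OF k]
  by simp

context
  fixes K :: "'k ring" and A :: "('k, 'a) module" and B :: "('k, 'b) module" and C :: "('k, 'c) module"
  assumes A: "module K A" and B: "module K B" and C: "module K C"
begin

interpretation A: module K A by (rule A)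
interpretation B: module K B by (rule B)
interpretation C: module K C by (rule C)

private abbreviation "S \<equiv> carrier A \<times> carrier B \<times> carrier C"
private abbreviation "F \<equiv> free_module K S"

interpretation F: module K F by (rule module_free_module) (rule A.is_cring)

private lemma gen_closed:
  "x \<in> carrier A \<Longrightarrow> y \<in> carrier B \<Longrightarrow> z \<in> carrier C \<Longrightarrow> free_gen K S (x, y, z) \<in> carrier F"
  by (simp add: free_gen_closed A.is_cring)

lemma tensor3_rels_subset: "tensor3_rels K A B C \<subseteq> carrier F"
  unfolding tensor3_rels_def Let_def
  by (intro Un_least subsetI; elim CollectE exE conjE; hypsubst)
    (intro F.minus_closed F.a_closed F.smult_closed gen_closed A.a_closed B.a_closed C.a_closed
      A.smult_closed B.smult_closed C.smult_closed; assumption)+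

lemma submodule_tensor3_null: "submodule K (tensor3_null K A B C) F"
  unfolding tensor3_null_def by (rule F.span_is_submodule[OF tensor3_rels_subset])

lemma module_tensor3: "module K (tensor3 K A B C)"
  unfolding tensor3_def by (rule module_quot[OF F.module_axioms submodule_tensor3_null])

private lemma pure3_eq:
  "pure3 K A B C x y z = tensor3_null K A B C +>\<^bsub>F\<^esub> free_gen K S (x, y, z)"
  by (simp add: pure3_def Let_def)

private lemma rel_eq:
  assumes "u \<ominus>\<^bsub>F\<^esub> v \<in> tensor3_rels K A B C" "u \<in> carrier F" "v \<in> carrier F"
  shows "tensor3_null K A B C +>\<^bsub>F\<^esub> u = tensor3_null K A B C +>\<^bsub>F\<^esub> v"
proof (rule quot_eqI[OF F.module_axioms submodule_tensor3_null assms(2,3)])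
  show "u \<ominus>\<^bsub>F\<^esub> v \<in> tensor3_null K A B C"
    unfolding tensor3_null_def by (rule subsetD[OF F.in_own_span[OF tensor3_rels_subset] assms(1)])
qed

text \<open>The six families in \<open>tensor3_rels\<close> are the defects of additivity and
  homogeneity in the three slots, and all of them become zero in the quotient.\<close>

lemma trilinear_pure3: "trilinear K A B C (tensor3 K A B C) (pure3 K A B C)"
proof -
  note q = quot_hom[OF F.module_axioms submodule_tensor3_null, folded tensor3_def]
  have rels: "x \<in> carrier A \<Longrightarrow> x' \<in> carrier A \<Longrightarrow> y \<in> carrier B \<Longrightarrow> z \<in> carrier C \<Longrightarrow>
      free_gen K S (x \<oplus>\<^bsub>A\<^esub> x', y, z) \<ominus>\<^bsub>F\<^esub> (free_gen K S (x, y, z) \<oplus>\<^bsub>F\<^esub> free_gen K S (x', y, z)) \<in> tensor3_rels K A B C"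
    "x \<in> carrier A \<Longrightarrow> y \<in> carrier B \<Longrightarrow> y' \<in> carrier B \<Longrightarrow> z \<in> carrier C \<Longrightarrow>
      free_gen K S (x, y \<oplus>\<^bsub>B\<^esub> y', z) \<ominus>\<^bsub>F\<^esub> (free_gen K S (x, y, z) \<oplus>\<^bsub>F\<^esub> free_gen K S (x, y', z)) \<in> tensor3_rels K A B C"
    "x \<in> carrier A \<Longrightarrow> y \<in> carrier B \<Longrightarrow> z \<in> carrier C \<Longrightarrow> z' \<in> carrier C \<Longrightarrow>
      free_gen K S (x, y, z \<oplus>\<^bsub>C\<^esub> z') \<ominus>\<^bsub>F\<^esub> (free_gen K S (x, y, z) \<oplus>\<^bsub>F\<^esub> free_gen K S (x, y, z')) \<in> tensor3_rels K A B C"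
    "k \<in> carrier K \<Longrightarrow> x \<in> carrier A \<Longrightarrow> y \<in> carrier B \<Longrightarrow> z \<in> carrier C \<Longrightarrow>
      free_gen K S (k \<odot>\<^bsub>A\<^esub> x, y, z) \<ominus>\<^bsub>F\<^esub> k \<odot>\<^bsub>F\<^esub> free_gen K S (x, y, z) \<in> tensor3_rels K A B C"
    "k \<in> carrier K \<Longrightarrow> x \<in> carrier A \<Longrightarrow> y \<in> carrier B \<Longrightarrow> z \<in> carrier C \<Longrightarrow>
      free_gen K S (x, k \<odot>\<^bsub>B\<^esub> y, z) \<ominus>\<^bsub>F\<^esub> k \<odot>\<^bsub>F\<^esub> free_gen K S (x, y, z) \<in> tensor3_rels K A B C"
    "k \<in> carrier K \<Longrightarrow> x \<in> carrier A \<Longrightarrow> y \<in> carrier B \<Longrightarrow> z \<in> carrier C \<Longrightarrow>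
      free_gen K S (x, y, k \<odot>\<^bsub>C\<^esub> z) \<ominus>\<^bsub>F\<^esub> k \<odot>\<^bsub>F\<^esub> free_gen K S (x, y, z) \<in> tensor3_rels K A B C"
    for x x' y y' z z' k
    unfolding tensor3_rels_def Let_def
    subgoal by (rule UnI1, rule UnI1, rule UnI1, rule UnI1, rule UnI1, rule CollectI,
          intro exI conjI, rule refl, assumption+)
    subgoal by (rule UnI1, rule UnI1, rule UnI1, rule UnI1, rule UnI2, rule CollectI,
          intro exI conjI, rule refl, assumption+)
    subgoal by (rule UnI1, rule UnI1, rule UnI1, rule UnI2, rule CollectI,
          intro exI conjI, rule refl, assumption+)
    subgoal by (rule UnI1, rule UnI1, rule UnI2, rule CollectI,
          intro exI conjI, rule refl, assumption+)
    subgoal by (rule UnI1, rule UnI2, rule CollectI, intro exI conjI, rule refl, assumption+)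
    subgoal by (rule UnI2, rule CollectI, intro exI conjI, rule refl, assumption+)
    done
  have add: "tensor3_null K A B C +>\<^bsub>F\<^esub> u =
      (tensor3_null K A B C +>\<^bsub>F\<^esub> v) \<oplus>\<^bsub>tensor3 K A B C\<^esub> (tensor3_null K A B C +>\<^bsub>F\<^esub> w)"
    if "u \<ominus>\<^bsub>F\<^esub> (v \<oplus>\<^bsub>F\<^esub> w) \<in> tensor3_rels K A B C" "u \<in> carrier F" "v \<in> carrier F" "w \<in> carrier F" for u v w
    using rel_eq[OF that(1,2) F.a_closed[OF that(3,4)]] module_hom_add[OF q that(3,4)] by (rule trans)
  have smult: "tensor3_null K A B C +>\<^bsub>F\<^esub> u = k \<odot>\<^bsub>tensor3 K A B C\<^esub> (tensor3_null K A B C +>\<^bsub>F\<^esub> v)"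
    if "u \<ominus>\<^bsub>F\<^esub> (k \<odot>\<^bsub>F\<^esub> v) \<in> tensor3_rels K A B C" "u \<in> carrier F" "k \<in> carrier K" "v \<in> carrier F" for u v k
    using rel_eq[OF that(1,2) F.smult_closed[OF that(3,4)]] module_hom_smult[OF q that(3,4)] by (rule trans)
  show ?thesis
    unfolding trilinear_def pure3_eq
  proof (intro conjI ballI)
    fix y z assume *: "y \<in> carrier B" "z \<in> carrier C"
    show "(\<lambda>x. tensor3_null K A B C +>\<^bsub>F\<^esub> free_gen K S (x, y, z)) \<in> module_hom K A (tensor3 K A B C)"
    proof (rule module_homI)
      fix x assume "x \<in> carrier A"
      then show "tensor3_null K A B C +>\<^bsub>F\<^esub> free_gen K S (x, y, z) \<in> carrier (tensor3 K A B C)"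
        using * by (intro module_hom_mem[OF q] gen_closed)
    next
      fix x x' assume "x \<in> carrier A" "x' \<in> carrier A"
      then show "tensor3_null K A B C +>\<^bsub>F\<^esub> free_gen K S (x \<oplus>\<^bsub>A\<^esub> x', y, z) =
          (tensor3_null K A B C +>\<^bsub>F\<^esub> free_gen K S (x, y, z)) \<oplus>\<^bsub>tensor3 K A B C\<^esub> (tensor3_null K A B C +>\<^bsub>F\<^esub> free_gen K S (x', y, z))"
        using * by (intro add rels gen_closed A.a_closed)
    next
      fix k x assume "k \<in> carrier K" "x \<in> carrier A"
      then show "tensor3_null K A B C +>\<^bsub>F\<^esub> free_gen K S (k \<odot>\<^bsub>A\<^esub> x, y, z) =
          k \<odot>\<^bsub>tensor3 K A B C\<^esub> (tensor3_null K A B C +>\<^bsub>F\<^esub> free_gen K S (x, y, z))"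
        using * by (intro smult rels gen_closed A.smult_closed)
    qed
  next
    fix x z assume *: "x \<in> carrier A" "z \<in> carrier C"
    show "(\<lambda>y. tensor3_null K A B C +>\<^bsub>F\<^esub> free_gen K S (x, y, z)) \<in> module_hom K B (tensor3 K A B C)"
    proof (rule module_homI)
      fix y assume "y \<in> carrier B"
      then show "tensor3_null K A B C +>\<^bsub>F\<^esub> free_gen K S (x, y, z) \<in> carrier (tensor3 K A B C)"
        using * by (intro module_hom_mem[OF q] gen_closed)
    next
      fix y y' assume "y \<in> carrier B" "y' \<in> carrier B"
      then show "tensor3_null K A B C +>\<^bsub>F\<^esub> free_gen K S (x, y \<oplus>\<^bsub>B\<^esub> y', z) =
          (tensor3_null K A B C +>\<^bsub>F\<^esub> free_gen K S (x, y, z)) \<oplus>\<^bsub>tensor3 K A B C\<^esub> (tensor3_null K A B C +>\<^bsub>F\<^esub> free_gen K S (x, y', z))"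
        using * by (intro add rels gen_closed B.a_closed)
    next
      fix k y assume "k \<in> carrier K" "y \<in> carrier B"
      then show "tensor3_null K A B C +>\<^bsub>F\<^esub> free_gen K S (x, k \<odot>\<^bsub>B\<^esub> y, z) =
          k \<odot>\<^bsub>tensor3 K A B C\<^esub> (tensor3_null K A B C +>\<^bsub>F\<^esub> free_gen K S (x, y, z))"
        using * by (intro smult rels gen_closed B.smult_closed)
    qed
  next
    fix x y assume *: "x \<in> carrier A" "y \<in> carrier B"
    show "(\<lambda>z. tensor3_null K A B C +>\<^bsub>F\<^esub> free_gen K S (x, y, z)) \<in> module_hom K C (tensor3 K A B C)"
    proof (rule module_homI)
      fix z assume "z \<in> carrier C"
      then show "tensor3_null K A B C +>\<^bsub>F\<^esub> free_gen K S (x, y, z) \<in> carrier (tensor3 K A B C)"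
        using * by (intro module_hom_mem[OF q] gen_closed)
    next
      fix z z' assume "z \<in> carrier C" "z' \<in> carrier C"
      then show "tensor3_null K A B C +>\<^bsub>F\<^esub> free_gen K S (x, y, z \<oplus>\<^bsub>C\<^esub> z') =
          (tensor3_null K A B C +>\<^bsub>F\<^esub> free_gen K S (x, y, z)) \<oplus>\<^bsub>tensor3 K A B C\<^esub> (tensor3_null K A B C +>\<^bsub>F\<^esub> free_gen K S (x, y, z'))"
        using * by (intro add rels gen_closed C.a_closed)
    next
      fix k z assume "k \<in> carrier K" "z \<in> carrier C"
      then show "tensor3_null K A B C +>\<^bsub>F\<^esub> free_gen K S (x, y, k \<odot>\<^bsub>C\<^esub> z) =
          k \<odot>\<^bsub>tensor3 K A B C\<^esub> (tensor3_null K A B C +>\<^bsub>F\<^esub> free_gen K S (x, y, z))"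
        using * by (intro smult rels gen_closed C.smult_closed)
    qed
  qed
qed

text \<open>Extend \<open>h\<close> linearly from the triples to the free module. Trilinearity says
  exactly that the extension kills the six families of relations, hence their span, so it descends
  to the quotient.\<close>

lemma tensor3_universal:
  assumes N: "module K N" and h: "trilinear K A B C N h"
  shows "\<exists>g\<in>module_hom K (tensor3 K A B C) N.
    \<forall>x\<in>carrier A. \<forall>y\<in>carrier B. \<forall>z\<in>carrier C. g (pure3 K A B C x y z) = h x y z"
proof -
  note q = quot_hom[OF F.module_axioms submodule_tensor3_null, folded tensor3_def]
  have "(\<lambda>(x, y, z). h x y z) s \<in> carrier N" if "s \<in> S" for s
    using that by (auto intro: trilinear_closed[OF h])
  then have "\<exists>g\<in>module_hom K F N. \<forall>s\<in>S. g (free_gen K S s) = (\<lambda>(x, y, z). h x y z) s"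
    by (rule free_universal[OF N])
  then obtain g where g: "g \<in> module_hom K F N"
    and "\<forall>s\<in>S. g (free_gen K S s) = (\<lambda>(x, y, z). h x y z) s" by (elim bexE)
  then have gh: "g (free_gen K S (x, y, z)) = h x y z"
    if "x \<in> carrier A" "y \<in> carrier B" "z \<in> carrier C" for x y z
    using that by (auto dest: bspec[of _ _ "(x, y, z)"])
  interpret N: module K N by (rule N)
  interpret g: mod_hom K F N g using F.module_axioms N g by (simp add: mod_hom_def mod_hom_axioms_def)
  have zero: "u = v \<Longrightarrow> v \<in> carrier N \<Longrightarrow> u \<ominus>\<^bsub>N\<^esub> v = \<zero>\<^bsub>N\<^esub>" for u v
    by (simp add: a_minus_def abelian_group.r_neg[OF module.axioms(2)[OF N]])
  have add0: "g (u \<ominus>\<^bsub>F\<^esub> (v \<oplus>\<^bsub>F\<^esub> w)) = \<zero>\<^bsub>N\<^esub>"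
    if "u \<in> carrier F" "v \<in> carrier F" "w \<in> carrier F" "g u = g v \<oplus>\<^bsub>N\<^esub> g w" for u v w
    using that zero[OF that(4)] by simp
  have smult0: "g (u \<ominus>\<^bsub>F\<^esub> k \<odot>\<^bsub>F\<^esub> v) = \<zero>\<^bsub>N\<^esub>"
    if "u \<in> carrier F" "k \<in> carrier K" "v \<in> carrier F" "g u = k \<odot>\<^bsub>N\<^esub> g v" for u k v
    using that zero[OF that(4)] by simp
  have zero_on_rels: "g r = \<zero>\<^bsub>N\<^esub>" if "r \<in> tensor3_rels K A B C" for r
    using that unfolding tensor3_rels_def Let_def
  proof (elim UnE CollectE exE conjE; hypsubst)
    fix x x' y z assume *: "x \<in> carrier A" "x' \<in> carrier A" "y \<in> carrier B" "z \<in> carrier C"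
    show "g (free_gen K S (x \<oplus>\<^bsub>A\<^esub> x', y, z) \<ominus>\<^bsub>F\<^esub> (free_gen K S (x, y, z) \<oplus>\<^bsub>F\<^esub> free_gen K S (x', y, z))) = \<zero>\<^bsub>N\<^esub>"
      using * trilinear_add(1)[OF h *(1,3,4,2)] by (intro add0 gen_closed) (simp_all add: gh)
  next
    fix x y y' z assume *: "x \<in> carrier A" "y \<in> carrier B" "y' \<in> carrier B" "z \<in> carrier C"
    show "g (free_gen K S (x, y \<oplus>\<^bsub>B\<^esub> y', z) \<ominus>\<^bsub>F\<^esub> (free_gen K S (x, y, z) \<oplus>\<^bsub>F\<^esub> free_gen K S (x, y', z))) = \<zero>\<^bsub>N\<^esub>"
      using * trilinear_add(2)[OF h *(1,2,4,3)] by (intro add0 gen_closed) (simp_all add: gh)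
  next
    fix x y z z' assume *: "x \<in> carrier A" "y \<in> carrier B" "z \<in> carrier C" "z' \<in> carrier C"
    show "g (free_gen K S (x, y, z \<oplus>\<^bsub>C\<^esub> z') \<ominus>\<^bsub>F\<^esub> (free_gen K S (x, y, z) \<oplus>\<^bsub>F\<^esub> free_gen K S (x, y, z'))) = \<zero>\<^bsub>N\<^esub>"
      using * trilinear_add(3)[OF h *] by (intro add0 gen_closed) (simp_all add: gh)
  next
    fix k x y z assume *: "k \<in> carrier K" "x \<in> carrier A" "y \<in> carrier B" "z \<in> carrier C"
    show "g (free_gen K S (k \<odot>\<^bsub>A\<^esub> x, y, z) \<ominus>\<^bsub>F\<^esub> k \<odot>\<^bsub>F\<^esub> free_gen K S (x, y, z)) = \<zero>\<^bsub>N\<^esub>"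
      using * trilinear_smult(1)[OF h *] by (intro smult0 gen_closed) (simp_all add: gh)
    show "g (free_gen K S (x, k \<odot>\<^bsub>B\<^esub> y, z) \<ominus>\<^bsub>F\<^esub> k \<odot>\<^bsub>F\<^esub> free_gen K S (x, y, z)) = \<zero>\<^bsub>N\<^esub>"
      using * trilinear_smult(2)[OF h *] by (intro smult0 gen_closed) (simp_all add: gh)
    show "g (free_gen K S (x, y, k \<odot>\<^bsub>C\<^esub> z) \<ominus>\<^bsub>F\<^esub> k \<odot>\<^bsub>F\<^esub> free_gen K S (x, y, z)) = \<zero>\<^bsub>N\<^esub>"
      using * trilinear_smult(3)[OF h *] by (intro smult0 gen_closed) (simp_all add: gh)
  qed
  have null: "g w = \<zero>\<^bsub>N\<^esub>" if w: "w \<in> tensor3_null K A B C" for w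
    by (rule module_hom_span_zero[OF F.module_axioms N g tensor3_rels_subset zero_on_rels w[unfolded tensor3_null_def]])
  have "\<exists>k\<in>module_hom K (tensor3 K A B C) N. \<forall>w\<in>carrier F. k (tensor3_null K A B C +>\<^bsub>F\<^esub> w) = g w"
  proof (rule module_hom_factor[OF F.module_axioms module_tensor3 N q _ g])
    show "(+>\<^bsub>F\<^esub>) (tensor3_null K A B C) ` carrier F = carrier (tensor3 K A B C)"
      unfolding tensor3_def by (rule quot_surj)
    show "\<And>w. w \<in> carrier F \<Longrightarrow> tensor3_null K A B C +>\<^bsub>F\<^esub> w = \<zero>\<^bsub>tensor3 K A B C\<^esub> \<Longrightarrow> g w = \<zero>\<^bsub>N\<^esub>"
      unfolding tensor3_def quot_zero_iff[OF F.module_axioms submodule_tensor3_null] by (rule null)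
  qed
  then obtain k where "k \<in> module_hom K (tensor3 K A B C) N"
    and "\<forall>w\<in>carrier F. k (tensor3_null K A B C +>\<^bsub>F\<^esub> w) = g w" by blast
  then show ?thesis
    by (intro bexI[of _ k] ballI) (simp_all add: pure3_eq gen_closed gh)
qed

text \<open>Neither scalar multiples nor zero need a case of their own: a scalar is absorbed into
  the first factor of a pure tensor, and zero is the multiple by \<open>0\<close> of a pure
  tensor.\<close>

lemma tensor3_induct:
  assumes X: "X \<in> carrier (tensor3 K A B C)"
    and pure: "\<And>x y z. x \<in> carrier A \<Longrightarrow> y \<in> carrier B \<Longrightarrow> z \<in> carrier C \<Longrightarrow> P (pure3 K A B C x y z)"
    and add: "\<And>X Y. X \<in> carrier (tensor3 K A B C) \<Longrightarrow> Y \<in> carrier (tensor3 K A B C) \<Longrightarrow> P X \<Longrightarrow> P Y \<Longrightarrow>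
      P (X \<oplus>\<^bsub>tensor3 K A B C\<^esub> Y)"
  shows "P X"
proof -
  note q = quot_hom[OF F.module_axioms submodule_tensor3_null, folded tensor3_def]
  obtain w where w: "w \<in> carrier F" and Xw: "X = tensor3_null K A B C +>\<^bsub>F\<^esub> w"
    using X unfolding tensor3_def quot_surj[symmetric] by (rule imageE)
  have smult_gen: "P (tensor3_null K A B C +>\<^bsub>F\<^esub> (k \<odot>\<^bsub>F\<^esub> free_gen K S (x, y, z)))"
    if "k \<in> carrier K" "x \<in> carrier A" "y \<in> carrier B" "z \<in> carrier C" for k x y z
    using that pure[of "k \<odot>\<^bsub>A\<^esub> x" y z] trilinear_smult(1)[OF trilinear_pure3 that]
    by (simp add: module_hom_smult[OF q] gen_closed flip: pure3_eq)
  have "P (tensor3_null K A B C +>\<^bsub>F\<^esub> w)"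
  proof (rule dsum_induct[of S K "\<lambda>_. ring_module K" w, folded free_module_def])
    show "P (tensor3_null K A B C +>\<^bsub>F\<^esub> \<zero>\<^bsub>F\<^esub>)"
      using smult_gen[of "\<zero>\<^bsub>K\<^esub>" "\<zero>\<^bsub>A\<^esub>" "\<zero>\<^bsub>B\<^esub>" "\<zero>\<^bsub>C\<^esub>"]
      by (simp add: gen_closed)
  next
    fix s k assume s: "s \<in> S" and "k \<in> carrier (ring_module K)"
    then have k: "k \<in> carrier K" by (simp add: carrier_ring_module)
    obtain x y z where "s = (x, y, z)" by (cases s)
    then show "P (tensor3_null K A B C +>\<^bsub>F\<^esub> dsum_in S (\<lambda>_. ring_module K) s k)"
      unfolding free_smult_gen[OF A.is_cring s k] using s k by (simp add: smult_gen)
  next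
    fix u v assume "u \<in> carrier F" "v \<in> carrier F"
      "P (tensor3_null K A B C +>\<^bsub>F\<^esub> u)" "P (tensor3_null K A B C +>\<^bsub>F\<^esub> v)"
    then show "P (tensor3_null K A B C +>\<^bsub>F\<^esub> (u \<oplus>\<^bsub>F\<^esub> v))"
      unfolding module_hom_add[OF q \<open>u \<in> carrier F\<close> \<open>v \<in> carrier F\<close>]
      by (intro add module_hom_mem[OF q])
  qed (rule module_ring_module[OF A.is_cring], rule w)
  then show ?thesis using Xw by simp
qed

end


section \<open>Codes of bracketings\<close>

lemma deg_pos: "deg t > 0"
  by (induction t) auto

lemma odd_deg: "odd (deg t)"
  by (induction t) auto

lemma left_brackets_bounds: "j \<in> set (left_brackets m t) \<Longrightarrow> m \<le> j \<and> j < m + deg t"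
proof (induction t arbitrary: m)
  case (Bracket s t u)
  then show ?case using deg_pos[of s] by fastforce
qed simp

lemma left_brackets_shift: "left_brackets (m + k) t = map (\<lambda>j. j + k) (left_brackets m t)"
proof (induction t arbitrary: m)
  case (Bracket s t u)
  then show ?case
    using Bracket.IH(1)[of m] Bracket.IH(2)[of "m + deg s"] Bracket.IH(3)[of "m + deg s + deg t"] by (simp add: add_ac)
qed simp

text \<open>The three subtrees occupy consecutive intervals of letter numbers. Sortedness lets the
  list of brackets be recovered from its multiset after grafting.\<close>

lemma sorted_left_brackets: "sorted (left_brackets m t)"
proof (induction t arbitrary: m)
  case (Bracket s t u)
  then show ?case
    by (auto simp: sorted_append dest!: left_brackets_bounds)
qed simp

text \<open>The lists \<open>X\<close> and \<open>Y\<close> hold the brackets and letters to the right of a subtree. That the brackets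
  in \<open>X\<close> come late tells a letter from a bracket when the code is parsed from left to right.\<close>

lemma left_brackets_unique:
  assumes "left_brackets m t @ X = left_brackets m t' @ X'" "letters t @ Y = letters t' @ Y'"
    and "\<And>x. x \<in> set X \<Longrightarrow> m + deg t \<le> x" "\<And>x. x \<in> set X' \<Longrightarrow> m + deg t' \<le> x"
  shows "t = t' \<and> X = X' \<and> Y = Y'"
  using assms
proof (induction t arbitrary: m t' X X' Y Y')
  case (Letter v)
  show ?case
  proof (cases t')
    case (Bracket s' u' w')
    then have "m \<in> set X" using Letter.prems(1) by simp
    then show ?thesis using Letter.prems(3) by force
  qed (use Letter.prems in auto)
next
  case (Bracket s t u)
  show ?case
  proof (cases t')
    case (Letter v)
    then have "m \<in> set X'" using Bracket.prems(1) by (metis append_Cons append_Nil left_brackets.simps list.set_intros(1))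
    then show ?thesis using Bracket.prems(4) Letter by force
  next
    case t': (Bracket s' t1' u')
    have s: "s = s' \<and>
        left_brackets (m + deg s) t @ left_brackets (m + deg s + deg t) u @ X =
        left_brackets (m + deg s') t1' @ left_brackets (m + deg s' + deg t1') u' @ X' \<and>
        letters t @ letters u @ Y = letters t1' @ letters u' @ Y'"
      by (rule Bracket.IH(1)[of m])
        (use Bracket.prems t' in \<open>auto dest!: left_brackets_bounds simp: add.assoc intro: le_trans[rotated]\<close>, fastforce+)
    have t: "t = t1' \<and>
        left_brackets (m + deg s + deg t) u @ X = left_brackets (m + deg s + deg t1') u' @ X' \<and>
        letters u @ Y = letters u' @ Y'"
      by (rule Bracket.IH(2)[of "m + deg s"])
        (use s Bracket.prems(3,4) t' in \<open>auto dest!: left_brackets_bounds\<close>, fastforce+)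
    have "u = u' \<and> X = X' \<and> Y = Y'"
      by (rule Bracket.IH(3)[of "m + deg s + deg t"])
        (use s t Bracket.prems(3,4) t' in \<open>auto simp: algebra_simps\<close>)
    then show ?thesis using s t t' by simp
  qed
qed

text \<open>The entry that \<open>code\<close> drops is always the number of the first letter, so
  for a proper bracket no information is lost.\<close>

lemma left_brackets_code: "deg t > 1 \<Longrightarrow> left_brackets m t = m # map (\<lambda>j. j + m - 1) (code t)"
proof (cases t)
  case (Bracket s u w)
  have "left_brackets m t = m # tl (left_brackets m t)" using Bracket by simp
  \<comment> \<open>Both lists are compared with the one starting at \<open>1 + m\<close>: the shift
    lemma only moves upwards, and \<open>m\<close> may be \<open>0\<close>.\<close>
  moreover have "left_brackets (1 + m) t = map (\<lambda>j. j + 1) (left_brackets m t)"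
    using left_brackets_shift[of m 1 t] by (simp add: add.commute)
  then have "left_brackets m t = map (\<lambda>j. j - 1) (left_brackets (1 + m) t)" by (simp add: comp_def)
  then have "left_brackets m t = map (\<lambda>j. j + m - 1) (left_brackets 1 t)"
    unfolding left_brackets_shift by (simp add: comp_def)
  ultimately show ?thesis unfolding code_def by (metis map_tl)
qed simp

text \<open>Justifies the definite description in \<open>decode\<close>: word and code together
  determine the bracketing, by the uniqueness of parsing.\<close>

lemma decode_eqI:
  assumes "letters t = vs" "code t = js"
  shows "decode js vs = t"
  unfolding decode_def
proof (rule the_equality)
  fix t' assume t': "letters t' = vs \<and> code t' = js"
  have "left_brackets 1 t' = left_brackets 1 t"
  \<comment> \<open>A single letter and a bracket of three letters both have the empty code, because
    the outermost bracket is dropped; the length of the word tells them apart.\<close>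
  proof (cases "length vs > 1")
    case True
    then show ?thesis using left_brackets_code[of t' 1] left_brackets_code[of t 1] t' assms by simp
  next
    case False
    have "left_brackets 1 b = []" if "letters b = vs" for b :: "'a bracketing"
    proof (cases b)
      case (Bracket x y z)
      then have "length vs = deg x + deg y + deg z" using that by auto
      then show ?thesis using False deg_pos[of x] deg_pos[of y] by linarith
    qed simp
    then show ?thesis using t' assms by simp
  qed
  then show "t' = t" using left_brackets_unique[of 1 t' "[]" t "[]" "[]" "[]"] t' assms by simp
qed (use assms in blast)

text \<open>Letters are counted from 0 here and from 1 in \<open>graft_code\<close>.\<close>

fun graft :: "nat \<Rightarrow> 'v \<Rightarrow> 'v \<Rightarrow> 'v \<Rightarrow> 'v bracketing \<Rightarrow> 'v bracketing" where
  "graft i a b c (Letter v) = Bracket (Letter a) (Letter b) (Letter c)"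
| "graft i a b c (Bracket s t u) =
    (if i < deg s then Bracket (graft i a b c s) t u
     else if i < deg s + deg t then Bracket s (graft (i - deg s) a b c t) u
     else Bracket s t (graft (i - deg s - deg t) a b c u))"

lemma letters_graft:
  "i < deg t \<Longrightarrow> letters (graft i a b c t) = take i (letters t) @ [a, b, c] @ drop (Suc i) (letters t)"
proof (induction t arbitrary: i)
  case (Bracket s t u)
  then show ?case by (auto simp: Suc_diff_le)
qed simp

text \<open>One letter becomes three, so brackets opening strictly after it move by 2, while those
  opening at or before it stay. Multisets suffice because several brackets may open at the same
  letter and only their number there matters.\<close>

lemma mset_left_brackets_graft:
  assumes "i < deg t"
  shows "mset (left_brackets m (graft i a b c t)) =
    add_mset (m + i) (mset (map (\<lambda>j. if j > m + i then j + 2 else j) (left_brackets m t)))"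
  using assms
proof (induction t arbitrary: i m)
  case (Bracket s t u)
  \<comment> \<open>A subtree that ends before the grafted letter keeps its numbers, and one that
    starts after it is shifted as a whole. Only the subtree containing the letter uses the induction
    hypothesis.\<close>
  have low: "map (\<lambda>j. if j > m + i then j + 2 else j) (left_brackets n b) = left_brackets n b"
    if "n + deg b \<le> m + i" for n b
    by (rule map_idI) (use that in \<open>auto dest!: left_brackets_bounds\<close>)
  have high: "map (\<lambda>j. if j > m + i then j + 2 else j) (left_brackets n b) = left_brackets (n + 2) b"
    if "n > m + i" for n b
    unfolding left_brackets_shift by (rule map_cong) (use that in \<open>auto dest!: left_brackets_bounds\<close>)
  consider "i < deg s" | "\<not> i < deg s" "i < deg s + deg t" | "\<not> i < deg s" "\<not> i < deg s + deg t" by blast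
  then show ?case
  proof cases
    case 1
    have "deg (graft i a b c s) = deg s + 2" using 1 by (simp add: letters_graft)
    then show ?thesis
      using 1 Bracket.IH(1)[OF 1, of m] high[of "m + deg s" t] high[of "m + deg s + deg t" u]
      by (simp add: add_ac)
  next
    case 2
    have "deg (graft (i - deg s) a b c t) = deg t + 2" using 2 by (simp add: letters_graft)
    then show ?thesis
      using 2 Bracket.IH(2)[of "i - deg s" "m + deg s"] low[of m s] high[of "m + deg s + deg t" u]
      by (simp add: add_ac)
  next
    case 3
    then show ?thesis
      using Bracket.prems Bracket.IH(3)[of "i - deg s - deg t" "m + deg s + deg t"] low[of m s]
        low[of "m + deg s" t]
      by (simp add: add_ac)
  qed
qed simp

text \<open>Rule (b) is grafting. Both sides, with the outermost bracket restored, are sorted lists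
  with the same multiset, hence equal; the outermost entry \<open>1\<close> is never renumbered, as
  it does not exceed \<open>Suc i\<close>.\<close>

lemma code_graft:
  assumes i: "i < deg t" and t: "deg t > 1"
  shows "code (graft i a b c t) = graft_code (Suc i) (code t)"
proof -
  let ?f = "\<lambda>j. if j > Suc i then j + 2 else j"
  let ?js = "graft_code (Suc i) (code t)"
  have t1: "left_brackets 1 t = 1 # code t" using left_brackets_code[OF t, of 1] by simp
  have ge: "1 \<le> j" if "j \<in> set (code t)" for j
    using left_brackets_bounds[of j 1 t] t1 that by simp
  have "sorted (1 # ?js)"
  proof -
    have "sorted ?js" unfolding graft_code_def by (rule sorted_sort)
    moreover have "1 \<le> j" if "j \<in> set ?js" for j
      using that ge unfolding graft_code_def set_sort by (auto split: if_splits)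
    ultimately show ?thesis by simp
  qed
  moreover have "mset (1 # ?js) = mset (left_brackets 1 (graft i a b c t))"
    using mset_left_brackets_graft[OF i, of 1 a b c] by (simp only: t1) (simp add: graft_code_def)
  ultimately have "left_brackets 1 (graft i a b c t) = 1 # ?js"
    using properties_for_sort sorted_left_brackets by (metis sorted_sort_id)
  then show ?thesis by (simp add: code_def)
qed

lemma coded_rel_ge: "coded_rel p r \<Longrightarrow> p \<ge> 2"
  by (induction rule: coded_rel.induct) auto

text \<open>Rule (a) places a bracketing in slot \<open>i\<close> of a bracket whose other two
  factors are letters. Its formerly outermost bracket becomes an explicit entry \<open>i\<close>,
  its inner brackets move by \<open>i - 1\<close>, and the new outermost bracket is the omitted
  one.\<close>

lemma code_wrap:
  assumes "deg t > 1"
  shows "code (Bracket t (Letter a) (Letter b)) = wrap_code 1 (code t)"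
    "code (Bracket (Letter a) t (Letter b)) = wrap_code 2 (code t)"
    "code (Bracket (Letter a) (Letter b) t) = wrap_code 3 (code t)"
  using left_brackets_code[OF assms] by (auto simp: code_def[of "Bracket _ _ _"] wrap_code_def)

lemma ternary_index_cases:
  fixes i :: nat
  assumes "i \<in> {1..3}"
  obtains "i = 1" | "i = 2" | "i = 3"
  using assms by force

lemma word_split_2:
  assumes "length vs = n + 2"
  obtains us a b where "vs = us @ [a, b]" "length us = n"
proof -
  obtain a b where "drop n vs = [a, b]"
    using assms by (cases "drop n vs"; cases "tl (drop n vs)") (auto dest: arg_cong[where f = length])
  then have "vs = take n vs @ [a, b]" by (metis append_take_drop_id)
  then show ?thesis using that[of "take n vs" a b] assms by simp
qed

lemma word_split_3:
  assumes "k + 2 < length vs"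
  obtains xs a b c ys where "vs = xs @ [a, b, c] @ ys" "length xs = k"
proof
  show "vs = take k vs @ [vs ! k, vs ! Suc k, vs ! Suc (Suc k)] @ drop (Suc (Suc (Suc k))) vs"
    using assms by (simp add: Cons_nth_drop_Suc)
qed (use assms in auto)

text \<open>Without existence, \<open>decode\<close> would be an unspecified term and the relators
  would carry no meaning. The two rules are realised by the corresponding operations on
  trees.\<close>

lemma coded_rel_bracketing:
  assumes "coded_rel p r" "js \<in> set r" "length vs = 2 * p + 1"
  shows "\<exists>t. letters t = vs \<and> code t = js"
  using assms
proof (induction arbitrary: js vs rule: coded_rel.induct)
  case base
  then obtain a b c d e where vs: "vs = [a, b, c, d, e]"
    by (auto simp: numeral_eq_Suc length_Suc_conv)
  let ?L = Letter
  have "code (Bracket (Bracket (?L a) (?L b) (?L c)) (?L d) (?L e)) = [1]"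
    "code (Bracket (?L a) (Bracket (?L b) (?L c) (?L d)) (?L e)) = [2]"
    "code (Bracket (?L a) (?L b) (Bracket (?L c) (?L d) (?L e))) = [3]"
    by (simp_all add: code_def)
  moreover have "js = [1] \<or> js = [2] \<or> js = [3]" using base by auto
  ultimately show ?case unfolding vs by (metis append.simps letters.simps)
next
  case (wrap p r i)
  from wrap.prems obtain js' where js': "js' \<in> set r" "js = wrap_code i js'" by auto
  have p: "2 \<le> p" using coded_rel_ge[OF wrap.hyps(1)] .
  have len: "length vs = 2 * p + 1 + 2" using wrap.prems by simp
  from \<open>i \<in> {1..3}\<close> show ?case
  proof (cases rule: ternary_index_cases)
    case 1
    obtain us a b where "vs = us @ [a, b]" "length us = 2 * p + 1" by (rule word_split_2[OF len])
    moreover from wrap.IH[OF js'(1) this(2)] obtain t where "letters t = us" "code t = js'" by blast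
    ultimately show ?thesis
      using js' 1 p by (intro exI[of _ "Bracket t (Letter a) (Letter b)"]) (simp add: code_wrap)
  next
    case 2
    obtain a ws where ws: "vs = a # ws" using len by (cases vs) auto
    obtain us b where us: "ws = us @ [b]" using len ws by (cases ws rule: rev_cases) auto
    have "length us = 2 * p + 1" using len ws us by simp
    with wrap.IH[OF js'(1) this] obtain t where "letters t = us" "code t = js'" by blast
    then show ?thesis
      using js' 2 p us ws len by (intro exI[of _ "Bracket (Letter a) t (Letter b)"]) (simp add: code_wrap)
  next
    case 3
    obtain a ws where ws: "vs = a # ws" using len by (cases vs) auto
    obtain b us where us: "ws = b # us" using len ws by (cases ws) auto
    have "length us = 2 * p + 1" using len ws us by simp
    with wrap.IH[OF js'(1) this] obtain t where "letters t = us" "code t = js'" by blast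
    then show ?thesis
      using js' 3 p us ws len by (intro exI[of _ "Bracket (Letter a) (Letter b) t"]) (simp add: code_wrap)
  qed
next
  case (graft p r i)
  from graft.prems obtain js' where js': "js' \<in> set r" "js = graft_code i js'" by auto
  have p: "2 \<le> p" using coded_rel_ge[OF graft.hyps(1)] .
  obtain xs a b c ys where vs: "vs = xs @ [a, b, c] @ ys" "i = Suc (length xs)"
    by (rule word_split_3[of "i - 1" vs]) (use graft.prems graft.hyps in auto)
  have "length (xs @ a # ys) = 2 * p + 1" using vs graft.prems by simp
  \<comment> \<open>The letter kept at the contracted place is arbitrary, since grafting replaces
    it; \<open>a\<close> is merely at hand.\<close>
  with graft.IH[OF js'(1) this] obtain t where t: "letters t = xs @ a # ys" "code t = js'" by blast
  then have "length xs < deg t" "deg t > 1" using p vs graft.prems by auto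
  then show ?case
    using t vs js' by (intro exI[of _ "graft (length xs) a b c t"]) (simp add: letters_graft code_graft)
qed

lemma decode_coded_rel:
  assumes "coded_rel p r" "js \<in> set r" "length vs = 2 * p + 1"
  shows "letters (decode js vs) = vs" "code (decode js vs) = js"
  using coded_rel_bracketing[OF assms] by (auto simp: decode_eqI)

lemma decode_wrap:
  assumes "coded_rel p r" "js \<in> set r" "length vs = 2 * p + 1"
  shows "decode (wrap_code 1 js) (vs @ [a, b]) = Bracket (decode js vs) (Letter a) (Letter b)"
    "decode (wrap_code 2 js) (a # vs @ [b]) = Bracket (Letter a) (decode js vs) (Letter b)"
    "decode (wrap_code 3 js) (a # b # vs) = Bracket (Letter a) (Letter b) (decode js vs)"
  using decode_coded_rel[OF assms] coded_rel_ge[OF assms(1)] assms(3)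
  by (auto intro!: decode_eqI simp: code_wrap)

text \<open>The letter \<open>x\<close> is free because grafting discards it. In the evaluation it
  will be the product of \<open>a\<close>, \<open>b\<close> and \<open>c\<close>.\<close>

lemma decode_graft:
  assumes "coded_rel p r" "js \<in> set r" "length (xs @ x # ys) = 2 * p + 1"
  shows "decode (graft_code (Suc (length xs)) js) (xs @ [a, b, c] @ ys) =
    graft (length xs) a b c (decode js (xs @ x # ys))"
  using decode_coded_rel[OF assms] coded_rel_ge[OF assms(1)] assms(3)
  by (intro decode_eqI) (simp_all add: letters_graft code_graft)

text \<open>Codes see only the shape of a tree, so a renaming of letters commutes with
  decoding.\<close>

lemma decode_map:
  assumes "coded_rel p r" "js \<in> set r" "length vs = 2 * p + 1"
  shows "decode js (map f vs) = map_bracketing f (decode js vs)"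
proof (rule decode_eqI)
  have l: "letters (map_bracketing f t) = map f (letters t)" for t by (induction t) auto
  have "left_brackets m (map_bracketing f t) = left_brackets m t" for m t
    by (induction t arbitrary: m) (auto simp: l)
  then have "code (map_bracketing f t) = code t" for t by (simp add: code_def)
  then show "letters (map_bracketing f (decode js vs)) = map f vs"
    "code (map_bracketing f (decode js vs)) = js"
    using decode_coded_rel[OF assms] l by simp_all
qed


section \<open>Coded relations in a partially associative algebra\<close>

fun bracket_eval :: "('a \<Rightarrow> 'a \<Rightarrow> 'a \<Rightarrow> 'a) \<Rightarrow> ('v \<Rightarrow> 'a) \<Rightarrow> 'v bracketing \<Rightarrow> 'a" where
  "bracket_eval \<mu> g (Letter v) = g v"
| "bracket_eval \<mu> g (Bracket s t u) =
    \<mu> (bracket_eval \<mu> g s) (bracket_eval \<mu> g t) (bracket_eval \<mu> g u)"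

lemma bracket_eval_map: "bracket_eval \<mu> g (map_bracketing f t) = bracket_eval \<mu> (g \<circ> f) t"
  by (induction t) auto

text \<open>Over an alphabet of algebra elements, grafting only spells out a letter that was already
  the product of \<open>a\<close>, \<open>b\<close> and \<open>c\<close>, so the value does not
  change.\<close>

lemma bracket_eval_graft:
  "i < deg t \<Longrightarrow> letters t ! i = \<mu> a b c \<Longrightarrow>
    bracket_eval \<mu> id (graft i a b c t) = bracket_eval \<mu> id t"
proof (induction t arbitrary: i)
  case (Bracket s t u)
  consider "i < deg s" | "\<not> i < deg s" "i < deg s + deg t" | "\<not> i < deg s" "\<not> i < deg s + deg t" by blast
  then show ?case
  proof cases
    case 1
    then show ?thesis using Bracket.prems Bracket.IH(1)[of i] by (simp add: nth_append)
  next
    case 2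
    then have "i - deg s < deg t" by linarith
    then show ?thesis using 2 Bracket.prems Bracket.IH(2)[of "i - deg s"] by (simp add: nth_append)
  next
    case 3
    then have "\<not> i - deg s < deg t" "i - deg s - deg t < deg u" using Bracket.prems by auto
    then show ?thesis
      using 3 Bracket.prems Bracket.IH(3)[of "i - deg s - deg t"] by (simp add: nth_append)
  qed
qed simp

context ternary_algebra
begin

lemma trilinear_product: "trilinear K A A A A \<mu>"
  unfolding trilinear_def using linear_1 linear_2 linear_3 by blast

lemma product_closed:
  "x \<in> carrier A \<Longrightarrow> y \<in> carrier A \<Longrightarrow> z \<in> carrier A \<Longrightarrow> \<mu> x y z \<in> carrier A"
  by (rule trilinear_closed[OF trilinear_product])

lemma bracket_eval_closed:
  "g ` set (letters t) \<subseteq> carrier A \<Longrightarrow> bracket_eval \<mu> g t \<in> carrier A"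
  by (induction t) (auto intro!: product_closed)

end

lemma foldr_add_closed:
  assumes M: "module K M" and g: "\<And>j. j \<in> set r \<Longrightarrow> g j \<in> carrier M"
  shows "foldr (\<lambda>j w. g j \<oplus>\<^bsub>M\<^esub> w) r \<zero>\<^bsub>M\<^esub> \<in> carrier M"
proof -
  interpret M: module K M by fact
  show ?thesis using g by (induction r) auto
qed

lemma module_hom_foldr:
  assumes M: "module K M" and N: "module K N" and f: "f \<in> module_hom K M N"
    and g: "\<And>j. j \<in> set r \<Longrightarrow> g j \<in> carrier M"
  shows "f (foldr (\<lambda>j w. g j \<oplus>\<^bsub>M\<^esub> w) r \<zero>\<^bsub>M\<^esub>) = foldr (\<lambda>j w. f (g j) \<oplus>\<^bsub>N\<^esub> w) r \<zero>\<^bsub>N\<^esub>"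
  using g
proof (induction r)
  case Nil
  show ?case by (simp add: module_hom_zero[OF M N f])
next
  case (Cons j r)
  have "foldr (\<lambda>j w. g j \<oplus>\<^bsub>M\<^esub> w) r \<zero>\<^bsub>M\<^esub> \<in> carrier M"
    by (rule foldr_add_closed[OF M]) (simp add: Cons.prems)
  then show ?case using Cons by (simp add: module_hom_add[OF f])
qed

lemma (in partially_associative_algebra) coded_rel_eval:
  assumes "coded_rel p r" "set ls \<subseteq> carrier A" "length ls = 2 * p + 1"
  shows "foldr (\<lambda>js w. bracket_eval \<mu> id (decode js ls) \<oplus>\<^bsub>A\<^esub> w) r \<zero>\<^bsub>A\<^esub> = \<zero>\<^bsub>A\<^esub>"
  using assms
proof (induction arbitrary: ls rule: coded_rel.induct)
  case base
  then obtain a b c d e where ls: "ls = [a, b, c, d, e]"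
    by (auto simp: numeral_eq_Suc length_Suc_conv)
  let ?L = Letter
  have "decode [1] ls = Bracket (Bracket (?L a) (?L b) (?L c)) (?L d) (?L e)"
    "decode [2] ls = Bracket (?L a) (Bracket (?L b) (?L c) (?L d)) (?L e)"
    "decode [3] ls = Bracket (?L a) (?L b) (Bracket (?L c) (?L d) (?L e))"
    by (auto intro!: decode_eqI simp: code_def ls)
  then show ?case
    using base.prems partial_assoc[of a b c d e] product_closed
    by (simp add: ls M.a_assoc)
next
  case (wrap p r i)
  have p: "2 \<le> p" using coded_rel_ge[OF wrap.hyps(1)] .
  have len: "length ls = 2 * p + 1 + 2" using wrap.prems by simp
  \<comment> \<open>Rule (a) fixes the other two arguments of the outer product. What remains is a
    linear map \<open>h\<close>, which passes through the sum and sends the vanishing shorter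
    relation to zero.\<close>
  have sum: "foldr (\<lambda>js w. h (bracket_eval \<mu> id (decode js us)) \<oplus>\<^bsub>A\<^esub> w) r \<zero>\<^bsub>A\<^esub> = \<zero>\<^bsub>A\<^esub>"
    if h: "h \<in> module_hom K A A" and us: "set us \<subseteq> carrier A" "length us = 2 * p + 1" for h us
  proof -
    have "bracket_eval \<mu> id (decode js us) \<in> carrier A" if "js \<in> set r" for js
      using decode_coded_rel[OF wrap.hyps(1) that us(2)] us by (intro bracket_eval_closed) auto
    then have "h (foldr (\<lambda>js w. bracket_eval \<mu> id (decode js us) \<oplus>\<^bsub>A\<^esub> w) r \<zero>\<^bsub>A\<^esub>) =
        foldr (\<lambda>js w. h (bracket_eval \<mu> id (decode js us)) \<oplus>\<^bsub>A\<^esub> w) r \<zero>\<^bsub>A\<^esub>"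
      by (intro module_hom_foldr[OF module_axioms module_axioms h])
    then show ?thesis
      unfolding wrap.IH[OF us] module_hom_zero[OF module_axioms module_axioms h] by (rule sym)
  qed
  have fold_map_cong: "foldr (\<lambda>js w. F js \<oplus>\<^bsub>A\<^esub> w) (map g r) \<zero>\<^bsub>A\<^esub> = foldr (\<lambda>js w. G js \<oplus>\<^bsub>A\<^esub> w) r \<zero>\<^bsub>A\<^esub>"
    if "\<And>js. js \<in> set r \<Longrightarrow> F (g js) = G js" for F g and G :: "nat list \<Rightarrow> _"
    using that by (induction r) auto
  obtain x ws where ws: "ls = x # ws" using len by (cases ls) auto
  obtain y us where us: "ws = y # us" using len ws by (cases ws) auto
  from \<open>i \<in> {1..3}\<close> show ?case
  proof (cases rule: ternary_index_cases)
    case 1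
    obtain us a b where us: "ls = us @ [a, b]" "length us = 2 * p + 1" by (rule word_split_2[OF len])
    show ?thesis
      unfolding 1 us(1)
      by (subst fold_map_cong[OF _], simp only: decode_wrap[OF wrap.hyps(1) _ us(2)] bracket_eval.simps id_apply)
        (rule sum, use us wrap.prems in \<open>auto intro: linear_1\<close>)
  next
    case 2
    obtain us b where us: "ws = us @ [b]" using len ws by (cases ws rule: rev_cases) auto
    have l: "length us = 2 * p + 1" using len us ws by simp
    show ?thesis
      unfolding 2 ws us
      by (subst fold_map_cong[OF _], simp only: decode_wrap[OF wrap.hyps(1) _ l] bracket_eval.simps id_apply)
        (rule sum, use l us ws wrap.prems in \<open>auto intro: linear_2\<close>)
  next
    case 3
    have l: "length us = 2 * p + 1" using len us ws by simp
    show ?thesis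
      unfolding 3 ws us
      by (subst fold_map_cong[OF _], simp only: decode_wrap[OF wrap.hyps(1) _ l] bracket_eval.simps id_apply)
        (rule sum, use l us ws wrap.prems in \<open>auto intro: linear_3\<close>)
  qed
next
  case (graft p r i)
  obtain xs a b c ys where ls: "ls = xs @ [a, b, c] @ ys" "i = Suc (length xs)"
    by (rule word_split_3[of "i - 1" ls]) (use graft.prems graft.hyps in auto)
  \<comment> \<open>Contracting the three letters at place \<open>i\<close> to their product gives a
    word of the length handled by the induction hypothesis; its letters still lie in the
    algebra.\<close>
  let ?us = "xs @ \<mu> a b c # ys"
  have us: "length ?us = 2 * p + 1" "set ?us \<subseteq> carrier A"
    using graft.prems ls product_closed by auto
  have "bracket_eval \<mu> id (decode (graft_code i js) ls) = bracket_eval \<mu> id (decode js ?us)"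
    if js: "js \<in> set r" for js
    unfolding ls decode_graft[OF graft.hyps(1) js us(1)]
    by (rule bracket_eval_graft) (simp_all add: decode_coded_rel[OF graft.hyps(1) js us(1)])
  then have "foldr (\<lambda>js w. bracket_eval \<mu> id (decode js ls) \<oplus>\<^bsub>A\<^esub> w) (map (graft_code i) r) \<zero>\<^bsub>A\<^esub> =
      foldr (\<lambda>js w. bracket_eval \<mu> id (decode js ?us) \<oplus>\<^bsub>A\<^esub> w) r \<zero>\<^bsub>A\<^esub>"
    by (induction r) auto
  then show ?case using graft.IH[OF us(2,1)] by (rule trans)
qed

lemma (in partially_associative_algebra) coded_rel_eval_map:
  assumes r: "coded_rel p r" and ls: "g ` set ls \<subseteq> carrier A" "length ls = 2 * p + 1"
  shows "foldr (\<lambda>js w. bracket_eval \<mu> g (decode js ls) \<oplus>\<^bsub>A\<^esub> w) r \<zero>\<^bsub>A\<^esub> = \<zero>\<^bsub>A\<^esub>"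
proof -
  have "foldr (\<lambda>js w. bracket_eval \<mu> g (decode js ls) \<oplus>\<^bsub>A\<^esub> w) r \<zero>\<^bsub>A\<^esub> =
      foldr (\<lambda>js w. bracket_eval \<mu> id (decode js (map g ls)) \<oplus>\<^bsub>A\<^esub> w) r \<zero>\<^bsub>A\<^esub>"
    by (rule foldr_cong) (simp_all add: decode_map[OF r _ ls(2)] bracket_eval_map)
  then show ?thesis using coded_rel_eval[OF r, of "map g ls"] ls by simp
qed


section \<open>The graded pieces\<close>

lemma odd_triples_bounds:
  "(a, b, c) \<in> odd_triples n \<Longrightarrow> odd a \<and> odd b \<and> odd c \<and> a < n \<and> b < n \<and> c < n \<and> a + b + c = n"
  by (auto simp: odd_triples_def elim!: oddE)

lemma odd_triples_odd: "d \<in> odd_triples n \<Longrightarrow> odd n"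
  by (cases d) (auto simp: odd_triples_def)

lemma finite_odd_triples: "finite (odd_triples n)"
  by (rule finite_subset[of _ "{..n} \<times> {..n} \<times> {..n}"]) (auto simp: odd_triples_def)

section \<open>Each degree depends only on the degrees below it\<close>

lemma dsum_cong:
  assumes "\<And>i. i \<in> I \<Longrightarrow> M i = M' i"
  shows "dsum I M = dsum I M'"
proof -
  have "(\<Pi>\<^sub>E i\<in>I. carrier (M i)) = (\<Pi>\<^sub>E i\<in>I. carrier (M' i))"
    by (rule PiE_cong) (simp add: assms)
  moreover have "{i \<in> I. f i \<noteq> \<zero>\<^bsub>M i\<^esub>} = {i \<in> I. f i \<noteq> \<zero>\<^bsub>M' i\<^esub>}" for f
    using assms by auto
  moreover have "(\<lambda>i\<in>I. \<zero>\<^bsub>M i\<^esub>) = (\<lambda>i\<in>I. \<zero>\<^bsub>M' i\<^esub>)"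
    "(\<lambda>f g. \<lambda>i\<in>I. f i \<oplus>\<^bsub>M i\<^esub> g i) = (\<lambda>f g. \<lambda>i\<in>I. f i \<oplus>\<^bsub>M' i\<^esub> g i)"
    "(\<lambda>c f. \<lambda>i\<in>I. c \<odot>\<^bsub>M i\<^esub> f i) = (\<lambda>c f. \<lambda>i\<in>I. c \<odot>\<^bsub>M' i\<^esub> f i)"
    by (auto intro!: ext restrict_ext simp: assms)
  ultimately show ?thesis unfolding dsum_def by simp
qed

lemma tensor_at_cong:
  assumes "\<And>m. odd m \<Longrightarrow> m < n \<Longrightarrow> L m = L' m" "d \<in> odd_triples n"
  shows "tensor_at K L d = tensor_at K L' d"
  using assms by (cases d) (auto simp: tensor_at_def dest!: odd_triples_bounds)

lemma tensor_sum_cong: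
  assumes "\<And>m. odd m \<Longrightarrow> m < n \<Longrightarrow> L m = L' m"
  shows "tensor_sum K L n = tensor_sum K L' n"
  unfolding tensor_sum_def by (rule dsum_cong) (rule tensor_at_cong[OF assms])

lemma pure_tensor_cong:
  assumes L: "\<And>m. odd m \<Longrightarrow> m < n \<Longrightarrow> L m = L' m"
  shows "pure_tensor K L n d x y z = pure_tensor K L' n d x y z"
proof (cases d)
  case (fields a b c)
  have "pure3 K (L a) (L b) (L c) x y z = pure3 K (L' a) (L' b) (L' c) x y z" if "d \<in> odd_triples n"
    using odd_triples_bounds[of a b c n] that L fields by simp
  moreover have "\<zero>\<^bsub>tensor_at K L e\<^esub> = \<zero>\<^bsub>tensor_at K L' e\<^esub>" if "e \<in> odd_triples n" for e
    using tensor_at_cong[OF L that] by simp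
  ultimately show ?thesis
    by (auto simp: fields pure_tensor_def dsum_in_def intro!: restrict_ext)
qed

lemma name_coset_cong:
  assumes L: "\<And>m. odd m \<Longrightarrow> m < n \<Longrightarrow> L m = L' m"
  shows "name_coset K L n = name_coset K L' n"
proof -
  have "eval_comb K L n = eval_comb K L' n"
    by (rule ext) (simp add: eval_comb_def Let_def tensor_sum_cong[of n L L', OF L] pure_tensor_cong[of n L L', OF L])
  then show ?thesis by (intro ext) (simp add: name_coset_def)
qed

lemma bracket_value_cong:
  assumes "\<And>a b c. odd (a + b + c) \<Longrightarrow> a + b + c < n \<Longrightarrow> P (a, b, c) = P' (a, b, c)" "deg t < n"
  shows "bracket_value P t = bracket_value P' t"
  using assms(2)
proof (induction t)
  case (Bracket s t u)
  then show ?case using assms(1)[of "deg s" "deg t" "deg u"] by (simp add: odd_deg)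
qed simp

text \<open>The subtrees under the root have degree below \<open>n\<close>, and the root itself is
  read as a pure tensor, so neither a piece nor a product of degree \<open>n\<close> is
  consulted.\<close>

lemma bracketed_tensor_cong:
  assumes L: "\<And>m. odd m \<Longrightarrow> m < n \<Longrightarrow> L m = L' m"
    and P: "\<And>a b c. odd (a + b + c) \<Longrightarrow> a + b + c < n \<Longrightarrow> P (a, b, c) = P' (a, b, c)"
    and t: "deg t = n" "n > 1"
  shows "bracketed_tensor K L P t = bracketed_tensor K L' P' t"
proof (cases t)
  case (Bracket s u w)
  then have "deg s < n" "deg u < n" "deg w < n" "deg s + deg u + deg w = n"
    using t deg_pos[of s] deg_pos[of u] deg_pos[of w] by auto
  moreover have "bracket_value P b = bracket_value P' b" if "deg b < n" for b :: "'b bracketing"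
    by (rule bracket_value_cong[of n P P', OF P that])
  ultimately show ?thesis
    unfolding Bracket by (simp add: pure_tensor_cong[of n L L', OF L])
qed (use t in simp)

lemma relation_space_cong:
  assumes L: "\<And>m. odd m \<Longrightarrow> m < 2 * p + 1 \<Longrightarrow> L m = L' m"
    and P: "\<And>a b c. odd (a + b + c) \<Longrightarrow> a + b + c < 2 * p + 1 \<Longrightarrow> P (a, b, c) = P' (a, b, c)"
  shows "relation_space K V L P p = relation_space K V L' P' p"
proof -
  let ?T = "tensor_sum K L' (2 * p + 1)"
  have T: "tensor_sum K L (2 * p + 1) = ?T" by (rule tensor_sum_cong[OF L])
  have eq: "foldr (\<lambda>js w. bracketed_tensor K L P (decode js vs) \<oplus>\<^bsub>?T\<^esub> w) r \<zero>\<^bsub>?T\<^esub> =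
      foldr (\<lambda>js w. bracketed_tensor K L' P' (decode js vs) \<oplus>\<^bsub>?T\<^esub> w) r \<zero>\<^bsub>?T\<^esub>"
    if r: "coded_rel p r" and vs: "length vs = 2 * p + 1" for r vs
  proof (rule foldr_cong[OF refl refl])
    fix js w assume "js \<in> set r"
    then have "deg (decode js vs) = 2 * p + 1" using decode_coded_rel(1)[OF r _ vs] vs by simp
    \<comment> \<open>A coded relation has \<open>p\<close> at least 2, which rules out a single
      letter, where \<open>bracketed_tensor\<close> is undefined.\<close>
    then have "bracketed_tensor K L P (decode js vs) = bracketed_tensor K L' P' (decode js vs)"
      using coded_rel_ge[OF r] by (intro bracketed_tensor_cong[of "2 * p + 1" L L' P P', OF L P]) auto
    then show "bracketed_tensor K L P (decode js vs) \<oplus>\<^bsub>?T\<^esub> w = bracketed_tensor K L' P' (decode js vs) \<oplus>\<^bsub>?T\<^esub> w"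
      by simp
  qed
  have "{foldr (\<lambda>js w. bracketed_tensor K L P (decode js vs) \<oplus>\<^bsub>?T\<^esub> w) r \<zero>\<^bsub>?T\<^esub> | r vs.
          coded_rel p r \<and> set vs \<subseteq> carrier V \<and> length vs = 2 * p + 1} =
      {foldr (\<lambda>js w. bracketed_tensor K L' P' (decode js vs) \<oplus>\<^bsub>?T\<^esub> w) r \<zero>\<^bsub>?T\<^esub> | r vs.
          coded_rel p r \<and> set vs \<subseteq> carrier V \<and> length vs = 2 * p + 1}"
    by (intro Collect_cong iff_exI iffI; elim conjE; hypsubst; simp only: eq simp_thms)
  then show ?thesis unfolding relation_space_def Let_def T by simp
qed

text \<open>A later stage overwrites only its own odd degree, so the entry in degree
  \<open>n\<close> is final from stage \<open>n div 2\<close> on.\<close>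

lemma tower_piece: "n div 2 \<le> q \<Longrightarrow> fst (tower K V q) n = piece K V n"
proof (induction q)
  case (Suc q)
  show ?case
  proof (cases "n div 2 = Suc q")
    case False
    then have "n \<noteq> 2 * Suc q + 1" "n div 2 \<le> q" using Suc.prems by auto
    moreover obtain L P where "tower K V q = (L, P)" by fastforce
    ultimately show ?thesis using Suc.IH by (simp add: next_piece_def Let_def)
  qed (simp add: piece_def)
qed (simp add: piece_def)

lemma tower_product: "(a + b + c) div 2 \<le> q \<Longrightarrow> snd (tower K V q) (a, b, c) = piece_product K V (a, b, c)"
proof (induction q)
  case (Suc q)
  show ?case
  proof (cases "(a + b + c) div 2 = Suc q")
    case False
    then have "a + b + c \<noteq> 2 * Suc q + 1" "(a + b + c) div 2 \<le> q" using Suc.prems by auto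
    moreover obtain L P where "tower K V q = (L, P)" by fastforce
    ultimately show ?thesis using Suc.IH by (simp add: next_piece_def Let_def)
  qed (simp add: piece_product_def)
qed (simp add: piece_product_def)

lemma piece_1: "piece K V 1 = copy_module Gen V"
  by (simp add: piece_def)

text \<open>Removes the tower from the development. Stage \<open>p\<close> is built from data of
  stage \<open>p - 1\<close>, which agree with the final pieces and products in all odd degrees
  below \<open>n\<close>; by the congruence lemmas nothing else enters.\<close>

lemma
  assumes p: "p \<ge> 1" and n: "n = 2 * p + 1"
  shows piece_rec: "piece K V n = copy_module (name_coset K (piece K V) n)
      (quot_module (tensor_sum K (piece K V) n) (relation_space K V (piece K V) (piece_product K V) p))"
    and piece_product_rec: "a + b + c = n \<Longrightarrow> piece_product K V (a, b, c) x y z =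
      name_coset K (piece K V) n (relation_space K V (piece K V) (piece_product K V) p
        +>\<^bsub>tensor_sum K (piece K V) n\<^esub> pure_tensor K (piece K V) n (a, b, c) x y z)"
proof -
  obtain q where q: "p = Suc q" using p by (cases p) auto
  obtain L P where LP: "tower K V q = (L, P)" by fastforce
  have L: "L m = piece K V m" if "odd m" "m < n" for m
  proof -
    have "m div 2 \<le> q" using that n q by (auto elim!: oddE)
    then show ?thesis using tower_piece[of m q K V] LP by simp
  qed
  have P: "P (a, b, c) = piece_product K V (a, b, c)" if "odd (a + b + c)" "a + b + c < n" for a b c
  proof -
    have "(a + b + c) div 2 \<le> q" using that n q by presburger
    then show ?thesis using tower_product[of a b c q K V] LP by simp
  qed
  have T: "tensor_sum K L n = tensor_sum K (piece K V) n" by (rule tensor_sum_cong[OF L])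
  have R: "relation_space K V L P p = relation_space K V (piece K V) (piece_product K V) p"
    using L P n by (intro relation_space_cong) auto
  have N: "name_coset K L n = name_coset K (piece K V) n" by (rule name_coset_cong[OF L])
  have pure: "pure_tensor K L n d x y z = pure_tensor K (piece K V) n d x y z" for d x y z
    by (rule pure_tensor_cong[OF L])
  have np: "tower K V p = next_piece K V p (L, P)" using LP q by simp
  have "piece K V n = fst (tower K V p) n" using n by (simp add: piece_def)
  then show "piece K V n = copy_module (name_coset K (piece K V) n)
      (quot_module (tensor_sum K (piece K V) n) (relation_space K V (piece K V) (piece_product K V) p))"
    using n T R N by (simp add: np next_piece_def Let_def)
  assume abc: "a + b + c = n"
  then have "piece_product K V (a, b, c) = snd (tower K V p) (a, b, c)" using n by (simp add: piece_product_def)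
  then show "piece_product K V (a, b, c) x y z =
      name_coset K (piece K V) n (relation_space K V (piece K V) (piece_product K V) p
        +>\<^bsub>tensor_sum K (piece K V) n\<^esub> pure_tensor K (piece K V) n (a, b, c) x y z)"
    using n abc T R N pure by (simp add: np next_piece_def Let_def)
qed

section \<open>The pieces are modules with trilinear products\<close>

locale free_ternary = V: module K V
  for K :: "'k ring" and V :: "('k, 'v) module"
begin

abbreviation L :: "('k, 'v) pieces" where "L \<equiv> piece K V"
abbreviation P :: "('k, 'v) products" where "P \<equiv> piece_product K V"
abbreviation T :: "nat \<Rightarrow> ('k, ('k, 'v) tensors) module" where "T n \<equiv> tensor_sum K L n"
abbreviation R :: "nat \<Rightarrow> ('k, 'v) tensors set" where "R p \<equiv> relation_space K V L P p"
abbreviation pt :: "nat \<Rightarrow> nat \<times> nat \<times> nat \<Rightarrow> ('k, 'v) elem \<Rightarrow> ('k, 'v) elem \<Rightarrow> ('k, 'v) elem \<Rightarrow>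
    ('k, 'v) tensors" where
  "pt n \<equiv> pure_tensor K L n"

text \<open>The induction hypothesis on the degree. It is what makes the tensor sum of degree
  \<open>n\<close> a module and puts the relators inside it; from there the piece of degree
  \<open>n\<close> inherits the same properties.\<close>

definition regular_below :: "nat \<Rightarrow> bool" where
  "regular_below n \<longleftrightarrow> (\<forall>m<n. odd m \<longrightarrow> module K (L m) \<and>
    (\<forall>a b c. (a, b, c) \<in> odd_triples m \<longrightarrow> trilinear K (L a) (L b) (L c) (L m) (P (a, b, c))))"

lemma regular_belowD:
  assumes "regular_below n" "odd m" "m < n"
  shows "module K (L m)"
    and "(a, b, c) \<in> odd_triples m \<Longrightarrow> trilinear K (L a) (L b) (L c) (L m) (P (a, b, c))"
  using assms by (auto simp: regular_below_def)

lemma regular_below_triple: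
  assumes "regular_below n" "(a, b, c) \<in> odd_triples n"
  shows "module K (L a)" "module K (L b)" "module K (L c)"
  using regular_belowD(1)[OF assms(1)] odd_triples_bounds[OF assms(2)] by auto

lemma module_tensor_at: "regular_below n \<Longrightarrow> d \<in> odd_triples n \<Longrightarrow> module K (tensor_at K L d)"
  by (cases d) (auto simp: tensor_at_def intro: module_tensor3 regular_below_triple)

lemma module_tensor_sum: "regular_below n \<Longrightarrow> module K (T n)"
  unfolding tensor_sum_def by (rule module_dsum[OF V.is_cring module_tensor_at])

lemma pure_tensor_trilinear:
  assumes n: "regular_below n" and d: "(a, b, c) \<in> odd_triples n"
  shows "trilinear K (L a) (L b) (L c) (T n) (pt n (a, b, c))"
proof -
  have "dsum_in (odd_triples n) (tensor_at K L) (a, b, c) \<in> module_hom K (tensor_at K L (a, b, c)) (T n)"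
    unfolding tensor_sum_def by (rule dsum_in_hom[OF module_tensor_at[OF n] d])
  then have "dsum_in (odd_triples n) (tensor_at K L) (a, b, c) \<in> module_hom K (tensor3 K (L a) (L b) (L c)) (T n)"
    by (simp add: tensor_at_def)
  from trilinear_hom[OF trilinear_pure3[OF regular_below_triple[OF n d]] this]
  show ?thesis by (simp add: pure_tensor_def)
qed

text \<open>Combines the induction principles of direct sums and tensor products. The case
  \<open>zero\<close> covers degrees without odd triples, and scalars are absorbed into pure
  tensors.\<close>

lemma tensor_sum_induct:
  assumes n: "regular_below n" and w: "w \<in> carrier (T n)"
    and zero: "Q \<zero>\<^bsub>T n\<^esub>"
    and pure: "\<And>a b c x y z. (a, b, c) \<in> odd_triples n \<Longrightarrow> x \<in> carrier (L a) \<Longrightarrow> y \<in> carrier (L b) \<Longrightarrow>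
      z \<in> carrier (L c) \<Longrightarrow> Q (pt n (a, b, c) x y z)"
    and add: "\<And>u v. u \<in> carrier (T n) \<Longrightarrow> v \<in> carrier (T n) \<Longrightarrow> Q u \<Longrightarrow> Q v \<Longrightarrow> Q (u \<oplus>\<^bsub>T n\<^esub> v)"
  shows "Q w"
proof (rule dsum_induct[of "odd_triples n" K "tensor_at K L" w Q, folded tensor_sum_def])
  fix d X assume d: "d \<in> odd_triples n" and X: "X \<in> carrier (tensor_at K L d)"
  obtain a b c where abc: "d = (a, b, c)" by (cases d)
  have dn: "(a, b, c) \<in> odd_triples n" using d abc by simp
  note hom = dsum_in_hom[of "odd_triples n" K "tensor_at K L" d, OF module_tensor_at[OF n] d, folded tensor_sum_def]
  show "Q (dsum_in (odd_triples n) (tensor_at K L) d X)"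
  proof (rule tensor3_induct[OF regular_below_triple[OF n dn]])
    show "X \<in> carrier (tensor3 K (L a) (L b) (L c))" using X abc by (simp add: tensor_at_def)
    show "Q (dsum_in (odd_triples n) (tensor_at K L) d (pure3 K (L a) (L b) (L c) x y z))"
      if "x \<in> carrier (L a)" "y \<in> carrier (L b)" "z \<in> carrier (L c)" for x y z
      using pure[OF dn that] by (simp add: pure_tensor_def abc)
    fix X Y
    assume "X \<in> carrier (tensor3 K (L a) (L b) (L c))" "Y \<in> carrier (tensor3 K (L a) (L b) (L c))"
    then have XY: "X \<in> carrier (tensor_at K L d)" "Y \<in> carrier (tensor_at K L d)"
      by (simp_all add: tensor_at_def abc)
    assume "Q (dsum_in (odd_triples n) (tensor_at K L) d X)" "Q (dsum_in (odd_triples n) (tensor_at K L) d Y)"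
    then have "Q (dsum_in (odd_triples n) (tensor_at K L) d X \<oplus>\<^bsub>T n\<^esub>
        dsum_in (odd_triples n) (tensor_at K L) d Y)"
      using add[OF module_hom_mem[OF hom XY(1)] module_hom_mem[OF hom XY(2)]] by blast
    then have "Q (dsum_in (odd_triples n) (tensor_at K L) d (X \<oplus>\<^bsub>tensor_at K L d\<^esub> Y))"
      by (simp only: module_hom_add[OF hom XY])
    then show "Q (dsum_in (odd_triples n) (tensor_at K L) d (X \<oplus>\<^bsub>tensor3 K (L a) (L b) (L c)\<^esub> Y))"
      by (simp add: tensor_at_def abc)
  qed
qed (use w zero add module_tensor_at[OF n] in auto)

text \<open>Each tensor product supplies one linear map per triple of degrees, and the direct sum
  glues the chosen maps.\<close>

lemma tensor_sum_universal:
  assumes n: "regular_below n" and N: "module K N"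
    and h: "\<And>a b c. (a, b, c) \<in> odd_triples n \<Longrightarrow> trilinear K (L a) (L b) (L c) N (h (a, b, c))"
  shows "\<exists>g\<in>module_hom K (T n) N. \<forall>a b c x y z. (a, b, c) \<in> odd_triples n \<longrightarrow> x \<in> carrier (L a) \<longrightarrow>
    y \<in> carrier (L b) \<longrightarrow> z \<in> carrier (L c) \<longrightarrow> g (pt n (a, b, c) x y z) = h (a, b, c) x y z"
proof -
  have "\<exists>g. g \<in> module_hom K (tensor_at K L d) N \<and> (\<forall>a b c x y z. d = (a, b, c) \<longrightarrow> x \<in> carrier (L a) \<longrightarrow>
      y \<in> carrier (L b) \<longrightarrow> z \<in> carrier (L c) \<longrightarrow> g (pure3 K (L a) (L b) (L c) x y z) = h d x y z)"
    if d: "d \<in> odd_triples n" for d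
  proof -
    obtain a b c where abc: "d = (a, b, c)" by (cases d)
    have dn: "(a, b, c) \<in> odd_triples n" using d abc by simp
    obtain g where "g \<in> module_hom K (tensor3 K (L a) (L b) (L c)) N"
      "\<forall>x\<in>carrier (L a). \<forall>y\<in>carrier (L b). \<forall>z\<in>carrier (L c). g (pure3 K (L a) (L b) (L c) x y z) = h (a, b, c) x y z"
      using tensor3_universal[OF regular_below_triple[OF n dn] N h[OF dn]] by (elim bexE)
    then show ?thesis by (intro exI[of _ g]) (auto simp: abc tensor_at_def)
  qed
  then obtain g where g: "\<And>d. d \<in> odd_triples n \<Longrightarrow> g d \<in> module_hom K (tensor_at K L d) N"
    and gh: "\<And>a b c x y z. (a, b, c) \<in> odd_triples n \<Longrightarrow> x \<in> carrier (L a) \<Longrightarrow>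
      y \<in> carrier (L b) \<Longrightarrow> z \<in> carrier (L c) \<Longrightarrow> g (a, b, c) (pure3 K (L a) (L b) (L c) x y z) = h (a, b, c) x y z"
    by metis
  have "\<exists>k\<in>module_hom K (T n) N. \<forall>d\<in>odd_triples n. \<forall>X\<in>carrier (tensor_at K L d).
      k (dsum_in (odd_triples n) (tensor_at K L) d X) = g d X"
    unfolding tensor_sum_def by (rule dsum_universal[OF module_tensor_at[OF n] N g])
  then obtain k where k: "k \<in> module_hom K (T n) N"
    and kg: "\<forall>d\<in>odd_triples n. \<forall>X\<in>carrier (tensor_at K L d). k (dsum_in (odd_triples n) (tensor_at K L) d X) = g d X"
    by (elim bexE)
  have "k (pt n (a, b, c) x y z) = h (a, b, c) x y z"
    if dn: "(a, b, c) \<in> odd_triples n" and xyz: "x \<in> carrier (L a)" "y \<in> carrier (L b)" "z \<in> carrier (L c)"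
    for a b c x y z
  proof -
    have "pure3 K (L a) (L b) (L c) x y z \<in> carrier (tensor_at K L (a, b, c))"
      using trilinear_closed[OF trilinear_pure3[OF regular_below_triple[OF n dn]] xyz] by (simp add: tensor_at_def)
    then show ?thesis using kg dn gh[OF dn xyz] by (simp add: pure_tensor_def)
  qed
  then show ?thesis using k by (intro bexI[of _ k]) auto
qed

lemma carrier_L_1: "carrier (L 1) = Gen ` carrier V"
  unfolding piece_1 carrier_copy ..

lemma Gen_hom: "Gen \<in> module_hom K V (L 1)"
  unfolding piece_1 by (rule copy_hom[OF V.module_axioms]) (simp add: inj_on_def)

lemma module_L_1: "module K (L 1)"
  unfolding piece_1 by (rule module_copy[OF V.module_axioms]) (simp add: inj_on_def)

lemma deg_triple: "deg (Bracket s t u) = n \<Longrightarrow> (deg s, deg t, deg u) \<in> odd_triples n"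
  by (auto simp: odd_triples_def odd_deg)

lemma bracket_value_closed:
  assumes n: "regular_below n" and t: "deg t < n" "set (letters t) \<subseteq> carrier V"
  shows "bracket_value P t \<in> carrier (L (deg t))"
  using t
proof (induction t)
  case (Letter v)
  then show ?case using carrier_L_1 by simp
next
  case (Bracket s t u)
  have d: "(deg s, deg t, deg u) \<in> odd_triples (deg (Bracket s t u))" by (rule deg_triple) (rule refl)
  show ?case
    unfolding bracket_value.simps
    by (rule trilinear_closed[OF regular_belowD(2)[OF n odd_deg _ d]]) (use Bracket in auto)
qed

lemma bracketed_tensor_closed:
  assumes n: "regular_below n" and t: "deg t = n" "n > 1" "set (letters t) \<subseteq> carrier V"
  shows "bracketed_tensor K L P t \<in> carrier (T n)"
proof (cases t)
  case (Bracket s u w)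
  have d: "(deg s, deg u, deg w) \<in> odd_triples n" using t Bracket by (intro deg_triple) simp
  have sum: "deg s + deg u + deg w = n" using t Bracket by simp
  have "deg s < n" "deg u < n" "deg w < n" using odd_triples_bounds[OF d] by auto
  moreover have "set (letters s) \<subseteq> carrier V" "set (letters u) \<subseteq> carrier V" "set (letters w) \<subseteq> carrier V"
    using t Bracket by auto
  ultimately show ?thesis
    unfolding Bracket bracketed_tensor.simps sum
    by (intro trilinear_closed[OF pure_tensor_trilinear[OF n d]] bracket_value_closed[OF n])
qed (use t in simp)

definition relators :: "nat \<Rightarrow> ('k, 'v) tensors set" where
  "relators p = {foldr (\<lambda>js w. bracketed_tensor K L P (decode js vs) \<oplus>\<^bsub>T (2 * p + 1)\<^esub> w) r \<zero>\<^bsub>T (2 * p + 1)\<^esub> | r vs.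
    coded_rel p r \<and> set vs \<subseteq> carrier V \<and> length vs = 2 * p + 1}"

lemma relation_space_eq: "R p = LinearCombinations.module.span K (T (2 * p + 1)) (relators p)"
  by (simp only: relation_space_def relators_def Let_def)

lemma relators_closed:
  assumes n: "regular_below (2 * p + 1)"
  shows "relators p \<subseteq> carrier (T (2 * p + 1))"
proof
  fix w assume "w \<in> relators p"
  then obtain r vs where w: "w = foldr (\<lambda>js w. bracketed_tensor K L P (decode js vs) \<oplus>\<^bsub>T (2 * p + 1)\<^esub> w) r \<zero>\<^bsub>T (2 * p + 1)\<^esub>"
    and r: "coded_rel p r" and vs: "set vs \<subseteq> carrier V" "length vs = 2 * p + 1"
    unfolding relators_def by blast
  show "w \<in> carrier (T (2 * p + 1))"
    unfolding w
  proof (rule foldr_add_closed[OF module_tensor_sum[OF n]])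
    fix js assume "js \<in> set r"
    then show "bracketed_tensor K L P (decode js vs) \<in> carrier (T (2 * p + 1))"
      using decode_coded_rel(1)[OF r _ vs(2)] vs coded_rel_ge[OF r]
      by (intro bracketed_tensor_closed[OF n]) auto
  qed
qed

lemma submodule_relation_space: "regular_below (2 * p + 1) \<Longrightarrow> submodule K (R p) (T (2 * p + 1))"
  unfolding relation_space_eq
  by (rule module.span_is_submodule[OF module_tensor_sum relators_closed])

text \<open>Every element of the tensor sum is a finite sum of pure tensors, which is what makes a
  list an adequate name for a coset.\<close>

lemma eval_comb_surj:
  assumes n: "regular_below n" and w: "w \<in> carrier (T n)"
  shows "\<exists>ts. eval_comb K L n ts = w"
proof -
  interpret T: module K "T n" by (rule module_tensor_sum[OF n])
  define tm where "tm = (\<lambda>(d, k, x, y, z). k \<odot>\<^bsub>T n\<^esub> pt n d x y z)"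
  have ev: "eval_comb K L n ts = foldr (\<lambda>t w. tm t \<oplus>\<^bsub>T n\<^esub> w) ts \<zero>\<^bsub>T n\<^esub>" for ts
    unfolding eval_comb_def Let_def tm_def by (rule foldr_cong) auto
  \<comment> \<open>The claim is strengthened by closedness of the single terms: concatenating two
    lists adds their values only by associativity, which holds on the carrier alone.\<close>
  have "\<exists>ts. tm ` set ts \<subseteq> carrier (T n) \<and> foldr (\<lambda>t w. tm t \<oplus>\<^bsub>T n\<^esub> w) ts \<zero>\<^bsub>T n\<^esub> = w"
    using n w
  proof (rule tensor_sum_induct)
    show "\<exists>ts. tm ` set ts \<subseteq> carrier (T n) \<and> foldr (\<lambda>t w. tm t \<oplus>\<^bsub>T n\<^esub> w) ts \<zero>\<^bsub>T n\<^esub> = \<zero>\<^bsub>T n\<^esub>"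
      by (intro exI[of _ "[]"]) simp
  next
    fix a b c x y z assume d: "(a, b, c) \<in> odd_triples n"
      and xyz: "x \<in> carrier (L a)" "y \<in> carrier (L b)" "z \<in> carrier (L c)"
    have "pt n (a, b, c) x y z \<in> carrier (T n)" by (rule trilinear_closed[OF pure_tensor_trilinear[OF n d] xyz])
    then show "\<exists>ts. tm ` set ts \<subseteq> carrier (T n) \<and>
        foldr (\<lambda>t w. tm t \<oplus>\<^bsub>T n\<^esub> w) ts \<zero>\<^bsub>T n\<^esub> = pt n (a, b, c) x y z"
      by (intro exI[of _ "[((a, b, c), \<one>\<^bsub>K\<^esub>, x, y, z)]"]) (simp add: tm_def)
  next
    fix u v
    assume "\<exists>ts. tm ` set ts \<subseteq> carrier (T n) \<and> foldr (\<lambda>t w. tm t \<oplus>\<^bsub>T n\<^esub> w) ts \<zero>\<^bsub>T n\<^esub> = u"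
      "\<exists>ts. tm ` set ts \<subseteq> carrier (T n) \<and> foldr (\<lambda>t w. tm t \<oplus>\<^bsub>T n\<^esub> w) ts \<zero>\<^bsub>T n\<^esub> = v"
    then obtain ss ts where s: "tm ` set ss \<subseteq> carrier (T n)" "foldr (\<lambda>t w. tm t \<oplus>\<^bsub>T n\<^esub> w) ss \<zero>\<^bsub>T n\<^esub> = u"
      and t: "tm ` set ts \<subseteq> carrier (T n)" "foldr (\<lambda>t w. tm t \<oplus>\<^bsub>T n\<^esub> w) ts \<zero>\<^bsub>T n\<^esub> = v"
      by (elim exE conjE)
    assume v: "v \<in> carrier (T n)"
    \<comment> \<open>Folding \<open>ss @ ts\<close> is folding \<open>ss\<close> with the value
      \<open>v\<close> of \<open>ts\<close> as starting point.\<close>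
    have "foldr (\<lambda>t w. tm t \<oplus>\<^bsub>T n\<^esub> w) ss v = foldr (\<lambda>t w. tm t \<oplus>\<^bsub>T n\<^esub> w) ss \<zero>\<^bsub>T n\<^esub> \<oplus>\<^bsub>T n\<^esub> v"
      using s(1)
    proof (induction ss)
      case Nil
      then show ?case using v by simp
    next
      case (Cons t ss)
      have "foldr (\<lambda>t w. tm t \<oplus>\<^bsub>T n\<^esub> w) ss \<zero>\<^bsub>T n\<^esub> \<in> carrier (T n)"
        by (rule foldr_add_closed[OF T.module_axioms]) (use Cons.prems in auto)
      then show ?case using Cons v T.a_assoc by simp
    qed
    then show "\<exists>ts. tm ` set ts \<subseteq> carrier (T n) \<and>
        foldr (\<lambda>t w. tm t \<oplus>\<^bsub>T n\<^esub> w) ts \<zero>\<^bsub>T n\<^esub> = u \<oplus>\<^bsub>T n\<^esub> v"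
      using s t by (intro exI[of _ "ss @ ts"]) auto
  qed
  then show ?thesis unfolding ev by blast
qed

text \<open>By the preceding lemma the choice in \<open>name_coset\<close> is never from an empty set, so the chosen
  representative determines the coset.\<close>

lemma name_coset_inj:
  assumes n: "regular_below (2 * p + 1)"
  shows "inj_on (name_coset K L (2 * p + 1)) (carrier (quot_module (T (2 * p + 1)) (R p)))"
proof (rule inj_onI)
  let ?T = "T (2 * p + 1)" and ?R = "R p" and ?ev = "eval_comb K L (2 * p + 1)"
  note M = module_tensor_sum[OF n] and S = submodule_relation_space[OF n]
  interpret abelian_subgroup ?R ?T by (rule submodule_abelian_subgroup[OF M S])
  have coset: "?ev (SOME ts. ?ev ts \<in> X) \<in> carrier ?T \<and> X = ?R +>\<^bsub>?T\<^esub> ?ev (SOME ts. ?ev ts \<in> X)"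
    if X: "X \<in> carrier (quot_module ?T ?R)" for X
  proof -
    obtain w where w: "w \<in> carrier ?T" "X = ?R +>\<^bsub>?T\<^esub> w"
      using X unfolding quot_surj[symmetric] by (rule imageE)
    obtain ts where "?ev ts = w" using eval_comb_surj[OF n w(1)] by blast
    then have "?ev ts \<in> X" using w a_rcos_self[OF w(1)] by simp
    then have ev: "?ev (SOME ts. ?ev ts \<in> X) \<in> X" by (rule someI)
    then have closed: "?ev (SOME ts. ?ev ts \<in> X) \<in> carrier ?T"
      using a_r_coset_subset_G[OF a_subset w(1)] w(2) by blast
    then show ?thesis using coset_eq_iff[OF M S closed w(1)] ev w(2) by simp
  qed
  fix X Y assume X: "X \<in> carrier (quot_module ?T ?R)" and Y: "Y \<in> carrier (quot_module ?T ?R)"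
    and eq: "name_coset K L (2 * p + 1) X = name_coset K L (2 * p + 1) Y"
  from eq have some: "(SOME ts. ?ev ts \<in> X) = (SOME ts. ?ev ts \<in> Y)" by (simp add: name_coset_def)
  have "X = ?R +>\<^bsub>?T\<^esub> ?ev (SOME ts. ?ev ts \<in> X)" using coset[OF X] by blast
  also have "\<dots> = Y" unfolding some using coset[OF Y] by simp
  finally show "X = Y" .
qed

text \<open>The canonical projection followed by the renaming of cosets. Surjectivity and control of
  its kernel let the piece be used as a quotient without further mention of names.\<close>

definition proj :: "nat \<Rightarrow> ('k, 'v) tensors \<Rightarrow> ('k, 'v) elem" where
  "proj p w = name_coset K L (2 * p + 1) (R p +>\<^bsub>T (2 * p + 1)\<^esub> w)"

context
  fixes p n
  assumes p: "p \<ge> 1" and n: "n = 2 * p + 1" and regular_below: "regular_below n"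
begin

lemma submodule_R: "submodule K (R p) (T n)"
  using submodule_relation_space[of p] regular_below n by simp

lemma module_L: "module K (L n)"
  unfolding piece_rec[OF p n, of K V]
  using name_coset_inj[of p] regular_below n
  by (intro module_copy module_quot[OF module_tensor_sum[OF regular_below] submodule_R]) simp

lemma proj_hom: "proj p \<in> module_hom K (T n) (L n)"
proof -
  have "name_coset K L n \<in> module_hom K (quot_module (T n) (R p)) (L n)"
    unfolding piece_rec[OF p n, of K V]
    using name_coset_inj[of p] regular_below n
    by (intro copy_hom module_quot[OF module_tensor_sum[OF regular_below] submodule_R]) simp
  from module_hom_comp[OF quot_hom[OF module_tensor_sum[OF regular_below] submodule_R] this]
  show ?thesis unfolding proj_def[abs_def] n .
qed

lemma proj_surj: "proj p ` carrier (T n) = carrier (L n)"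
proof -
  have "carrier (L n) = name_coset K L n ` (\<lambda>w. R p +>\<^bsub>T n\<^esub> w) ` carrier (T n)"
    unfolding piece_rec[OF p n, of K V] carrier_copy quot_surj ..
  then show ?thesis by (simp add: image_image proj_def[abs_def] n)
qed

text \<open>The zero of the renamed module is the name of the zero coset, so injectivity of the
  naming turns the equation into one between cosets. This inclusion of the kernel in
  \<open>R p\<close> is what factoring a linear map through \<open>proj p\<close> requires.\<close>

lemma proj_zero: "w \<in> carrier (T n) \<Longrightarrow> proj p w = \<zero>\<^bsub>L n\<^esub> \<Longrightarrow> w \<in> R p"
proof -
  assume w: "w \<in> carrier (T n)" and z: "proj p w = \<zero>\<^bsub>L n\<^esub>"
  have "\<zero>\<^bsub>L n\<^esub> = name_coset K L n \<zero>\<^bsub>quot_module (T n) (R p)\<^esub>"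
    unfolding piece_rec[OF p n, of K V] copy_zero ..
  with z have eq: "name_coset K L n (R p +>\<^bsub>T n\<^esub> w) = name_coset K L n \<zero>\<^bsub>quot_module (T n) (R p)\<^esub>"
    unfolding proj_def n[symmetric] by (rule trans)
  interpret Q: module K "quot_module (T n) (R p)"
    by (rule module_quot[OF module_tensor_sum[OF regular_below] submodule_R])
  have "R p +>\<^bsub>T n\<^esub> w = \<zero>\<^bsub>quot_module (T n) (R p)\<^esub>"
    using name_coset_inj[of p] regular_below n
    by (intro inj_onD[OF _ eq _ Q.zero_closed] module_hom_mem[OF quot_hom[OF module_tensor_sum[OF regular_below] submodule_R] w]) simp
  then show "w \<in> R p" using quot_zero_iff[OF module_tensor_sum[OF regular_below] submodule_R w] by simp
qed

lemma P_eq: "(a, b, c) \<in> odd_triples n \<Longrightarrow> P (a, b, c) x y z = proj p (pt n (a, b, c) x y z)"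
  unfolding proj_def n[symmetric]
  by (rule piece_product_rec[OF p n]) (simp add: odd_triples_def)

lemma trilinear_P_step:
  assumes d: "(a, b, c) \<in> odd_triples n"
  shows "trilinear K (L a) (L b) (L c) (L n) (P (a, b, c))"
proof -
  have "P (a, b, c) = (\<lambda>x y z. proj p (pt n (a, b, c) x y z))" by (intro ext P_eq d)
  then show ?thesis using trilinear_hom[OF pure_tensor_trilinear[OF regular_below d] proj_hom] by simp
qed

end

text \<open>Closes the circle: the preceding facts about degree \<open>n\<close> assume regularity
  below \<open>n\<close> and yield the step to \<open>Suc n\<close>.\<close>

lemma regular_below: "regular_below n"
proof (induction n)
  case 0
  show ?case by (simp add: regular_below_def)
next
  case (Suc n)
  have "module K (L n) \<and> (\<forall>a b c. (a, b, c) \<in> odd_triples n \<longrightarrow> trilinear K (L a) (L b) (L c) (L n) (P (a, b, c)))"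
    if odd: "odd n"
  proof -
    obtain p where n: "n = 2 * p + 1" using odd by (rule oddE)
    show ?thesis
    proof (cases "p = 0")
      case True
      \<comment> \<open>Three odd numbers add up to at least 3, so no product lands in degree
        1.\<close>
      then have "odd_triples n = {}" using n by (auto simp: odd_triples_def elim!: oddE)
      then show ?thesis using True n module_L_1 by simp
    next
      case False
      then have p: "p \<ge> 1" by simp
      show ?thesis using module_L[OF p n Suc.IH] trilinear_P_step[OF p n Suc.IH] by blast
    qed
  qed
  then show ?case using Suc.IH unfolding regular_below_def less_Suc_eq by blast
qed

lemma module_piece: "odd n \<Longrightarrow> module K (L n)"
  using regular_belowD(1)[OF regular_below[of "Suc n"]] by simp

lemma trilinear_piece_product:
  "(a, b, c) \<in> odd_triples n \<Longrightarrow> trilinear K (L a) (L b) (L c) (L n) (P (a, b, c))"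
  by (rule regular_belowD(2)[OF regular_below[of "Suc n"]]) (use odd_triples_odd in auto)

end

section \<open>Linear and trilinear maps into and out of direct sums\<close>

lemma module_hom_finsum:
  assumes M: "module K M" and N: "module K N" and D: "finite D"
    and h: "\<And>d. d \<in> D \<Longrightarrow> h d \<in> module_hom K M N"
  shows "(\<lambda>x. finsum N (\<lambda>d. h d x) D) \<in> module_hom K M N"
proof -
  interpret N: module K N by fact
  note hc = module_hom_mem[OF h]
  show ?thesis
  proof (rule module_homI)
    fix x assume "x \<in> carrier M"
    then show "finsum N (\<lambda>d. h d x) D \<in> carrier N" by (intro N.finsum_closed) (auto intro: hc)
  next
    fix x y assume xy: "x \<in> carrier M" "y \<in> carrier M"
    have "finsum N (\<lambda>d. h d (x \<oplus>\<^bsub>M\<^esub> y)) D = finsum N (\<lambda>d. h d x \<oplus>\<^bsub>N\<^esub> h d y) D"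
      by (rule N.finsum_cong') (use xy in \<open>auto intro: hc simp: module_hom_add[OF h]\<close>)
    also have "\<dots> = finsum N (\<lambda>d. h d x) D \<oplus>\<^bsub>N\<^esub> finsum N (\<lambda>d. h d y) D"
      by (rule N.finsum_addf) (use xy in \<open>auto intro: hc\<close>)
    finally show "finsum N (\<lambda>d. h d (x \<oplus>\<^bsub>M\<^esub> y)) D =
      finsum N (\<lambda>d. h d x) D \<oplus>\<^bsub>N\<^esub> finsum N (\<lambda>d. h d y) D" .
  next
    fix c x assume c: "c \<in> carrier K" and x: "x \<in> carrier M"
    have "finsum N (\<lambda>d. h d (c \<odot>\<^bsub>M\<^esub> x)) D = finsum N (\<lambda>d. c \<odot>\<^bsub>N\<^esub> h d x) D"
      by (rule N.finsum_cong') (use c x in \<open>auto intro: hc simp: module_hom_smult[OF h]\<close>)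
    also have "\<dots> = c \<odot>\<^bsub>N\<^esub> finsum N (\<lambda>d. h d x) D"
      by (rule N.finsum_smult_ldistr[symmetric]) (use c x D in \<open>auto intro: hc\<close>)
    finally show "finsum N (\<lambda>d. h d (c \<odot>\<^bsub>M\<^esub> x)) D = c \<odot>\<^bsub>N\<^esub> finsum N (\<lambda>d. h d x) D" .
  qed
qed

lemma trilinear_finsum:
  assumes "module K A" "module K B" "module K C" "module K N" "finite D"
    and h: "\<And>d. d \<in> D \<Longrightarrow> trilinear K A B C N (h d)"
  shows "trilinear K A B C N (\<lambda>x y z. finsum N (\<lambda>d. h d x y z) D)"
  unfolding trilinear_def
  by (intro conjI ballI module_hom_finsum assms(1-5) trilinearD[OF h])

lemma dsum_component_hom: "i \<in> I \<Longrightarrow> (\<lambda>x. x i) \<in> module_hom K (dsum I M) (M i)"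
  by (rule module_homI) (auto simp: carrier_dsum dsum_add dsum_smult)

lemma module_hom_dsum:
  assumes "\<And>x. x \<in> carrier N \<Longrightarrow> f x \<in> carrier (dsum I M)"
    and h: "\<And>i. i \<in> I \<Longrightarrow> (\<lambda>x. f x i) \<in> module_hom K N (M i)"
    and N: "module K N"
  shows "f \<in> module_hom K N (dsum I M)"
proof (rule module_homI)
  interpret N: module K N by fact
  have ext: "f x \<in> extensional I" if "x \<in> carrier N" for x
    using assms(1)[OF that] by (simp add: carrier_dsum)
  fix x assume x: "x \<in> carrier N"
  fix y assume y: "y \<in> carrier N"
  show "f (x \<oplus>\<^bsub>N\<^esub> y) = f x \<oplus>\<^bsub>dsum I M\<^esub> f y"
    by (rule extensionalityI[OF ext])
      (use x y in \<open>auto simp: dsum_add module_hom_add[OF h]\<close>)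
next
  interpret N: module K N by fact
  have ext: "f x \<in> extensional I" if "x \<in> carrier N" for x
    using assms(1)[OF that] by (simp add: carrier_dsum)
  fix c x assume "c \<in> carrier K" "x \<in> carrier N"
  then show "f (c \<odot>\<^bsub>N\<^esub> x) = c \<odot>\<^bsub>dsum I M\<^esub> f x"
    by (intro extensionalityI[OF ext]) (auto simp: dsum_smult module_hom_smult[OF h])
qed (rule assms(1))

lemma trilinear_dsum:
  assumes "\<And>x y z. x \<in> carrier A \<Longrightarrow> y \<in> carrier B \<Longrightarrow> z \<in> carrier C \<Longrightarrow> f x y z \<in> carrier (dsum I M)"
    and h: "\<And>i. i \<in> I \<Longrightarrow> trilinear K A B C (M i) (\<lambda>x y z. f x y z i)"
    and "module K A" "module K B" "module K C"
  shows "trilinear K A B C (dsum I M) f"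
  unfolding trilinear_def
  by (intro conjI ballI module_hom_dsum assms(1,3-5) trilinearD[OF h])

lemma module_hom_dsum_eqI:
  assumes M: "\<And>i. i \<in> I \<Longrightarrow> module K (M i)" and N: "module K N"
    and f: "f \<in> module_hom K (dsum I M) N" and g: "g \<in> module_hom K (dsum I M) N"
    and eq: "\<And>i m. i \<in> I \<Longrightarrow> m \<in> carrier (M i) \<Longrightarrow> f (dsum_in I M i m) = g (dsum_in I M i m)"
    and x: "x \<in> carrier (dsum I M)"
  shows "f x = g x"
proof -
  interpret N: module K N by fact
  note D = module_dsum[OF N.is_cring M]
  show ?thesis
  proof (rule dsum_induct[OF M x])
    show "f \<zero>\<^bsub>dsum I M\<^esub> = g \<zero>\<^bsub>dsum I M\<^esub>"
      by (simp add: module_hom_zero[OF D N f] module_hom_zero[OF D N g])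
    show "f (u \<oplus>\<^bsub>dsum I M\<^esub> v) = g (u \<oplus>\<^bsub>dsum I M\<^esub> v)"
      if "u \<in> carrier (dsum I M)" "v \<in> carrier (dsum I M)" "f u = g u" "f v = g v" for u v
      using that by (simp add: module_hom_add[OF f] module_hom_add[OF g])
  qed (assumption, rule eq)
qed

text \<open>With two arguments fixed, both sides are linear in the third, so the arguments are
  reduced to homogeneous ones one after the other, starting with the last.\<close>

lemma trilinear_dsum_eqI:
  assumes M: "\<And>i. i \<in> I \<Longrightarrow> module K (M i)" and N: "module K N"
    and f: "trilinear K (dsum I M) (dsum I M) (dsum I M) N f"
    and g: "trilinear K (dsum I M) (dsum I M) (dsum I M) N g"
    and eq: "\<And>i j k x y z. i \<in> I \<Longrightarrow> j \<in> I \<Longrightarrow> k \<in> I \<Longrightarrow>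
      x \<in> carrier (M i) \<Longrightarrow> y \<in> carrier (M j) \<Longrightarrow> z \<in> carrier (M k) \<Longrightarrow>
      f (dsum_in I M i x) (dsum_in I M j y) (dsum_in I M k z) =
      g (dsum_in I M i x) (dsum_in I M j y) (dsum_in I M k z)"
    and x: "x \<in> carrier (dsum I M)" and y: "y \<in> carrier (dsum I M)" and z: "z \<in> carrier (dsum I M)"
  shows "f x y z = g x y z"
proof (rule module_hom_dsum_eqI[OF M N trilinearD(3)[OF f x y] trilinearD(3)[OF g x y] _ z])
  fix k c assume k: "k \<in> I" and c: "c \<in> carrier (M k)"
  note kc = dsum_in_closed[of I K M, OF M k c]
  show "f x y (dsum_in I M k c) = g x y (dsum_in I M k c)"
  proof (rule module_hom_dsum_eqI[OF M N trilinearD(2)[OF f x kc] trilinearD(2)[OF g x kc] _ y])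
    fix j b assume j: "j \<in> I" and b: "b \<in> carrier (M j)"
    note jb = dsum_in_closed[of I K M, OF M j b]
    show "f x (dsum_in I M j b) (dsum_in I M k c) = g x (dsum_in I M j b) (dsum_in I M k c)"
      by (rule module_hom_dsum_eqI[OF M N trilinearD(1)[OF f jb kc] trilinearD(1)[OF g jb kc] eq[OF _ j k _ b c] x])
  qed
qed


section \<open>The free algebra\<close>

context free_ternary
begin

abbreviation FA :: "('k, nat \<Rightarrow> ('k, 'v) elem) module" where "FA \<equiv> free_algebra K V"
abbreviation hom_in :: "nat \<Rightarrow> ('k, 'v) elem \<Rightarrow> (nat \<Rightarrow> ('k, 'v) elem)" where
  "hom_in \<equiv> dsum_in {n. odd n} L"

lemma module_free_algebra: "module K FA"
  unfolding free_algebra_def by (rule module_dsum[OF V.is_cring]) (simp add: module_piece)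

lemma hom_in_hom: "odd n \<Longrightarrow> hom_in n \<in> module_hom K (L n) FA"
  unfolding free_algebra_def by (rule dsum_in_hom) (simp_all add: module_piece)

lemma component_trilinear:
  assumes n: "odd n"
  shows "trilinear K FA FA FA (L n) (\<lambda>x y z. free_product K V x y z n)"
proof -
  have comp: "(\<lambda>x. x a) \<in> module_hom K FA (L a)" if "odd a" for a
    unfolding free_algebra_def by (rule dsum_component_hom) (simp add: that)
  have "trilinear K FA FA FA (L n) ((\<lambda>(a, b, c) x y z. P (a, b, c) (x a) (y b) (z c)) d)"
    if d: "d \<in> odd_triples n" for d
  proof -
    obtain a b c where abc: "d = (a, b, c)" by (cases d)
    have dn: "(a, b, c) \<in> odd_triples n" using d abc by simp
    then have "odd a" "odd b" "odd c" using odd_triples_bounds[OF dn] by auto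
    then show ?thesis
      unfolding abc prod.case by (intro trilinear_comp[OF trilinear_piece_product[OF dn]] comp)
  qed
  from trilinear_finsum[OF module_free_algebra module_free_algebra module_free_algebra module_piece[OF n]
      finite_odd_triples this]
  show ?thesis using n by (simp add: free_product_def case_prod_unfold)
qed

text \<open>Only finiteness of the support takes an argument. Once \<open>n\<close> exceeds the sum
  of bounds for the three supports, every triple of degrees with sum \<open>n\<close> has an entry
  beyond its bound, so each summand has a zero factor.\<close>

lemma free_product_closed:
  assumes x: "x \<in> carrier FA" and y: "y \<in> carrier FA" and z: "z \<in> carrier FA"
  shows "free_product K V x y z \<in> carrier FA"
  unfolding free_algebra_def carrier_dsum
proof (intro conjI ballI)
  show "free_product K V x y z \<in> extensional {n. odd n}" by (simp add: free_product_def)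
  show "free_product K V x y z n \<in> carrier (L n)" if "n \<in> {n. odd n}" for n
    using trilinear_closed[OF component_trilinear x y z] that by simp
  have "\<exists>N. \<forall>a. odd a \<longrightarrow> a > N \<longrightarrow> w a = \<zero>\<^bsub>L a\<^esub>" if "w \<in> carrier FA" for w
  proof -
    have "finite {n \<in> {n. odd n}. w n \<noteq> \<zero>\<^bsub>L n\<^esub>}" using that by (simp add: free_algebra_def carrier_dsum)
    then obtain N where "\<forall>n\<in>{n \<in> {n. odd n}. w n \<noteq> \<zero>\<^bsub>L n\<^esub>}. n \<le> N"
      using finite_nat_set_iff_bounded_le by auto
    then show ?thesis by (intro exI[of _ N]) force
  qed
  then obtain X Y Z where X: "\<And>a. odd a \<Longrightarrow> a > X \<Longrightarrow> x a = \<zero>\<^bsub>L a\<^esub>"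
    and Y: "\<And>a. odd a \<Longrightarrow> a > Y \<Longrightarrow> y a = \<zero>\<^bsub>L a\<^esub>" and Z: "\<And>a. odd a \<Longrightarrow> a > Z \<Longrightarrow> z a = \<zero>\<^bsub>L a\<^esub>"
    using x y z by metis
  have mem: "w a \<in> carrier (L a)" if "w \<in> carrier FA" "odd a" for w a
    using that by (simp add: free_algebra_def carrier_dsum)
  have "free_product K V x y z n = \<zero>\<^bsub>L n\<^esub>" if n: "odd n" "n > X + Y + Z" for n
  proof -
    interpret Ln: module K "L n" by (rule module_piece[OF n(1)])
    have "P (a, b, c) (x a) (y b) (z c) = \<zero>\<^bsub>L n\<^esub>" if d: "(a, b, c) \<in> odd_triples n" for a b c
    proof -
      have odd: "odd a" "odd b" "odd c" and "a > X \<or> b > Y \<or> c > Z"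
        using odd_triples_bounds[OF d] n by auto
      then show ?thesis
        using trilinear_zero[OF trilinear_piece_product[OF d] module_piece module_piece module_piece
            module_piece[OF n(1)], OF odd mem[OF x odd(1)] mem[OF y odd(2)] mem[OF z odd(3)]] X Y Z
        by auto
    qed
    then have "finsum (L n) (\<lambda>(a, b, c). P (a, b, c) (x a) (y b) (z c)) (odd_triples n) =
        finsum (L n) (\<lambda>_. \<zero>\<^bsub>L n\<^esub>) (odd_triples n)"
      by (intro Ln.finsum_cong') auto
    then show ?thesis using n by (simp add: free_product_def)
  qed
  then have "{n \<in> {n. odd n}. free_product K V x y z n \<noteq> \<zero>\<^bsub>L n\<^esub>} \<subseteq> {..X + Y + Z}"
    by (force simp: not_le[symmetric])
  then show "finite {n \<in> {n. odd n}. free_product K V x y z n \<noteq> \<zero>\<^bsub>L n\<^esub>}"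
    by (rule finite_subset) simp
qed

lemma trilinear_free_product: "trilinear K FA FA FA FA (free_product K V)"
proof -
  have "trilinear K FA FA FA (dsum {n. odd n} L) (free_product K V)"
    by (rule trilinear_dsum)
      (simp_all add: component_trilinear module_free_algebra free_product_closed flip: free_algebra_def)
  then show ?thesis by (simp add: free_algebra_def)
qed

text \<open>On homogeneous elements the convolution sum collapses: any triple other than
  \<open>(a, b, c)\<close> meets a zero component, and \<open>(a, b, c)\<close> itself occurs only
  in degree \<open>n\<close>.\<close>

lemma free_product_hom_in:
  assumes d: "(a, b, c) \<in> odd_triples n"
    and x: "x \<in> carrier (L a)" and y: "y \<in> carrier (L b)" and z: "z \<in> carrier (L c)"
  shows "free_product K V (hom_in a x) (hom_in b y) (hom_in c z) = hom_in n (P (a, b, c) x y z)"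
proof (rule extensionalityI[of _ "{n. odd n}"])
  have n: "odd n" using odd_triples_odd[OF d] .
  fix m :: nat assume "m \<in> {n. odd n}"
  then have m: "odd m" by simp
  interpret Lm: module K "L m" by (rule module_piece[OF m])
  define h where "h = (\<lambda>(a', b', c'). P (a', b', c') (hom_in a x a') (hom_in b y b') (hom_in c z c'))"
  have abc: "odd a" "odd b" "odd c" using odd_triples_bounds[OF d] by auto
  have closed: "hom_in i w j \<in> carrier (L j)" if "odd i" "odd j" "w \<in> carrier (L i)" for i j w
    using module_hom_mem[OF hom_in_hom[OF that(1)] that(3)] that(2) by (simp add: free_algebra_def carrier_dsum)
  have zero: "h e = \<zero>\<^bsub>L m\<^esub>" if e: "e \<in> odd_triples m" "e \<noteq> (a, b, c)" for e
  proof -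
    obtain a' b' c' where e': "e = (a', b', c')" by (cases e)
    have em: "(a', b', c') \<in> odd_triples m" using e e' by simp
    have odd: "odd a'" "odd b'" "odd c'" using odd_triples_bounds[OF em] by auto
    have "hom_in a x a' = \<zero>\<^bsub>L a'\<^esub> \<or> hom_in b y b' = \<zero>\<^bsub>L b'\<^esub> \<or> hom_in c z c' = \<zero>\<^bsub>L c'\<^esub>"
      using e e' odd by (auto simp: dsum_in_def)
    then show ?thesis
      using trilinear_zero[OF trilinear_piece_product[OF em] module_piece module_piece module_piece
          module_piece[OF m], OF odd closed[OF abc(1) odd(1) x] closed[OF abc(2) odd(2) y] closed[OF abc(3) odd(3) z]]
      by (auto simp: h_def e')
  qed
  have hclosed: "h e \<in> carrier (L m)" if e: "e \<in> odd_triples m" for e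
  proof -
    obtain a' b' c' where e': "e = (a', b', c')" by (cases e)
    have em: "(a', b', c') \<in> odd_triples m" using e e' by simp
    have odd: "odd a'" "odd b'" "odd c'" using odd_triples_bounds[OF em] by auto
    show ?thesis
      unfolding h_def e' prod.case
      by (intro trilinear_closed[OF trilinear_piece_product[OF em]] closed abc odd x y z)
  qed
  have fp: "free_product K V (hom_in a x) (hom_in b y) (hom_in c z) m = finsum (L m) h (odd_triples m)"
    using m by (simp add: free_product_def h_def)
  show "free_product K V (hom_in a x) (hom_in b y) (hom_in c z) m = hom_in n (P (a, b, c) x y z) m"
  proof (cases "m = n")
    case True
    have "finsum (L m) h (odd_triples m) = finsum (L m) h {(a, b, c)}"
      by (rule Lm.add.finprod_mono_neutral_cong_right)
        (use True d zero hclosed finite_odd_triples in auto)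
    also have "\<dots> = h (a, b, c)"
    proof -
      have "h (a, b, c) \<in> carrier (L m)" using hclosed d True by simp
      then show ?thesis by (subst Lm.finsum_insert) auto
    qed
    also have "\<dots> = P (a, b, c) x y z" using abc by (simp add: h_def dsum_in_def)
    finally show ?thesis using fp True n by (simp add: dsum_in_def)
  next
    case False
    then have "(a, b, c) \<notin> odd_triples m" using d by (auto simp: odd_triples_def)
    then have "finsum (L m) h (odd_triples m) = finsum (L m) (\<lambda>_. \<zero>\<^bsub>L m\<^esub>) (odd_triples m)"
      using zero by (intro Lm.finsum_cong') auto
    then show ?thesis using fp False m by (simp add: dsum_in_def)
  qed
qed (simp_all add: free_product_def dsum_in_def)

lemma free_inclusion_eq: "free_inclusion K V v = hom_in 1 (Gen v)"
  by (simp add: free_inclusion_def)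

section \<open>Existence of the extension\<close>

lemma hom_from_L_1:
  assumes A: "module K A" and f: "f \<in> module_hom K V A"
  shows "\<exists>g\<in>module_hom K (L 1) A. \<forall>v\<in>carrier V. g (Gen v) = f v"
proof (rule module_hom_factor[OF V.module_axioms module_L_1 A Gen_hom _ f])
  show "Gen ` carrier V = carrier (L 1)" using carrier_L_1 by simp
  fix v assume "v \<in> carrier V" "Gen v = \<zero>\<^bsub>L 1\<^esub>"
  then have "v = \<zero>\<^bsub>V\<^esub>" unfolding piece_1 copy_zero by simp
  then show "f v = \<zero>\<^bsub>A\<^esub>" by (simp add: module_hom_zero[OF V.module_axioms A f])
qed

text \<open>The components of the desired morphism, degree by degree. Compatibility with products is
  part of the recursion, because it is what evaluates the inner brackets of the relators in the next
  degree.\<close>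

lemma piece_hom_exists:
  assumes A: "partially_associative_algebra K A \<mu>" and f: "f \<in> module_hom K V A"
  shows "\<exists>G. \<forall>n. odd n \<longrightarrow> G n \<in> module_hom K (L n) A \<and>
    (n = 1 \<longrightarrow> (\<forall>v\<in>carrier V. G n (Gen v) = f v)) \<and>
    (\<forall>a b c x y z. (a, b, c) \<in> odd_triples n \<longrightarrow> x \<in> carrier (L a) \<longrightarrow> y \<in> carrier (L b) \<longrightarrow>
      z \<in> carrier (L c) \<longrightarrow> G n (P (a, b, c) x y z) = \<mu> (G a x) (G b y) (G c z))"
proof -
  interpret A: partially_associative_algebra K A \<mu> by fact
  note MA = A.module_axioms
  \<comment> \<open>Here \<open>r\<close> is the candidate for degree \<open>n\<close>, while
    \<open>G\<close> is consulted only at the three strictly smaller degrees of an odd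
    triple.\<close>
  define Q where "Q G n r \<longleftrightarrow> (odd n \<longrightarrow> r \<in> module_hom K (L n) A \<and>
    (n = 1 \<longrightarrow> (\<forall>v\<in>carrier V. r (Gen v) = f v)) \<and>
    (\<forall>a b c x y z. (a, b, c) \<in> odd_triples n \<longrightarrow> x \<in> carrier (L a) \<longrightarrow> y \<in> carrier (L b) \<longrightarrow>
      z \<in> carrier (L c) \<longrightarrow> r (P (a, b, c) x y z) = \<mu> (G a x) (G b y) (G c z)))"
    for G :: "nat \<Rightarrow> ('k, 'v) elem \<Rightarrow> 'a" and n and r
  have "\<exists>G. \<forall>n. Q G n (G n)"
  \<comment> \<open>Two obligations: the condition depends on \<open>G\<close> only below
    \<open>n\<close>, and a suitable \<open>r\<close> exists whenever \<open>G\<close> is correct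
    below \<open>n\<close>.\<close>
  proof (rule dependent_wellorder_choice)
    fix r and G G' :: "nat \<Rightarrow> ('k, 'v) elem \<Rightarrow> 'a" and n :: nat
    assume eq: "\<And>m. m < n \<Longrightarrow> G m = G' m"
    have "G a = G' a \<and> G b = G' b \<and> G c = G' c" if "(a, b, c) \<in> odd_triples n" for a b c
      using odd_triples_bounds[OF that] eq by simp
    then have "((a, b, c) \<in> odd_triples n \<longrightarrow> x \<in> carrier (L a) \<longrightarrow> y \<in> carrier (L b) \<longrightarrow>
        z \<in> carrier (L c) \<longrightarrow> r (P (a, b, c) x y z) = \<mu> (G a x) (G b y) (G c z)) \<longleftrightarrow>
      ((a, b, c) \<in> odd_triples n \<longrightarrow> x \<in> carrier (L a) \<longrightarrow> y \<in> carrier (L b) \<longrightarrow>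
        z \<in> carrier (L c) \<longrightarrow> r (P (a, b, c) x y z) = \<mu> (G' a x) (G' b y) (G' c z))" for a b c x y z
      by simp
    then show "Q G n r = Q G' n r" unfolding Q_def by presburger
  next
    fix n :: nat and G :: "nat \<Rightarrow> ('k, 'v) elem \<Rightarrow> 'a"
    assume IH: "\<And>m. m < n \<Longrightarrow> Q G m (G m)"
    show "\<exists>r. Q G n r"
    proof (cases "odd n")
      case False
      then show ?thesis by (simp add: Q_def)
    next
      case True
      then obtain p where n: "n = 2 * p + 1" by (rule oddE)
      show ?thesis
      proof (cases "p = 0")
        case True
        then have n1: "n = 1" and "odd_triples n = {}" using n by (auto simp: odd_triples_def elim!: oddE)
        moreover obtain g where "g \<in> module_hom K (L 1) A" "\<forall>v\<in>carrier V. g (Gen v) = f v"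
          using hom_from_L_1[OF MA f] by blast
        ultimately show ?thesis by (intro exI[of _ g]) (simp add: Q_def)
      next
        case False
        then have p: "p \<ge> 1" by simp
        have G_hom: "G m \<in> module_hom K (L m) A" if "odd m" "m < n" for m
          using IH[OF that(2)] that(1) by (simp add: Q_def)
        have G_Gen: "G 1 (Gen v) = f v" if "v \<in> carrier V" for v
          using IH[of 1] that p n by (simp add: Q_def)
        have G_P: "G m (P (a, b, c) x y z) = \<mu> (G a x) (G b y) (G c z)"
          if "m < n" "(a, b, c) \<in> odd_triples m" "x \<in> carrier (L a)" "y \<in> carrier (L b)" "z \<in> carrier (L c)"
          for m a b c x y z
          using IH[OF that(1)] odd_triples_odd[OF that(2)] that(2-) unfolding Q_def by blast
        \<comment> \<open>Written as a function applied to a triple, the shape that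
          \<open>tensor_sum_universal\<close> expects.\<close>
        have tri: "trilinear K (L a) (L b) (L c) A ((\<lambda>(a, b, c) x y z. \<mu> (G a x) (G b y) (G c z)) (a, b, c))"
          if d: "(a, b, c) \<in> odd_triples n" for a b c
          unfolding prod.case
          by (rule trilinear_comp[OF A.trilinear_product]; rule G_hom) (use odd_triples_bounds[OF d] in auto)
        obtain \<phi> where \<phi>: "\<phi> \<in> module_hom K (T n) A"
          and "\<forall>a b c x y z. (a, b, c) \<in> odd_triples n \<longrightarrow> x \<in> carrier (L a) \<longrightarrow>
            y \<in> carrier (L b) \<longrightarrow> z \<in> carrier (L c) \<longrightarrow>
            \<phi> (pt n (a, b, c) x y z) = (\<lambda>(a, b, c) x y z. \<mu> (G a x) (G b y) (G c z)) (a, b, c) x y z"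
          using tensor_sum_universal[OF regular_below MA, of n "\<lambda>(a, b, c) x y z. \<mu> (G a x) (G b y) (G c z)"] tri
          by blast
        then have \<phi>_pt: "\<phi> (pt n (a, b, c) x y z) = \<mu> (G a x) (G b y) (G c z)"
          if "(a, b, c) \<in> odd_triples n" "x \<in> carrier (L a)" "y \<in> carrier (L b)" "z \<in> carrier (L c)"
          for a b c x y z
          using that by simp
        \<comment> \<open>By induction on the tree, using multiplicativity of \<open>G\<close>; the
          restriction to degrees below \<open>n\<close> keeps every product where \<open>G\<close>
          is already known to be multiplicative.\<close>
        have G_value: "G (deg t) (bracket_value P t) = bracket_eval \<mu> f t"
          if "deg t < n" "set (letters t) \<subseteq> carrier V" for t
          using that
        proof (induction t)
          case (Letter v)
          then show ?case using G_Gen by simp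
        next
          case (Bracket s t u)
          have d: "(deg s, deg t, deg u) \<in> odd_triples (deg (Bracket s t u))" by (rule deg_triple) (rule refl)
          show ?case
            unfolding bracket_value.simps bracket_eval.simps
            by (subst G_P[OF _ d]) (use Bracket in \<open>auto intro!: bracket_value_closed[OF regular_below[of n]]\<close>)
        qed
        \<comment> \<open>No map on the piece of degree \<open>n\<close> exists yet: the outermost
          bracket is a pure tensor and is evaluated by \<open>\<phi>\<close>, while the three
          factors below it are evaluated by \<open>G\<close>.\<close>
        have \<phi>_bracket: "\<phi> (bracketed_tensor K L P t) = bracket_eval \<mu> f t"
          if t: "deg t = n" "set (letters t) \<subseteq> carrier V" for t
        proof (cases t)
          case (Letter v)
          then show ?thesis using t n p by simp
        next
          case (Bracket s u w)
          have d: "(deg s, deg u, deg w) \<in> odd_triples n" using t Bracket by (intro deg_triple) simp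
          have sum: "deg s + deg u + deg w = n" using t Bracket by simp
          have lt: "deg s < n" "deg u < n" "deg w < n" using odd_triples_bounds[OF d] by auto
          have sub: "set (letters s) \<subseteq> carrier V" "set (letters u) \<subseteq> carrier V" "set (letters w) \<subseteq> carrier V"
            using t Bracket by auto
          show ?thesis
            unfolding Bracket bracketed_tensor.simps sum bracket_eval.simps
            using lt sub by (simp add: \<phi>_pt[OF d] bracket_value_closed[OF regular_below[of n]] G_value)
        qed
        have \<phi>_relators: "\<phi> w = \<zero>\<^bsub>A\<^esub>" if w_rel: "w \<in> relators p" for w
        proof -
          obtain r vs where w: "w = foldr (\<lambda>js w. bracketed_tensor K L P (decode js vs) \<oplus>\<^bsub>T n\<^esub> w) r \<zero>\<^bsub>T n\<^esub>"
            and r: "coded_rel p r" and vs: "set vs \<subseteq> carrier V" "length vs = 2 * p + 1"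
            using w_rel unfolding relators_def n by blast
          have dec: "letters (decode js vs) = vs" if "js \<in> set r" for js
            using decode_coded_rel(1)[OF r that vs(2)] .
          have closed: "bracketed_tensor K L P (decode js vs) \<in> carrier (T n)" if "js \<in> set r" for js
            using dec[OF that] vs p n by (intro bracketed_tensor_closed regular_below) auto
          have "\<phi> w = foldr (\<lambda>js w. \<phi> (bracketed_tensor K L P (decode js vs)) \<oplus>\<^bsub>A\<^esub> w) r \<zero>\<^bsub>A\<^esub>"
            unfolding w by (rule module_hom_foldr[OF module_tensor_sum[OF regular_below] MA \<phi> closed])
          also have "\<dots> = foldr (\<lambda>js w. bracket_eval \<mu> f (decode js vs) \<oplus>\<^bsub>A\<^esub> w) r \<zero>\<^bsub>A\<^esub>"
            by (rule foldr_cong[OF refl refl]) (simp add: \<phi>_bracket dec vs n)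
          also have "\<dots> = \<zero>\<^bsub>A\<^esub>"
            by (rule A.coded_rel_eval_map[OF r _ vs(2)]) (use vs module_hom_mem[OF f] in auto)
          finally show ?thesis .
        qed
        have \<phi>_R: "\<phi> w = \<zero>\<^bsub>A\<^esub>" if "w \<in> R p" for w
          using that unfolding relation_space_eq n[symmetric]
          by (intro module_hom_span_zero[OF module_tensor_sum[OF regular_below] MA \<phi> relators_closed[OF regular_below, of p, folded n] \<phi>_relators])
        \<comment> \<open>The kernel of \<open>proj p\<close> lies in \<open>R p\<close>, where
          \<open>\<phi>\<close> vanishes, so \<open>\<phi>\<close> descends to the piece.\<close>
        obtain r where r: "r \<in> module_hom K (L n) A" and r_proj: "\<forall>w\<in>carrier (T n). r (proj p w) = \<phi> w"
          using module_hom_factor[OF module_tensor_sum[OF regular_below] module_L[OF p n regular_below] MA proj_hom[OF p n regular_below]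
              proj_surj[OF p n regular_below] \<phi> \<phi>_R[OF proj_zero[OF p n regular_below]]]
          by blast
        have "r (P (a, b, c) x y z) = \<mu> (G a x) (G b y) (G c z)"
          if "(a, b, c) \<in> odd_triples n" "x \<in> carrier (L a)" "y \<in> carrier (L b)" "z \<in> carrier (L c)"
          for a b c x y z
          unfolding P_eq[OF p n regular_below that(1)]
          using r_proj trilinear_closed[OF pure_tensor_trilinear[OF regular_below that(1)] that(2-4)] \<phi>_pt[OF that]
          by simp
        then have "Q G n r" using r p n by (auto simp: Q_def)
        then show ?thesis by (intro exI[of _ r])
      qed
    qed
  qed
  then show ?thesis unfolding Q_def .
qed

text \<open>The direct sum glues the graded maps to \<open>F\<close>. Both sides of the product rule
  are trilinear, so it is enough to compare them on homogeneous elements, where it is the product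
  rule of the components.\<close>

lemma free_algebra_hom_exists:
  assumes A: "partially_associative_algebra K A \<mu>" and f: "f \<in> module_hom K V A"
  shows "\<exists>F\<in>module_hom K FA A. (\<forall>v\<in>carrier V. F (free_inclusion K V v) = f v) \<and>
    (\<forall>x\<in>carrier FA. \<forall>y\<in>carrier FA. \<forall>z\<in>carrier FA. \<mu> (F x) (F y) (F z) = F (free_product K V x y z))"
proof -
  interpret A: partially_associative_algebra K A \<mu> by fact
  note MA = A.module_axioms
  obtain G where all: "\<forall>n. odd n \<longrightarrow> G n \<in> module_hom K (L n) A \<and>
    (n = 1 \<longrightarrow> (\<forall>v\<in>carrier V. G n (Gen v) = f v)) \<and>
    (\<forall>a b c x y z. (a, b, c) \<in> odd_triples n \<longrightarrow> x \<in> carrier (L a) \<longrightarrow> y \<in> carrier (L b) \<longrightarrow>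
      z \<in> carrier (L c) \<longrightarrow> G n (P (a, b, c) x y z) = \<mu> (G a x) (G b y) (G c z))"
    using piece_hom_exists[OF A f] by (elim exE)
  have G: "G n \<in> module_hom K (L n) A" if "odd n" for n
    using spec[OF all, of n] that by simp
  have G_Gen: "G 1 (Gen v) = f v" if "v \<in> carrier V" for v
    using spec[OF all, of 1] that by simp
  have G_P: "G n (P (a, b, c) x y z) = \<mu> (G a x) (G b y) (G c z)"
    if "odd n" "(a, b, c) \<in> odd_triples n" "x \<in> carrier (L a)" "y \<in> carrier (L b)" "z \<in> carrier (L c)"
    for n a b c x y z
    using spec[OF all, of n] that by simp
  have mods: "\<And>n. n \<in> {n. odd n} \<Longrightarrow> module K (L n)" by (simp add: module_piece)
  have "\<exists>F\<in>module_hom K (dsum {n. odd n} L) A. \<forall>n\<in>{n. odd n}. \<forall>x\<in>carrier (L n). F (hom_in n x) = G n x"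
    by (rule dsum_universal[OF mods MA]) (simp_all add: G)
  then obtain F where F: "F \<in> module_hom K FA A"
    and F_in: "\<And>n x. odd n \<Longrightarrow> x \<in> carrier (L n) \<Longrightarrow> F (hom_in n x) = G n x"
    unfolding free_algebra_def by blast
  have "\<mu> (F x) (F y) (F z) = F (free_product K V x y z)"
    if xyz: "x \<in> carrier FA" "y \<in> carrier FA" "z \<in> carrier FA" for x y z
  proof (rule trilinear_dsum_eqI[OF mods MA _ _ _ xyz[unfolded free_algebra_def]])
    show "trilinear K (dsum {n. odd n} L) (dsum {n. odd n} L) (dsum {n. odd n} L) A (\<lambda>x y z. \<mu> (F x) (F y) (F z))"
      unfolding free_algebra_def[symmetric] by (rule trilinear_comp[OF A.trilinear_product F F F])
    show "trilinear K (dsum {n. odd n} L) (dsum {n. odd n} L) (dsum {n. odd n} L) A (\<lambda>x y z. F (free_product K V x y z))"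
      unfolding free_algebra_def[symmetric] by (rule trilinear_hom[OF trilinear_free_product F])
    fix a b c x y z
    assume abc: "a \<in> {n. odd n}" "b \<in> {n. odd n}" "c \<in> {n. odd n}"
      and x: "x \<in> carrier (L a)" and y: "y \<in> carrier (L b)" and z: "z \<in> carrier (L c)"
    have d: "(a, b, c) \<in> odd_triples (a + b + c)" using abc by (simp add: odd_triples_def)
    have n: "odd (a + b + c)" using abc by simp
    have "F (free_product K V (hom_in a x) (hom_in b y) (hom_in c z)) = G (a + b + c) (P (a, b, c) x y z)"
      unfolding free_product_hom_in[OF d x y z]
      by (rule F_in[OF n trilinear_closed[OF trilinear_piece_product[OF d] x y z]])
    then show "\<mu> (F (hom_in a x)) (F (hom_in b y)) (F (hom_in c z)) =
        F (free_product K V (hom_in a x) (hom_in b y) (hom_in c z))"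
      using abc by (simp add: F_in x y z G_P[OF n d x y z])
  qed
  moreover have "F (free_inclusion K V v) = f v" if "v \<in> carrier V" for v
    using F_in[of 1 "Gen v"] carrier_L_1 G_Gen[OF that] that unfolding free_inclusion_eq by simp
  ultimately show ?thesis using F by blast
qed

section \<open>Uniqueness of the extension\<close>

lemma free_algebra_hom_unique:
  assumes A: "module K A"
    and F: "F \<in> module_hom K FA A" and F': "F' \<in> module_hom K FA A"
    and FP: "\<And>x y z. x \<in> carrier FA \<Longrightarrow> y \<in> carrier FA \<Longrightarrow> z \<in> carrier FA \<Longrightarrow>
      \<mu> (F x) (F y) (F z) = F (free_product K V x y z)"
    and FP': "\<And>x y z. x \<in> carrier FA \<Longrightarrow> y \<in> carrier FA \<Longrightarrow> z \<in> carrier FA \<Longrightarrow>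
      \<mu> (F' x) (F' y) (F' z) = F' (free_product K V x y z)"
    and eq: "\<And>v. v \<in> carrier V \<Longrightarrow> F (free_inclusion K V v) = F' (free_inclusion K V v)"
    and x: "x \<in> carrier FA"
  shows "F x = F' x"
proof -
  have pieces: "F (hom_in n x) = F' (hom_in n x)" if "odd n" "x \<in> carrier (L n)" for n x
    using that
  proof (induction n arbitrary: x rule: less_induct)
    case (less n)
    obtain p where n: "n = 2 * p + 1" using less.prems(1) by (rule oddE)
    show ?case
    proof (cases "p = 0")
      case True
      then have n1: "n = 1" using n by simp
      with less.prems carrier_L_1 obtain v where "v \<in> carrier V" "x = Gen v" by auto
      then show ?thesis using eq n1 unfolding free_inclusion_eq by simp
    next
      case False
      then have p: "p \<ge> 1" by simp
      note step = p n regular_below[of n]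
      obtain w where w: "w \<in> carrier (T n)" and x: "x = proj p w"
        using less.prems(2) unfolding proj_surj[OF step, symmetric] by blast
      note h = module_hom_comp[OF proj_hom[OF step] hom_in_hom[OF less.prems(1)]]
      note TM = module_tensor_sum[OF regular_below[of n]]
      \<comment> \<open>The induction runs over the representative \<open>w\<close> in the tensor
        sum, where pure tensors generate additively.\<close>
      have "F (hom_in n (proj p w)) = F' (hom_in n (proj p w))"
      proof (rule tensor_sum_induct[OF regular_below[of n] w])
        show "F (hom_in n (proj p \<zero>\<^bsub>T n\<^esub>)) = F' (hom_in n (proj p \<zero>\<^bsub>T n\<^esub>))"
          using module_hom_zero[OF TM A module_hom_comp[OF h F]] module_hom_zero[OF TM A module_hom_comp[OF h F']]
          by simp
      next
        fix a b c x y z assume d: "(a, b, c) \<in> odd_triples n"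
          and xyz: "x \<in> carrier (L a)" "y \<in> carrier (L b)" "z \<in> carrier (L c)"
        have odd: "odd a" "odd b" "odd c" and lt: "a < n" "b < n" "c < n"
          using odd_triples_bounds[OF d] by auto
        note mem = module_hom_mem[OF hom_in_hom[OF odd(1)] xyz(1)] module_hom_mem[OF hom_in_hom[OF odd(2)] xyz(2)]
          module_hom_mem[OF hom_in_hom[OF odd(3)] xyz(3)]
        \<comment> \<open>A projected pure tensor is a graded product, which is a product of three
          homogeneous elements of the free algebra. Multiplicativity then moves both maps to these
          factors of lower degree.\<close>
        show "F (hom_in n (proj p (pt n (a, b, c) x y z))) = F' (hom_in n (proj p (pt n (a, b, c) x y z)))"
          unfolding P_eq[OF step d, symmetric] free_product_hom_in[OF d xyz, symmetric]
            FP[OF mem, symmetric] FP'[OF mem, symmetric]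
          by (simp add: less.IH[OF lt(1) odd(1) xyz(1)] less.IH[OF lt(2) odd(2) xyz(2)] less.IH[OF lt(3) odd(3) xyz(3)])
      next
        fix u v assume uv: "u \<in> carrier (T n)" "v \<in> carrier (T n)"
          and "F (hom_in n (proj p u)) = F' (hom_in n (proj p u))" "F (hom_in n (proj p v)) = F' (hom_in n (proj p v))"
        then show "F (hom_in n (proj p (u \<oplus>\<^bsub>T n\<^esub> v))) = F' (hom_in n (proj p (u \<oplus>\<^bsub>T n\<^esub> v)))"
          using module_hom_add[OF module_hom_comp[OF h F] uv] module_hom_add[OF module_hom_comp[OF h F'] uv] by simp
      qed
      then show ?thesis using x by simp
    qed
  qed
  show ?thesis
    by (rule module_hom_dsum_eqI[OF _ A F[unfolded free_algebra_def] F'[unfolded free_algebra_def] _ x[unfolded free_algebra_def]])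
      (simp_all add: module_piece pieces)
qed

end

text \<open>Functions are total, so a map given only on the carrier has many representatives.
  Extensionality fixes the value outside the carrier and makes unique existence a statement about
  the map itself.\<close>

theorem proposition4:
  fixes K :: "'k ring" and V :: "('k, 'v) module" and A :: "('k, 'a) module"
    and \<mu> :: "'a \<Rightarrow> 'a \<Rightarrow> 'a \<Rightarrow> 'a" and f :: "'v \<Rightarrow> 'a"
  assumes "field K"
    and "\<And>n::nat. n > 0 \<Longrightarrow> [n] \<cdot>\<^bsub>K\<^esub> \<one>\<^bsub>K\<^esub> \<noteq> \<zero>\<^bsub>K\<^esub>"
    and "partially_associative_algebra K A \<mu>"
    and "vectorspace K V"
    and "linear_map K V A f"
  shows "\<exists>!F. F \<in> extensional (carrier (free_algebra K V)) \<and>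
    ternary_algebra_hom K (free_algebra K V) (free_product K V) A \<mu> F \<and>
    (\<forall>v\<in>carrier V. F (free_inclusion K V v) = f v)"
proof -
  interpret V: vectorspace K V by fact
  interpret A: partially_associative_algebra K A \<mu> by fact
  interpret f: linear_map K V A f by fact
  interpret free_ternary K V by (simp add: free_ternary_def V.module_axioms)
  note FA = module_free_algebra
  interpret FA: ternary_algebra K FA "free_product K V"
    by (intro ternary_algebra.intro vectorspace.intro ternary_algebra_axioms.intro FA assms(1)
        trilinearD[OF trilinear_free_product])
  \<comment> \<open>Since source and target are already known to be ternary algebras over
    \<open>K\<close>, the locale predicate reduces to linearity and compatibility with the
    products.\<close>
  have hom_iff: "ternary_algebra_hom K FA (free_product K V) A \<mu> F \<longleftrightarrow> F \<in> module_hom K FA A \<and>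
      (\<forall>x y z. x \<in> carrier FA \<longrightarrow> y \<in> carrier FA \<longrightarrow> z \<in> carrier FA \<longrightarrow>
        \<mu> (F x) (F y) (F z) = F (free_product K V x y z))" for F
    by (simp only: ternary_algebra_hom_def ternary_algebra_hom_axioms_def linear_map_def mod_hom_def
        mod_hom_axioms_def FA.ternary_algebra_axioms A.ternary_algebra_axioms FA.vectorspace_axioms
        A.vectorspace_axioms FA A.module_axioms simp_thms atomize_imp atomize_all)
  have inclusion: "free_inclusion K V v \<in> carrier FA" if "v \<in> carrier V" for v
    unfolding free_inclusion_eq
    by (rule module_hom_mem[OF hom_in_hom]) (use that carrier_L_1 in auto)
  obtain F where F: "F \<in> module_hom K FA A" and F_incl: "\<forall>v\<in>carrier V. F (free_inclusion K V v) = f v"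
    and F_prod: "\<forall>x\<in>carrier FA. \<forall>y\<in>carrier FA. \<forall>z\<in>carrier FA. \<mu> (F x) (F y) (F z) = F (free_product K V x y z)"
    using free_algebra_hom_exists[OF assms(3) f.f_hom] by (elim bexE conjE)
  \<comment> \<open>Restriction changes no value on the carrier, which is closed under all
    operations involved, so the morphism properties survive.\<close>
  let ?F = "restrict F (carrier FA)"
  show ?thesis
  proof (rule ex1I[of _ ?F])
    have "?F \<in> module_hom K FA A"
      by (rule module_homI)
        (simp_all add: module_hom_mem[OF F] module_hom_add[OF F] module_hom_smult[OF F] FA.M.a_closed FA.smult_closed)
    moreover have "\<mu> (?F x) (?F y) (?F z) = ?F (free_product K V x y z)"
      if "x \<in> carrier FA" "y \<in> carrier FA" "z \<in> carrier FA" for x y z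
      using F_prod that by (simp add: free_product_closed)
    ultimately have "ternary_algebra_hom K FA (free_product K V) A \<mu> ?F" unfolding hom_iff by blast
    moreover have "?F (free_inclusion K V v) = f v" if "v \<in> carrier V" for v
      using F_incl that by (simp add: inclusion)
    ultimately show "?F \<in> extensional (carrier FA) \<and> ternary_algebra_hom K FA (free_product K V) A \<mu> ?F \<and>
        (\<forall>v\<in>carrier V. ?F (free_inclusion K V v) = f v)"
      by (intro conjI ballI restrict_extensional)
  next
    fix H assume H: "H \<in> extensional (carrier FA) \<and> ternary_algebra_hom K FA (free_product K V) A \<mu> H \<and>
      (\<forall>v\<in>carrier V. H (free_inclusion K V v) = f v)"
    have H_ext: "H \<in> extensional (carrier FA)" using H by (rule conjunct1)
    have H_incl: "\<forall>v\<in>carrier V. H (free_inclusion K V v) = f v" using H by (elim conjE)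
    have H_hom: "H \<in> module_hom K FA A \<and> (\<forall>x y z. x \<in> carrier FA \<longrightarrow> y \<in> carrier FA \<longrightarrow> z \<in> carrier FA \<longrightarrow>
        \<mu> (H x) (H y) (H z) = H (free_product K V x y z))"
      using H unfolding hom_iff by (elim conjE) (rule conjI)
    show "H = ?F"
    proof (rule extensionalityI[OF H_ext restrict_extensional])
      fix x assume x: "x \<in> carrier FA"
      have "H x = F x"
        by (rule free_algebra_hom_unique[where \<mu> = \<mu>, OF A.module_axioms conjunct1[OF H_hom] F _ _ _ x])
          (simp_all add: H_hom F_prod H_incl F_incl)
      then show "H x = ?F x" using x by simp
    qed
  qed
qed

end
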